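(* Let $n\ge 3$ be odd, let $\Gamma = B_n$, $A = A(\Gamma)$ and $W = W(\Gamma)$. Let $w_0$ be the longest element of $W$, and put $e_i = s_i\cdots s_2s_1s_2\cdots s_i$ for $1\le i\le n$. There are precisely three equivalence classes of proper up-to-center-epimorphisms $A\to W$. These are represented by $\mu'$, $\nu_n^3$, $\nu_n^4$, where $$\mu'(\sigma_1) = w_0s_1,\quad \mu'(\sigma_i) = s_i \ \text{ for } 2\le i\le n,$$ $$\nu_n^3(\sigma_1) = w_0s_1,\quad \nu_n^3(\sigma_i) = e_{i-1}s_i \ \text{ for } 2\le i\le n,$$ $$\nu_n^4(\sigma_1) = 1,\quad \nu_n^4(\sigma_i) = e_{i-1}s_i \ \text{ for } 2\le i\le n.$$
   Context: The Coxeter graph $B_n$ has vertices $1,\dots,n$ with $m_{12}=4$, $m_{i,i+1}=3$ for $2\le i\le n-1$, and $m_{ij}=2$ for $|i-j|\ge 2$. The Artin group $A = A(B_n)$ is generated by $\sigma_1,\dots,\sigma_n$ subject to $\sigma_1\sigma_2\sigma_1\sigma_2=\sigma_2\sigma_1\sigma_2\sigma_1$, $\sigma_i\sigma_{i+1}\sigma_i=\sigma_{i+1}\sigma_i\sigma_{i+1}$ for $2\le i\le n-1$, and $\sigma_i\sigma_j=\sigma_j\sigma_i$ for $|i-j|\ge 2$. The Coxeter group $W = W(B_n)$ is the quotient of $A$ by the relations $\sigma_i^2=1$, and $s_i$ is the image of $\sigma_i$. There is an isomorphism $W\simeq (C_2)^n\rtimes \mathrm{Sym}_n$, where $C_2=\{\pm1\}$,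 under which $s_1=[-1,1,\dots,1]\in (C_2)^n$ and $s_i=(i-1,i)\in\mathrm{Sym}_n$ for $2\le i\le n$; then $e_i$ is the element of $(C_2)^n$ with $-1$ in position $i$ and $1$ elsewhere, and the element of maximal word length with respect to $s_1,\dots,s_n$ is $w_0=[-1,\dots,-1]$, which is central. Let $Z(W)$ denote the center of $W$. A homomorphism $\varphi: A\to W$ is an up-to-center-epimorphism if $W = \mathrm{Im}\,\varphi\cdot Z(W)$; it is proper if moreover it is not an epimorphism (not surjective). Two homomorphisms $\varphi_1,\varphi_2: A\to W$ are equivalent if there is an automorphism $\alpha$ of $W$ such that $\varphi_2=\alpha\circ\varphi_1$. *)

theory Defs
  imports "HOL-Algebra.Coset" "HOL-Algebra.Bij"
begin

section \<open>Groups given by generators and relations\<close>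

text \<open>A letter \<open>(x, True)\<close> stands for the generator \<open>x\<close>, and \<open>(x, False)\<close> for its inverse.\<close>

type_synonym 'a word = "('a \<times> bool) list"

definition words :: "'a set \<Rightarrow> 'a word set" where
  "words X = lists (X \<times> UNIV)"

definition positive_word :: "'a list \<Rightarrow> 'a word" where
  "positive_word xs = map (\<lambda>x. (x, True)) xs"

text \<open>A pair \<open>(u, v) \<in> R\<close> stands for the relation \<open>u = v\<close>.\<close>

inductive word_eq :: "'a set \<Rightarrow> ('a word \<times> 'a word) set \<Rightarrow> 'a word \<Rightarrow> 'a word \<Rightarrow> bool"
  for X R where
  rel: "(u, v) \<in> R \<Longrightarrow> u \<in> words X \<Longrightarrow> v \<in> words X \<Longrightarrow> word_eq X R u v"
| cancel: "x \<in> X \<Longrightarrow> word_eq X R [(x, b), (x, \<not> b)] []"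
| cong: "word_eq X R u u' \<Longrightarrow> word_eq X R v v' \<Longrightarrow> word_eq X R (u @ v) (u' @ v')"
| refl: "u \<in> words X \<Longrightarrow> word_eq X R u u"
| sym: "word_eq X R u v \<Longrightarrow> word_eq X R v u"
| trans: "word_eq X R u v \<Longrightarrow> word_eq X R v w \<Longrightarrow> word_eq X R u w"

definition word_class :: "'a set \<Rightarrow> ('a word \<times> 'a word) set \<Rightarrow> 'a word \<Rightarrow> 'a word set" where
  "word_class X R u = {v. word_eq X R u v}"

definition presented_group :: "'a set \<Rightarrow> ('a word \<times> 'a word) set \<Rightarrow> 'a word set monoid" where
  "presented_group X R =
     \<lparr>carrier = word_class X R ` words X,
      mult = (\<lambda>U V. \<Union>u\<in>U. \<Union>v\<in>V. word_class X R (u @ v)),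
      one = word_class X R []\<rparr>"

lemma word_eq_in_words: "word_eq X R u v \<Longrightarrow> u \<in> words X \<and> v \<in> words X"
  by (induction rule: word_eq.induct) (auto simp: words_def)

lemma word_class_eq_iff:
  "u \<in> words X \<Longrightarrow> word_class X R u = word_class X R v \<longleftrightarrow> word_eq X R u v"
proof
  assume u: "u \<in> words X" and "word_class X R u = word_class X R v"
  then have "u \<in> word_class X R v"
    using word_eq.refl[OF u] by (auto simp: word_class_def)
  then show "word_eq X R u v"
    by (simp add: word_class_def word_eq.sym)
next
  assume "word_eq X R u v"
  then show "word_class X R u = word_class X R v"
    unfolding word_class_def by (blast intro: word_eq.sym word_eq.trans)
qed

lemma presented_group_mult:
  assumes "u \<in> words X" "v \<in> words X"
  shows "word_class X R u \<otimes>\<^bsub>presented_group X R\<^esub> word_class X R v = word_class X R (u @ v)"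
proof -
  have "word_class X R (u' @ v') = word_class X R (u @ v)"
    if "u' \<in> word_class X R u" "v' \<in> word_class X R v" for u' v'
  proof -
    have "word_eq X R (u @ v) (u' @ v')"
      using that by (simp add: word_class_def word_eq.cong)
    moreover from this have "u @ v \<in> words X" by (simp add: word_eq_in_words)
    ultimately show ?thesis using word_class_eq_iff[of "u @ v" X R "u' @ v'"] by simp
  qed
  moreover have "u \<in> word_class X R u" "v \<in> word_class X R v"
    using assms by (simp_all add: word_class_def word_eq.refl)
  ultimately have "(\<Union>u'\<in>word_class X R u. \<Union>v'\<in>word_class X R v. word_class X R (u' @ v'))
      = word_class X R (u @ v)"
    by blast
  then show ?thesis
    by (simp add: presented_group_def)
qed

lemma word_eq_inverse:
  "u \<in> words X \<Longrightarrow> word_eq X R (rev (map (\<lambda>(x, b). (x, \<not> b)) u) @ u) []"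
proof (induction u)
  case Nil
  then show ?case by (simp add: words_def word_eq.refl)
next
  case (Cons a u)
  obtain x b where a: "a = (x, b)" by (cases a)
  let ?i = "rev (map (\<lambda>(x, b). (x, \<not> b)) u)"
  have xu: "x \<in> X" "u \<in> words X" and i: "?i \<in> words X"
    using Cons.prems a by (auto simp: words_def)
  have "word_eq X R [(x, \<not> b), (x, \<not> \<not> b)] []"
    by (rule word_eq.cancel) (fact xu)
  then have "word_eq X R ([(x, \<not> b), (x, b)] @ u) ([] @ u)"
    using word_eq.cong word_eq.refl xu by fastforce
  then have "word_eq X R (?i @ [(x, \<not> b), (x, b)] @ u) (?i @ u)"
    using word_eq.cong word_eq.refl[OF i] by fastforce
  then show ?case
    using Cons.IH xu a by (auto intro: word_eq.trans)
qed

lemma group_presented_group: "group (presented_group X R)"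
proof (rule groupI)
  let ?G = "presented_group X R"
  note m = presented_group_mult
  have car: "carrier ?G = word_class X R ` words X"
    and one: "\<one>\<^bsub>?G\<^esub> = word_class X R []"
    by (simp_all add: presented_group_def)
  have app: "u @ v \<in> words X" if "u \<in> words X" "v \<in> words X" for u v :: "'a word"
    using that by (auto simp: words_def)
  have nil: "[] \<in> words X" by (simp add: words_def)
  show "\<one>\<^bsub>?G\<^esub> \<in> carrier ?G" using nil by (simp add: car one)
  fix U assume U: "U \<in> carrier ?G"
  then obtain u where u: "u \<in> words X" "U = word_class X R u" by (auto simp: car)
  show "\<one>\<^bsub>?G\<^esub> \<otimes>\<^bsub>?G\<^esub> U = U" using u nil by (simp add: one m)
  let ?i = "rev (map (\<lambda>(x, b). (x, \<not> b)) u)"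
  have i: "?i \<in> words X" using u by (auto simp: words_def)
  then have "word_class X R ?i \<otimes>\<^bsub>?G\<^esub> U = \<one>\<^bsub>?G\<^esub>"
    using word_eq_inverse[OF u(1)] u by (simp add: m one word_class_eq_iff app)
  then show "\<exists>V\<in>carrier ?G. V \<otimes>\<^bsub>?G\<^esub> U = \<one>\<^bsub>?G\<^esub>" using i car by blast
  fix V assume V: "V \<in> carrier ?G"
  then obtain v where v: "v \<in> words X" "V = word_class X R v" by (auto simp: car)
  show "U \<otimes>\<^bsub>?G\<^esub> V \<in> carrier ?G" using u v by (simp add: m car app)
  fix Z assume Z: "Z \<in> carrier ?G"
  then obtain z where z: "z \<in> words X" "Z = word_class X R z" by (auto simp: car)
  show "U \<otimes>\<^bsub>?G\<^esub> V \<otimes>\<^bsub>?G\<^esub> Z = U \<otimes>\<^bsub>?G\<^esub> (V \<otimes>\<^bsub>?G\<^esub> Z)"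
    using u v z by (simp add: m app)
qed


section \<open>Artin groups and Coxeter groups\<close>

definition alternating :: "'a \<Rightarrow> 'a \<Rightarrow> nat \<Rightarrow> 'a list" where
  "alternating x y k = map (\<lambda>j. if even j then x else y) [0..<k]"

text \<open>A Coxeter graph is given by its vertex set \<open>X\<close> and its labels \<open>m\<close>. The value \<open>m x y = 0\<close>
  encodes the label \<open>\<infinity>\<close>: both sides of the braid relation are then empty.\<close>

definition braid_relations :: "'a set \<Rightarrow> ('a \<Rightarrow> 'a \<Rightarrow> nat) \<Rightarrow> ('a word \<times> 'a word) set" where
  "braid_relations X m =
     {(positive_word (alternating x y (m x y)), positive_word (alternating y x (m x y))) | x y.
        x \<in> X \<and> y \<in> X \<and> x \<noteq> y}"

definition artin_group :: "'a set \<Rightarrow> ('a \<Rightarrow> 'a \<Rightarrow> nat) \<Rightarrow> 'a word set monoid" where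
  "artin_group X m = presented_group X (braid_relations X m)"

definition artin_gen :: "'a set \<Rightarrow> ('a \<Rightarrow> 'a \<Rightarrow> nat) \<Rightarrow> 'a \<Rightarrow> 'a word set" where
  "artin_gen X m x = word_class X (braid_relations X m) (positive_word [x])"

definition coxeter_relations :: "'a set \<Rightarrow> ('a \<Rightarrow> 'a \<Rightarrow> nat) \<Rightarrow> ('a word \<times> 'a word) set" where
  "coxeter_relations X m = braid_relations X m \<union> {(positive_word [x, x], []) | x. x \<in> X}"

definition coxeter_group :: "'a set \<Rightarrow> ('a \<Rightarrow> 'a \<Rightarrow> nat) \<Rightarrow> 'a word set monoid" where
  "coxeter_group X m = presented_group X (coxeter_relations X m)"

definition coxeter_gen :: "'a set \<Rightarrow> ('a \<Rightarrow> 'a \<Rightarrow> nat) \<Rightarrow> 'a \<Rightarrow> 'a word set" where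
  "coxeter_gen X m x = word_class X (coxeter_relations X m) (positive_word [x])"

definition list_product :: "('g, 'b) monoid_scheme \<Rightarrow> 'g list \<Rightarrow> 'g" where
  "list_product G gs = foldr (mult G) gs (one G)"

text \<open>Inverses of the elements of \<open>Y\<close> are not allowed as letters; in a Coxeter group
  this makes no difference since the generators are involutions.\<close>

definition word_length :: "('g, 'b) monoid_scheme \<Rightarrow> 'g set \<Rightarrow> 'g \<Rightarrow> nat" where
  "word_length G Y g = (LEAST k. \<exists>gs. set gs \<subseteq> Y \<and> length gs = k \<and> list_product G gs = g)"

definition longest_element :: "('g, 'b) monoid_scheme \<Rightarrow> 'g set \<Rightarrow> 'g" where
  "longest_element G Y =
     (THE w. w \<in> carrier G \<and> (\<forall>v\<in>carrier G. word_length G Y v \<le> word_length G Y w))"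


section \<open>Homomorphisms up to the center\<close>

definition center :: "('g, 'b) monoid_scheme \<Rightarrow> 'g set" where
  "center G = {z \<in> carrier G. \<forall>g\<in>carrier G. z \<otimes>\<^bsub>G\<^esub> g = g \<otimes>\<^bsub>G\<^esub> z}"

text \<open>Homomorphisms are taken to be extensional, so that each homomorphism of groups
  is represented by exactly one function.\<close>

definition up_to_center_epi ::
    "('g, 'b) monoid_scheme \<Rightarrow> ('h, 'c) monoid_scheme \<Rightarrow> ('g \<Rightarrow> 'h) set" where
  "up_to_center_epi G H =
     {f \<in> hom G H \<inter> extensional (carrier G). carrier H = f ` carrier G <#>\<^bsub>H\<^esub> center H}"

definition proper_up_to_center_epi ::
    "('g, 'b) monoid_scheme \<Rightarrow> ('h, 'c) monoid_scheme \<Rightarrow> ('g \<Rightarrow> 'h) set" where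
  "proper_up_to_center_epi G H = up_to_center_epi G H - epi G H"

definition hom_equivalence ::
    "('g, 'b) monoid_scheme \<Rightarrow> ('h, 'c) monoid_scheme \<Rightarrow> (('g \<Rightarrow> 'h) \<times> ('g \<Rightarrow> 'h)) set" where
  "hom_equivalence G H =
     {(f1, f2). f1 \<in> hom G H \<inter> extensional (carrier G) \<and> f2 \<in> hom G H \<inter> extensional (carrier G) \<and>
        (\<exists>\<alpha>\<in>auto H. f2 = compose (carrier G) \<alpha> f1)}"


section \<open>Type \<open>B\<close>\<close>

definition coxeter_B :: "nat \<Rightarrow> nat \<Rightarrow> nat" where
  "coxeter_B i j =
     (if i = j then 1
      else if {i, j} = {1, 2} then 4
      else if j = i + 1 \<or> i = j + 1 then 3
      else 2)"

abbreviation artin_B :: "nat \<Rightarrow> nat word set monoid" where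
  "artin_B n \<equiv> artin_group {1..n} coxeter_B"

abbreviation sigma_B :: "nat \<Rightarrow> nat \<Rightarrow> nat word set" where
  "sigma_B n i \<equiv> artin_gen {1..n} coxeter_B i"

abbreviation W_B :: "nat \<Rightarrow> nat word set monoid" where
  "W_B n \<equiv> coxeter_group {1..n} coxeter_B"

abbreviation s_B :: "nat \<Rightarrow> nat \<Rightarrow> nat word set" where
  "s_B n i \<equiv> coxeter_gen {1..n} coxeter_B i"

definition w0_B :: "nat \<Rightarrow> nat word set" where
  "w0_B n = longest_element (W_B n) (s_B n ` {1..n})"

text \<open>The list of indices is \<open>i, \<dots>, 2, 1, 2, \<dots>, i\<close>.\<close>

definition e_B :: "nat \<Rightarrow> nat \<Rightarrow> nat word set" where
  "e_B n i = list_product (W_B n) (map (s_B n) (rev [2..<i+1] @ [1] @ [2..<i+1]))"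

end

theory Submission
  imports Defs "HOL-Combinatorics.Cycles"
begin

text \<open>
  A homomorphism \<open>\<phi>: A \<rightarrow> W\<close> whose image generates \<open>W\<close> together with the center induces a
  homomorphism to \<open>Sym n\<close> with non-abelian image, so the images \<open>t\<^sub>1, \<dots>, t\<^sub>n\<^sub>-\<^sub>1\<close> of
  \<open>\<sigma>\<^sub>2, \<dots>, \<sigma>\<^sub>n\<close> are not all equal. By Artin's theorem they are then the
  standard transpositions, up to a relabelling. For this, let the strands \<open>3, \<dots>, n\<close> act on
  the non-trivial cycles of \<open>t\<^sub>1\<close>: there are at most \<open>n/2\<close> of them, so by induction on the
  number of strands the action is cyclic, and \<open>t\<^sub>3\<close>, \<open>t\<^sub>4\<close> agree on the support of \<open>t\<^sub>1\<close>.
  They must therefore differ on the fixed points of \<open>t\<^sub>1\<close>, where again by induction there are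
  at least \<open>n - 2\<close> points; hence \<open>t\<^sub>1\<close> moves only two points.

  In the signed permutation model of \<open>W\<close>, the braid relations determine the signs of
  \<open>\<phi> \<sigma>\<^sub>i\<close> up to conjugation by a diagonal element and up to the automorphism
  \<open>g \<mapsto> w\<^sub>0\<^sup>s g\<close>, where \<open>s\<close> is the parity of the permutation underlying \<open>g\<close>. Eight
  homomorphisms remain: two are not surjective even up to the center, three are surjective (one of
  them only because \<open>n\<close> is odd), and the other three are \<open>\<mu>'\<close>,
  \<open>\<nu>\<^sub>n\<^sup>3\<close> and \<open>\<nu>\<^sub>n\<^sup>4\<close>.

  That \<open>W\<close> is the group of signed permutations follows by counting: \<open>W\<close> has normal forms
  \<open>x\<^sub>1 \<cdots> x\<^sub>n\<close>, where \<open>x\<^sub>i\<close> is an initial segment of \<open>s\<^sub>i \<cdots> s\<^sub>2 s\<^sub>1 s\<^sub>2 \<cdots> s\<^sub>i\<close>.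
  There is a unique normal form of length \<open>n\<^sup>2\<close>; it represents \<open>[-1, \<dots>, -1]\<close>, and an
  inversion count shows that it is reduced, so that \<open>w\<^sub>0 = [-1, \<dots>, -1]\<close>.
\<close>

section \<open>Braid relations between bijections\<close>

text \<open>Artin's theorem is proved for bijections of an arbitrary finite set, because the
  induction applies it to sets of cycles and of fixed points; a cycle is replaced by a chosen
  representative, so the type of the points never changes. Two strands are lost at each step because
  the generators far from \<open>t 1\<close> are those of the strands from 3 on. A cyclic action on
  the cycles of \<open>t 1\<close> says only that \<open>t 3\<close> and \<open>t 4\<close> agree up
  to powers of \<open>t 1\<close>, with exponents that vary from point to point. To turn this into
  equality a third generator commuting with both is used, \<open>t 6\<close>; this takes seven
  strands, so five strands need an argument of their own. Oddness of n avoids two exceptional cases,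
  four strands (where \<open>t 1 = t 3\<close> is possible) and six. It also makes the product of
  the signs of \<open>w\<^sub>0\<close> equal to -1. Properness rests on this: each of the three
  images lies in the kernel of a character of W with values in {1, -1}, while the central element
  \<open>w\<^sub>0\<close> does not.\<close>

text \<open>\<open>m\<close> counts strands, so the generators are \<open>t 1\<close> to
  \<open>t (m - 1)\<close>. The relations are required only on \<open>X\<close>; the same
  \<open>t\<close> can thus be restricted to an invariant subset without being redefined.\<close>

definition braid_on :: "nat \<Rightarrow> 'a set \<Rightarrow> (nat \<Rightarrow> 'a \<Rightarrow> 'a) \<Rightarrow> bool" where
  "braid_on m X t \<longleftrightarrow>
     (\<forall>i. 1 \<le> i \<longrightarrow> i < m \<longrightarrow> bij_betw (t i) X X) \<and>
     (\<forall>i j x. 1 \<le> i \<longrightarrow> i + 2 \<le> j \<longrightarrow> j < m \<longrightarrow> x \<in> X \<longrightarrow> t i (t j x) = t j (t i x)) \<and>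
     (\<forall>i x. 1 \<le> i \<longrightarrow> Suc i < m \<longrightarrow> x \<in> X \<longrightarrow>
        t i (t (Suc i) (t i x)) = t (Suc i) (t i (t (Suc i) x)))"

lemma braid_onI:
  assumes "\<And>i. 1 \<le> i \<Longrightarrow> i < m \<Longrightarrow> bij_betw (t i) X X"
    and "\<And>i j x. 1 \<le> i \<Longrightarrow> i + 2 \<le> j \<Longrightarrow> j < m \<Longrightarrow> x \<in> X \<Longrightarrow> t i (t j x) = t j (t i x)"
    and "\<And>i x. 1 \<le> i \<Longrightarrow> Suc i < m \<Longrightarrow> x \<in> X \<Longrightarrow>
      t i (t (Suc i) (t i x)) = t (Suc i) (t i (t (Suc i) x))"
  shows "braid_on m X t"
  unfolding braid_on_def using assms by blast

lemma braid_on_bij: "braid_on m X t \<Longrightarrow> 1 \<le> i \<Longrightarrow> i < m \<Longrightarrow> bij_betw (t i) X X"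
  unfolding braid_on_def by blast

lemma braid_on_closed: "braid_on m X t \<Longrightarrow> 1 \<le> i \<Longrightarrow> i < m \<Longrightarrow> x \<in> X \<Longrightarrow> t i x \<in> X"
  using braid_on_bij bij_betwE by blast

lemma braid_on_commute:
  assumes "braid_on m X t" "1 \<le> i" "i < m" "1 \<le> j" "j < m" "i + 2 \<le> j \<or> j + 2 \<le> i" "x \<in> X"
  shows "t i (t j x) = t j (t i x)"
  using assms unfolding braid_on_def by metis

lemma braid_on_braid:
  "braid_on m X t \<Longrightarrow> 1 \<le> i \<Longrightarrow> Suc i < m \<Longrightarrow> x \<in> X \<Longrightarrow>
    t i (t (Suc i) (t i x)) = t (Suc i) (t i (t (Suc i) x))"
  unfolding braid_on_def by blast

lemma braid_on_shift:
  assumes t: "braid_on (m + k) X t"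
  shows "braid_on m X (\<lambda>i. t (i + k))"
proof (rule braid_onI)
  show "bij_betw (t (i + k)) X X" if "1 \<le> i" "i < m" for i
    using braid_on_bij[OF t] that by simp
  show "t (i + k) (t (j + k) x) = t (j + k) (t (i + k) x)"
    if "1 \<le> i" "i + 2 \<le> j" "j < m" "x \<in> X" for i j x
    using braid_on_commute[OF t, of "i + k" "j + k" x] that by simp
  show "t (i + k) (t (Suc i + k) (t (i + k) x)) = t (Suc i + k) (t (i + k) (t (Suc i + k) x))"
    if "1 \<le> i" "Suc i < m" "x \<in> X" for i x
    using braid_on_braid[OF t, of "i + k" x] that by simp
qed

lemma braid_on_mono:
  assumes t: "braid_on m X t" and "k \<le> m"
  shows "braid_on k X t"
  by (rule braid_onI) (use assms braid_on_bij[OF t] braid_on_commute[OF t] braid_on_braid[OF t] in auto)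

lemma braid_on_subset:
  assumes t: "braid_on m X t" and "Y \<subseteq> X" and Y: "\<And>i. 1 \<le> i \<Longrightarrow> i < m \<Longrightarrow> t i ` Y = Y"
  shows "braid_on m Y t"
proof (rule braid_onI)
  show "bij_betw (t i) Y Y" if "1 \<le> i" "i < m" for i
    using bij_betw_subset[OF braid_on_bij[OF t that] assms(2)] Y[OF that] by blast
qed (use assms(2) braid_on_commute[OF t] braid_on_braid[OF t] in auto)

section \<open>How equalities between braid generators spread\<close>

text \<open>If \<open>u\<close> and \<open>v\<close> commute, the relation
  \<open>u v u = v u v\<close> becomes \<open>u u v = u v v\<close>, and cancelling leaves
  \<open>u = v\<close>. Most later coincidences of generators come from here.\<close>

lemma commuting_braid_eq:
  assumes u: "bij_betw u X X" and v: "bij_betw v X X"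
    and c: "\<And>x. x \<in> X \<Longrightarrow> u (v x) = v (u x)"
    and b: "\<And>x. x \<in> X \<Longrightarrow> u (v (u x)) = v (u (v x))"
    and x: "x \<in> X"
  shows "u x = v x"
proof -
  have uX: "u y \<in> X" and vX: "v y \<in> X" if "y \<in> X" for y
    using u v that bij_betwE by blast+
  have "v (u (u x)) = v (u (v x))" using b[OF x] c[OF uX[OF x]] by simp
  then have "u (u x) = u (v x)" by (metis bij_betw_def inj_onD uX v vX x)
  then show ?thesis by (metis bij_betw_def inj_onD u uX vX x)
qed

text \<open>\<open>t k\<close> commutes with \<open>t i\<close>, hence with the equal map
  \<open>t j\<close>, to which it is also braided.\<close>

lemma braid_on_eq_step:
  assumes t: "braid_on m X t" and ij: "1 \<le> i" "i < m" "1 \<le> j" "j < m"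
    and k: "1 \<le> k" "k < m" "k = Suc j \<or> j = Suc k" "i + 2 \<le> k \<or> k + 2 \<le> i"
    and eq: "\<And>x. x \<in> X \<Longrightarrow> t i x = t j x" and x: "x \<in> X"
  shows "t j x = t k x"
proof (rule commuting_braid_eq[OF _ _ _ _ x])
  show "bij_betw (t j) X X" "bij_betw (t k) X X" using braid_on_bij[OF t] ij k by auto
  fix y assume y: "y \<in> X"
  have "t i (t k y) = t k (t i y)"
    using braid_on_commute[OF t ij(1,2) k(1,2) k(4) y] .
  then show "t j (t k y) = t k (t j y)"
    using eq y braid_on_closed[OF t k(1,2) y] by simp
  show "t j (t k (t j y)) = t k (t j (t k y))"
    using braid_on_braid[OF t _ _ y] ij(3,4) k(1-3) by metis
qed

definition all_equal_on :: "nat \<Rightarrow> 'a set \<Rightarrow> (nat \<Rightarrow> 'a \<Rightarrow> 'a) \<Rightarrow> bool" where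
  "all_equal_on m X t \<longleftrightarrow>
     (\<forall>i j x. 1 \<le> i \<longrightarrow> i < m \<longrightarrow> 1 \<le> j \<longrightarrow> j < m \<longrightarrow> x \<in> X \<longrightarrow> t i x = t j x)"

lemma all_equal_onD:
  "all_equal_on m X t \<Longrightarrow> 1 \<le> i \<Longrightarrow> i < m \<Longrightarrow> 1 \<le> j \<Longrightarrow> j < m \<Longrightarrow> x \<in> X \<Longrightarrow> t i x = t j x"
  unfolding all_equal_on_def by blast

text \<open>\<open>t (i + 2)\<close> commutes with \<open>t i = t (i + 1)\<close>, so the equality
  spreads upwards, and in the same way downwards. Hence in an action that is not cyclic no two
  consecutive generators agree.\<close>

lemma all_equal_onI_consecutive:
  assumes t: "braid_on m X t" and i: "1 \<le> i" "Suc i < m"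
    and eq: "\<And>x. x \<in> X \<Longrightarrow> t i x = t (Suc i) x"
  shows "all_equal_on m X t"
proof -
  have up: "Suc k < m \<longrightarrow> (\<forall>x\<in>X. t k x = t (Suc k) x)" if "i \<le> k" for k
    using that
  proof (induction k rule: dec_induct)
    case base
    then show ?case using eq by simp
  next
    case (step k)
    then show ?case
      using braid_on_eq_step[OF t, of k "Suc k" "Suc (Suc k)"] i by simp
  qed
  have down: "1 \<le> k \<longrightarrow> (\<forall>x\<in>X. t k x = t (Suc k) x)" if "k \<le> i" for k
    using that
  proof (induction k rule: inc_induct)
    case base
    then show ?case using eq by simp
  next
    case (step k)
    then show ?case
      using braid_on_eq_step[OF t, of "Suc (Suc k)" "Suc k" k] i by simp
  qed
  have all: "\<forall>x\<in>X. t k x = t (Suc k) x" if "1 \<le> k" "Suc k < m" for k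
    using up[of k] down[of k] that by (cases "i \<le> k") auto
  have "k < m \<longrightarrow> (\<forall>x\<in>X. t k x = t 1 x)" if "1 \<le> k" for k
    using that
  proof (induction k rule: dec_induct)
    case base
    then show ?case by simp
  next
    case (step k)
    then show ?case using all[of k] by (metis Suc_lessD)
  qed
  then show ?thesis unfolding all_equal_on_def by metis
qed

section \<open>Artin's theorem for an odd number of strands\<close>

text \<open>Only non-negative powers occur; on a finite set a bijection has finite order, and this
  makes the relation symmetric.\<close>

definition same_cycle :: "('a \<Rightarrow> 'a) \<Rightarrow> 'a \<Rightarrow> 'a \<Rightarrow> bool" where
  "same_cycle c x y \<longleftrightarrow> (\<exists>k. y = (c ^^ k) x)"

lemma same_cycle_refl: "same_cycle c x x"
  unfolding same_cycle_def by (metis funpow_0)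

lemma same_cycle_trans: "same_cycle c x y \<Longrightarrow> same_cycle c y z \<Longrightarrow> same_cycle c x z"
  unfolding same_cycle_def by (metis funpow_add comp_apply)

lemma same_cycle_step: "same_cycle c x (c x)"
  unfolding same_cycle_def by (rule exI[of _ 1]) simp

lemma funpow_closed:
  "bij_betw c X X \<Longrightarrow> x \<in> X \<Longrightarrow> (c ^^ k) x \<in> X"
  by (induction k) (auto dest: bij_betwE)

lemma bij_betw_finite_order:
  assumes "bij_betw c X X" "finite X"
  obtains N where "N > 0" "\<And>x. x \<in> X \<Longrightarrow> (c ^^ N) x = x"
proof -
  let ?p = "\<lambda>x. if x \<in> X then c x else x"
  have "bij_betw ?p X X" using assms(1) by (rule bij_betw_cong[THEN iffD1, rotated]) simp
  then have "?p permutes X" by (rule bij_imp_permutes) simp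
  then obtain N where N: "?p ^^ N = id" "N > 0"
    using assms(2) permutation_permutes by (metis permutation_is_nilpotent)
  have "x \<in> X \<Longrightarrow> (?p ^^ k) x = (c ^^ k) x" for x k
    using funpow_closed[OF assms(1)] by (induction k) auto
  then show thesis using that[of N] N by (metis id_apply)
qed

lemma same_cycle_sym:
  assumes "bij_betw c X X" "finite X" "x \<in> X" "same_cycle c x y"
  shows "same_cycle c y x"
proof -
  obtain N where N: "N > 0" "\<And>x. x \<in> X \<Longrightarrow> (c ^^ N) x = x"
    using bij_betw_finite_order[OF assms(1,2)] by blast
  obtain k where k: "y = (c ^^ k) x" using assms(4) by (auto simp: same_cycle_def)
  have NM: "(c ^^ (N * j)) x = x" for j
    by (induction j) (use N(2) assms(3) in \<open>auto simp: funpow_add\<close>)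
  \<comment> \<open>\<open>N * k\<close> is a multiple of \<open>N\<close> and at least
    \<open>k\<close>, so this power of \<open>c\<close> undoes \<open>c ^^ k\<close>.\<close>
  have "(c ^^ (N * k - k)) y = (c ^^ (N * k - k + k)) x"
    using k by (simp only: funpow_add comp_apply)
  also have "N * k - k + k = N * k" using N(1) by (cases N) auto
  finally show ?thesis using NM unfolding same_cycle_def by metis
qed

lemma funpow_commute_on:
  assumes "bij_betw c X X" "\<And>x. x \<in> X \<Longrightarrow> g (c x) = c (g x)" "x \<in> X"
  shows "g ((c ^^ k) x) = (c ^^ k) (g x)"
  by (induction k) (use assms funpow_closed[OF assms(1)] in auto)

lemma same_cycle_map:
  assumes "bij_betw c X X" "\<And>x. x \<in> X \<Longrightarrow> g (c x) = c (g x)" "x \<in> X" "same_cycle c x y"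
  shows "same_cycle c (g x) (g y)"
  using assms funpow_commute_on[of c X g x, OF assms(1,2,3)] by (auto simp: same_cycle_def)

text \<open>At \<open>x\<close> both \<open>u\<close> and \<open>v\<close> are \<open>w\<close>
  followed by a power of \<open>c\<close>. These exponents are known only at \<open>x\<close>;
  commutation with \<open>w\<close> replaces \<open>u (w x)\<close> by \<open>w (u x)\<close>, where
  the known exponent applies. Both products become the same power of \<open>c\<close> applied to
  \<open>w (w x)\<close>.\<close>

lemma commute_modulo_cycles:
  assumes c: "bij_betw c X X"
    and gX: "u \<in> X \<rightarrow> X" "v \<in> X \<rightarrow> X" "w \<in> X \<rightarrow> X"
    and gc: "\<And>x. x \<in> X \<Longrightarrow> u (c x) = c (u x)" "\<And>x. x \<in> X \<Longrightarrow> v (c x) = c (v x)"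
      "\<And>x. x \<in> X \<Longrightarrow> w (c x) = c (w x)"
    and wu: "\<And>x. x \<in> X \<Longrightarrow> u (w x) = w (u x)" and wv: "\<And>x. x \<in> X \<Longrightarrow> v (w x) = w (v x)"
    and eq: "same_cycle c (w x) (u x)" "same_cycle c (w x) (v x)"
    and x: "x \<in> X"
  shows "u (v x) = v (u x)"
proof -
  obtain k l where k: "u x = (c ^^ k) (w x)" and l: "v x = (c ^^ l) (w x)"
    using eq by (auto simp: same_cycle_def)
  have wx: "w x \<in> X" "w (w x) \<in> X" using gX x by (auto simp: Pi_iff)
  note fc = funpow_commute_on[of c X, OF c]
  have "u (v x) = (c ^^ l) (u (w x))" using l fc[of u "w x" l] gc(1) wx by simp
  also have "\<dots> = (c ^^ l) (w ((c ^^ k) (w x)))" using wu[OF x] k by simp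
  also have "\<dots> = (c ^^ l) ((c ^^ k) (w (w x)))" using fc[of w "w x" k] gc(3) wx by simp
  also have "\<dots> = (c ^^ k) ((c ^^ l) (w (w x)))" by (metis add.commute comp_apply funpow_add)
  also have "\<dots> = (c ^^ k) (w ((c ^^ l) (w x)))" using fc[of w "w x" l] gc(3) wx by simp
  also have "\<dots> = (c ^^ k) (v (w x))" using wv[OF x] l by simp
  also have "\<dots> = v (u x)" using k fc[of v "w x" k] gc(2) wx by simp
  finally show ?thesis .
qed

text \<open>For a bijection of a finite set the predicate \<open>same_cycle c x\<close> depends only
  on the cycle of \<open>x\<close>, and therefore so does the choice. Representatives turn the set
  of cycles into a subset of \<open>X\<close>, to which an induction hypothesis of the same type
  applies.\<close>

definition cycle_rep :: "('a \<Rightarrow> 'a) \<Rightarrow> 'a \<Rightarrow> 'a" where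
  "cycle_rep c x = (SOME y. same_cycle c x y)"

definition moved :: "('a \<Rightarrow> 'a) \<Rightarrow> 'a set \<Rightarrow> 'a set" where
  "moved c X = {x \<in> X. c x \<noteq> x}"

lemma same_cycle_rep: "same_cycle c x (cycle_rep c x)"
  unfolding cycle_rep_def by (rule someI) (rule same_cycle_refl)

lemma same_cycle_closed: "bij_betw c X X \<Longrightarrow> x \<in> X \<Longrightarrow> same_cycle c x y \<Longrightarrow> y \<in> X"
  unfolding same_cycle_def using funpow_closed by fast

lemma cycle_rep_eq_iff:
  assumes "bij_betw c X X" "finite X" "x \<in> X" "y \<in> X"
  shows "cycle_rep c x = cycle_rep c y \<longleftrightarrow> same_cycle c x y"
proof
  assume "cycle_rep c x = cycle_rep c y"
  then have "same_cycle c x (cycle_rep c y)" using same_cycle_rep[of c x] by simp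
  moreover have "same_cycle c (cycle_rep c y) y"
    using same_cycle_sym[OF assms(1,2,4) same_cycle_rep] .
  ultimately show "same_cycle c x y" by (rule same_cycle_trans)
next
  assume xy: "same_cycle c x y"
  have "same_cycle c x = same_cycle c y"
    by (intro ext iffI) (rule same_cycle_trans[OF same_cycle_sym[OF assms(1-3) xy]]
        same_cycle_trans[OF xy], assumption)+
  then show "cycle_rep c x = cycle_rep c y" by (simp add: cycle_rep_def)
qed

lemma cycle_rep_moved:
  assumes "bij_betw c X X" "finite X" "x \<in> moved c X"
  shows "cycle_rep c x \<in> moved c X"
proof -
  have x: "x \<in> X" "c x \<noteq> x" using assms(3) by (auto simp: moved_def)
  have "same_cycle c (cycle_rep c x) x"
    using same_cycle_sym[OF assms(1,2) x(1) same_cycle_rep] .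
  then obtain k where k: "x = (c ^^ k) (cycle_rep c x)" by (auto simp: same_cycle_def)
  have "c (cycle_rep c x) = cycle_rep c x \<Longrightarrow> (c ^^ k) (cycle_rep c x) = cycle_rep c x"
    by (induction k) auto
  then have "c (cycle_rep c x) \<noteq> cycle_rep c x" using x k by metis
  then show ?thesis
    using same_cycle_closed[OF assms(1) x(1) same_cycle_rep] by (simp add: moved_def)
qed

text \<open>\<open>c\<close> sends the representative of a non-trivial cycle to a moved point that
  is not a representative. So the representatives and their images are disjoint sets of the same
  size.\<close>

lemma card_cycle_reps:
  assumes c: "bij_betw c X X" and X: "finite X"
  shows "2 * card (cycle_rep c ` moved c X) \<le> card (moved c X)"
proof -
  let ?M = "moved c X" and ?R = "cycle_rep c ` moved c X"
  have M: "?M \<subseteq> X" "finite ?M" using X by (auto simp: moved_def)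
  have R: "?R \<subseteq> ?M" using cycle_rep_moved[OF c X] by auto
  have rr: "cycle_rep c r = r" if "r \<in> ?R" for r
  proof -
    from that obtain x where x: "x \<in> X" "r = cycle_rep c x" using M(1) by blast
    moreover have "r \<in> X" using that R M(1) by blast
    ultimately show ?thesis using cycle_rep_eq_iff[OF c X x(1)] same_cycle_rep[of c x] by metis
  qed
  have cc: "cycle_rep c (c r) = cycle_rep c r" if "r \<in> X" for r
    using cycle_rep_eq_iff[OF c X] same_cycle_step that bij_betwE[OF c] by metis
  have inj: "inj_on c X" using c bij_betw_imp_inj_on by blast
  have "c ` ?R \<subseteq> ?M"
  proof
    fix y assume "y \<in> c ` ?R"
    then obtain r where r: "r \<in> ?M" "y = c r" using R by blast
    then have "r \<in> X" "c r \<in> X" "c r \<noteq> r" using bij_betwE[OF c] by (auto simp: moved_def)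
    then show "y \<in> ?M" using inj r by (auto simp: moved_def dest: inj_onD)
  qed
  moreover have "?R \<inter> c ` ?R = {}"
  proof (rule equals0I)
    fix y assume "y \<in> ?R \<inter> c ` ?R"
    then obtain r where r: "r \<in> ?R" "y = c r" "y \<in> ?R" by blast
    then have "y = r" using rr cc M(1) R by (metis subsetD)
    then show False using r R by (auto simp: moved_def)
  qed
  moreover have "card (c ` ?R) = card ?R"
    using inj R M(1) by (meson card_image inj_on_subset subset_trans)
  ultimately have "card ?R + card ?R \<le> card ?M"
    using R M(2) card_Un_disjoint[of ?R "c ` ?R"] card_mono[of ?M "?R \<union> c ` ?R"]
    by (metis Un_least finite_subset)
  then show ?thesis by simp
qed

lemma moved_image:
  assumes "bij_betw c X X" "finite X" "bij_betw g X X" "\<And>x. x \<in> X \<Longrightarrow> g (c x) = c (g x)"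
  shows "g ` moved c X = moved c X"
proof (rule endo_inj_surj)
  show "finite (moved c X)" using assms(2) by (simp add: moved_def)
  show "inj_on g (moved c X)"
    using inj_on_subset[OF bij_betw_imp_inj_on[OF assms(3)]] by (auto simp: moved_def)
  show "g ` moved c X \<subseteq> moved c X"
  proof
    fix y assume "y \<in> g ` moved c X"
    then obtain x where x: "x \<in> X" "c x \<noteq> x" "y = g x" by (auto simp: moved_def)
    have "c x \<in> X" "g x \<in> X" using assms(1,3) x bij_betwE by blast+
    moreover have "g (c x) \<noteq> g x"
      using inj_onD[OF bij_betw_imp_inj_on[OF assms(3)], of "c x" x] x \<open>c x \<in> X\<close> by blast
    ultimately show "y \<in> moved c X" using x assms(4)[OF x(1)] by (simp add: moved_def)
  qed
qed

section \<open>The action induced on the cycles\<close>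

text \<open>A map that commutes with \<open>c\<close> sends cycles to cycles; this is the
  well-definedness of the induced action, and it allows inner occurrences of
  \<open>cycle_rep\<close> to be dropped.\<close>

lemma cycle_rep_comp:
  assumes c: "bij_betw c X X" "finite X" and g: "g \<in> X \<rightarrow> X" "\<And>x. x \<in> X \<Longrightarrow> g (c x) = c (g x)"
    and x: "x \<in> X"
  shows "cycle_rep c (g (cycle_rep c x)) = cycle_rep c (g x)"
proof -
  have rX: "cycle_rep c x \<in> X" using same_cycle_closed[OF c(1) x same_cycle_rep] .
  have "same_cycle c (g x) (g (cycle_rep c x))"
    using same_cycle_map[of c X g, OF c(1) g(2) x same_cycle_rep] by blast
  then show ?thesis using cycle_rep_eq_iff[OF c] g(1) x rX by (metis PiE)
qed

lemma braid_on_cycle_reps: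
  assumes c: "bij_betw c X X" "finite X" and t: "braid_on m X t"
    and tc: "\<And>i x. 1 \<le> i \<Longrightarrow> i < m \<Longrightarrow> x \<in> X \<Longrightarrow> t i (c x) = c (t i x)"
  shows "braid_on m (cycle_rep c ` moved c X) (\<lambda>i x. cycle_rep c (t i x))"
proof -
  let ?R = "cycle_rep c ` moved c X" and ?t = "\<lambda>i x. cycle_rep c (t i x)"
  have MX: "moved c X \<subseteq> X" by (auto simp: moved_def)
  have RM: "?R \<subseteq> moved c X" using cycle_rep_moved[OF c] by auto
  have rX: "cycle_rep c x \<in> X" if "x \<in> X" for x
    using same_cycle_closed[OF c(1) that same_cycle_rep] .
  have tX: "t i \<in> X \<rightarrow> X" if "1 \<le> i" "i < m" for i
    using braid_on_closed[OF t that] by blast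
  have tcl: "t i x \<in> X" if "1 \<le> i" "i < m" "x \<in> X" for i x
    using braid_on_closed[OF t that] .
  have comp: "?t i (cycle_rep c x) = ?t i x" if "1 \<le> i" "i < m" "x \<in> X" for i x
    using cycle_rep_comp[OF c tX[OF that(1,2)] tc[OF that(1,2)] that(3)] by blast
  have RX: "x \<in> X" if "x \<in> ?R" for x using that RM MX by blast
  show ?thesis
  proof (rule braid_onI)
    fix i assume i: "1 \<le> i" "i < m"
    have tm: "t i ` moved c X = moved c X"
      using moved_image[OF c braid_on_bij[OF t i] tc[OF i]] by blast
    have "?t i ` ?R = ?t i ` moved c X"
      unfolding image_image by (rule image_cong) (use comp[OF i] MX in auto)
    also have "\<dots> = cycle_rep c ` (t i ` moved c X)" by (simp add: image_image)
    finally have surj: "?t i ` ?R = ?R" using tm by simp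
    have "finite ?R" using c(2) MX finite_subset by blast
    then show "bij_betw (?t i) ?R ?R"
      using surj by (simp add: bij_betw_def eq_card_imp_inj_on)
  next
    fix i j x assume ij: "1 \<le> i" "i + 2 \<le> j" "j < m" and x: "x \<in> ?R"
    have "t i (t j x) = t j (t i x)" using braid_on_commute[OF t, of i j x] ij RX[OF x] by simp
    then show "?t i (?t j x) = ?t j (?t i x)"
      using comp tcl ij RX[OF x] by simp
  next
    fix i x assume i: "1 \<le> i" "Suc i < m" and x: "x \<in> ?R"
    have "t i (t (Suc i) (t i x)) = t (Suc i) (t i (t (Suc i) x))"
      using braid_on_braid[OF t i RX[OF x]] .
    then show "?t i (?t (Suc i) (?t i x)) = ?t (Suc i) (?t i (?t (Suc i) x))"
      using comp tcl i RX[OF x] by simp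
  qed
qed

text \<open>A cyclic action on the cycles gives agreement of the generators only up to powers of
  \<open>c\<close>, with an exponent that may depend on \<open>x\<close>.\<close>

lemma all_equal_on_cycle_reps:
  assumes c: "bij_betw c X X" "finite X" and t: "braid_on m X t"
    and tc: "\<And>i x. 1 \<le> i \<Longrightarrow> i < m \<Longrightarrow> x \<in> X \<Longrightarrow> t i (c x) = c (t i x)"
    and eq: "all_equal_on m (cycle_rep c ` moved c X) (\<lambda>i x. cycle_rep c (t i x))"
    and ij: "1 \<le> i" "i < m" "1 \<le> j" "j < m" and x: "x \<in> moved c X"
  shows "same_cycle c (t i x) (t j x)"
proof -
  have xX: "x \<in> X" using x by (simp add: moved_def)
  have "cycle_rep c (t i (cycle_rep c x)) = cycle_rep c (t j (cycle_rep c x))"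
    using all_equal_onD[OF eq ij] x by blast
  moreover have "cycle_rep c (t k (cycle_rep c x)) = cycle_rep c (t k x)" if "1 \<le> k" "k < m" for k
    using cycle_rep_comp[of c X "t k" x, OF c _ tc[OF that] xX] braid_on_closed[OF t that] by blast
  ultimately show ?thesis
    using cycle_rep_eq_iff[OF c] braid_on_closed[OF t _ _ xX] ij by metis
qed

lemma two_points_commute:
  assumes u: "bij_betw u X X" and v: "bij_betw v X X" and X: "finite X" "card X \<le> 2" and x: "x \<in> X"
  shows "u (v x) = v (u x)"
proof (cases "card X = 2")
  case True
  then obtain a b where ab: "X = {a, b}" "a \<noteq> b" by (auto simp: card_2_iff)
  have "f a = a \<and> f b = b \<or> f a = b \<and> f b = a" if f: "bij_betw f X X" for f
  proof -
    have "f a \<in> {a, b}" "f b \<in> {a, b}" "f a \<noteq> f b"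
      using bij_betwE[OF f] inj_onD[OF bij_betw_imp_inj_on[OF f], of a b] ab by blast+
    then show ?thesis by auto
  qed
  from this[OF u] this[OF v] show ?thesis using x ab by auto
next
  case False
  moreover have "card X \<noteq> 0" using X(1) x by auto
  ultimately have "card X = 1" using X(2) by linarith
  then have "X = {x}" using x by (auto simp: card_1_singleton_iff)
  then have "u x = x" "v x = x" using bij_betwE[OF u] bij_betwE[OF v] by auto
  then show ?thesis by simp
qed

text \<open>The symmetric group of a set with at most two points is abelian, so braided elements of
  it coincide.\<close>

lemma all_equal_on_two_points:
  assumes t: "braid_on m X t" and X: "finite X" "card X \<le> 2"
  shows "all_equal_on m X t"
proof (cases "m \<ge> 3")
  case True
  have b: "bij_betw (t 1) X X" "bij_betw (t (Suc 1)) X X" using braid_on_bij[OF t] True by auto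
  have "t 1 x = t (Suc 1) x" if "x \<in> X" for x
    using two_points_commute[OF b X] braid_on_braid[OF t, of 1] that True
    by (intro commuting_braid_eq[OF b]) auto
  then show ?thesis using all_equal_onI_consecutive[OF t, of 1] True by auto
next
  case False
  then have "i = j" if "1 \<le> i" "i < m" "1 \<le> j" "j < m" for i j using that by auto
  then show ?thesis unfolding all_equal_on_def by blast
qed

section \<open>Supports of the generators\<close>

text \<open>The braid relation reads \<open>v (u v) = (u v) u\<close>: the map \<open>u v\<close>
  conjugates \<open>u\<close> to \<open>v\<close>, and so carries the points moved by
  \<open>u\<close> onto those moved by \<open>v\<close>.\<close>

lemma card_moved_braid:
  assumes u: "bij_betw u X X" and v: "bij_betw v X X" 
    and b: "\<And>x. x \<in> X \<Longrightarrow> u (v (u x)) = v (u (v x))"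
  shows "card (moved u X) = card (moved v X)"
proof -
  have g: "bij_betw (u \<circ> v) X X" using u v by (metis bij_betw_trans)
  have uX: "u x \<in> X" and vX: "v x \<in> X" if "x \<in> X" for x
    using bij_betwE[OF u] bij_betwE[OF v] that by auto
  have iff: "v ((u \<circ> v) x) = (u \<circ> v) x \<longleftrightarrow> u x = x" if x: "x \<in> X" for x
  proof -
    have "v ((u \<circ> v) x) = (u \<circ> v) (u x)" using b[OF x] by simp
    then show ?thesis
      using inj_onD[OF bij_betw_imp_inj_on[OF g] _ uX[OF x] x] by auto
  qed
  have "(u \<circ> v) ` moved u X = moved v X"
  proof
    show "(u \<circ> v) ` moved u X \<subseteq> moved v X"
      using iff bij_betwE[OF g] by (auto simp: moved_def)
    show "moved v X \<subseteq> (u \<circ> v) ` moved u X"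
    proof
      fix y assume y: "y \<in> moved v X"
      then have "y \<in> (u \<circ> v) ` X" using g by (auto simp: moved_def bij_betw_def)
      then obtain x where x: "x \<in> X" "y = (u \<circ> v) x" by blast
      then have "u x \<noteq> x" using iff[OF x(1)] y by (auto simp: moved_def)
      then show "y \<in> (u \<circ> v) ` moved u X" using x by (auto simp: moved_def)
    qed
  qed
  moreover have "inj_on (u \<circ> v) (moved u X)"
    by (rule inj_on_subset[OF bij_betw_imp_inj_on[OF g]]) (auto simp: moved_def)
  ultimately show ?thesis by (metis card_image)
qed

lemma braid_on_card_moved:
  assumes t: "braid_on m X t" and "1 \<le> i" "i < m"
  shows "card (moved (t i) X) = card (moved (t 1) X)"
proof -
  have "i < m \<longrightarrow> card (moved (t i) X) = card (moved (t 1) X)"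
    using assms(2)
  proof (induction i rule: dec_induct)
    case base
    then show ?case by simp
  next
    case (step k)
    have "card (moved (t k) X) = card (moved (t (Suc k)) X)" if "Suc k < m"
      using card_moved_braid[OF braid_on_bij[OF t, of k] braid_on_bij[OF t, of "Suc k"]]
        braid_on_braid[OF t, of k] step(1) that by auto
    then show ?case using step by auto
  qed
  then show ?thesis using assms(3) by simp
qed

text \<open>If \<open>t 1\<close> were the identity on \<open>X\<close>, it would commute with
  \<open>t 2\<close> and hence equal it.\<close>

lemma moved_nonempty:
  assumes t: "braid_on m X t" and ne: "\<not> all_equal_on m X t"
  shows "moved (t 1) X \<noteq> {}"
proof
  assume "moved (t 1) X = {}"
  then have id: "t 1 x = x" if "x \<in> X" for x using that by (auto simp: moved_def)
  have m: "Suc 1 < m"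
  proof (rule ccontr)
    assume "\<not> Suc 1 < m"
    then have "i = j" if "1 \<le> i" "i < m" "1 \<le> j" "j < m" for i j using that by auto
    then show False using ne unfolding all_equal_on_def by blast
  qed
  have b: "bij_betw (t 1) X X" "bij_betw (t (Suc 1)) X X" using braid_on_bij[OF t] m by auto
  have cl: "t (Suc 1) x \<in> X" if "x \<in> X" for x using bij_betwE[OF b(2)] that by blast
  have "t 1 x = t (Suc 1) x" if "x \<in> X" for x
    by (rule commuting_braid_eq[OF b _ _ that]) (use id cl braid_on_braid[OF t, of 1] m in auto)
  then show False using all_equal_onI_consecutive[OF t, of 1] m ne by auto
qed

lemma card_moved_ge_two:
  assumes "bij_betw c X X" "finite X" "moved c X \<noteq> {}"
  shows "2 \<le> card (moved c X)"
proof -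
  have "finite (moved c X)" using assms(2) by (simp add: moved_def)
  then have "card (cycle_rep c ` moved c X) \<noteq> 0" using assms(3) by simp
  then show ?thesis using card_cycle_reps[OF assms(1,2)] by linarith
qed

lemma moved_closed:
  assumes "bij_betw c X X" "x \<in> moved c X"
  shows "c x \<in> moved c X"
proof -
  have x: "x \<in> X" "c x \<in> X" "c x \<noteq> x" using assms bij_betwE by (auto simp: moved_def)
  then have "c (c x) \<noteq> c x" using inj_onD[OF bij_betw_imp_inj_on[OF assms(1)], of "c x" x] by blast
  then show ?thesis using x by (simp add: moved_def)
qed

lemma moved_pair:
  assumes "bij_betw c X X" "moved c X = {a, b}"
  shows "c a = b" "c b = a"
proof -
  have "c a \<in> {a, b}" "c a \<noteq> a" "c b \<in> {a, b}" "c b \<noteq> b"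
    using moved_closed[OF assms(1)] assms(2) by (auto simp: moved_def)
  then show "c a = b" "c b = a" by auto
qed

lemma moved_pair_eq:
  assumes "bij_betw u X X" "bij_betw v X X" "moved u X = {a, b}" "moved v X = {a, b}" "x \<in> X"
  shows "u x = v x"
proof (cases "x \<in> {a, b}")
  case True
  then show ?thesis using moved_pair[OF assms(1,3)] moved_pair[OF assms(2,4)] by auto
next
  case False
  then have "x \<notin> moved u X" "x \<notin> moved v X" using assms(3,4) by auto
  then show ?thesis using assms(5) by (simp add: moved_def)
qed

lemma disjoint_moved_commute:
  assumes u: "bij_betw u X X" and v: "bij_betw v X X" and d: "moved u X \<inter> moved v X = {}" and x: "x \<in> X"
  shows "u (v x) = v (u x)"
proof -
  have fix1: "f y = y" if "y \<in> X" "y \<notin> moved f X" for f y using that by (simp add: moved_def)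
  have vx: "v x \<in> X" and ux: "u x \<in> X" using x bij_betwE[OF u] bij_betwE[OF v] by auto
  show ?thesis
  proof (cases "x \<in> moved u X")
    case True
    then have "x \<notin> moved v X" "u x \<notin> moved v X" using d moved_closed[OF u True] by auto
    then show ?thesis using fix1[of x v] fix1[of "u x" v] x ux by simp
  next
    case False
    then have *: "u x = x" using fix1 x by blast
    show ?thesis
    proof (cases "x \<in> moved v X")
      case True
      then have "v x \<notin> moved u X" using d moved_closed[OF v True] by auto
      then show ?thesis using fix1[of "v x" u] vx * by simp
    next
      case False
      then show ?thesis using fix1[of x v] x * by simp
    qed
  qed
qed

section \<open>Generators that move only two points\<close>

text \<open>Supports of far generators are disjoint and those of neighbours share exactly one point,
  so the supports are the edges of a path with vertices \<open>p i\<close>. Four strands are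
  excluded because there \<open>t 1 = t 3\<close> can hold in an action that is not cyclic.\<close>

lemma transposition_path:
  assumes t: "braid_on m X t" and X: "finite X" and m: "3 \<le> m" "m \<noteq> 4" and ne: "\<not> all_equal_on m X t"
    and two: "card (moved (t 1) X) = 2"
  obtains p where "inj_on p {1..m}" "p ` {1..m} \<subseteq> X"
    "\<And>i. 1 \<le> i \<Longrightarrow> i < m \<Longrightarrow> moved (t i) X = {p i, p (Suc i)}"
proof -
  define M where "M i = moved (t i) X" for i
  have MX: "M i \<subseteq> X" for i by (auto simp: M_def moved_def)
  have bij: "bij_betw (t i) X X" if "1 \<le> i" "i < m" for i using braid_on_bij[OF t that] .
  have card2: "card (M i) = 2" if "1 \<le> i" "i < m" for i
    using braid_on_card_moved[OF t that] two by (simp add: M_def)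
  have eqM: "t i x = t j x"
    if "1 \<le> i" "i < m" "1 \<le> j" "j < m" "M i = M j" "x \<in> X" for i j x
    using moved_pair_eq[OF bij bij, of i j _ _ x] that card2[of i] unfolding M_def card_2_iff by metis
  have consec: "\<not> (\<forall>x\<in>X. t i x = t (Suc i) x)" if "1 \<le> i" "Suc i < m" for i
    using all_equal_onI_consecutive[OF t that] ne by blast
  \<comment> \<open>Two commuting generators whose supports are pairs with a common point are equal.
    To conclude that all generators are then equal, one needs a neighbour of one index that is far
    from the other: \<open>Suc j\<close>, \<open>i - 1\<close> or \<open>Suc i\<close>. Only
    \<open>m = 4\<close>, \<open>i = 1\<close>, \<open>j = 3\<close> has none.\<close>
  have disj: "M i \<inter> M j = {}" if ij: "1 \<le> i" "i + 2 \<le> j" "j < m" for i j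
  proof (rule ccontr)
    assume "M i \<inter> M j \<noteq> {}"
    then obtain a where a: "a \<in> M i" "a \<in> M j" by blast
    have ij': "1 \<le> j" "i < m" using ij by auto
    have "t j ` M i = M i"
      unfolding M_def
      by (rule moved_image[of "t i" X "t j"])
        (use X bij ij ij' two MX braid_on_commute[OF t, of j i] card2[of i] in \<open>auto simp: M_def\<close>)
    then have "t j a \<in> M i" "t j a \<in> M j" "t j a \<noteq> a"
      using a moved_closed[OF bij[OF ij'(1) ij(3)]] unfolding M_def by (auto simp: moved_def)
    then have "M i = {a, t j a}" "M j = {a, t j a}"
      using card2[of i] card2[of j] a ij ij' unfolding card_2_iff by auto
    then have eq: "t i x = t j x" if "x \<in> X" for x using eqM[OF ij(1) ij'(2,1) ij(3) _ that] by simp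
    show False
    proof (cases "Suc j < m")
      case True
      have "t j x = t (Suc j) x" if "x \<in> X" for x
        using braid_on_eq_step[OF t ij(1) ij'(2,1) ij(3), of "Suc j"] eq ij True that by auto
      then show False using consec[of j] ij' True by blast
    next
      case False
      show False
      proof (cases "j = i + 2")
        case True
        then have i: "2 \<le> i" using False m ij by auto
        have "t i x = t (i - 1) x" if "x \<in> X" for x
          using braid_on_eq_step[OF t ij'(1) ij(3,1) ij'(2), of "i - 1"] eq ij True i that by auto
        moreover have "1 \<le> i - 1" "Suc (i - 1) = i" using i by auto
        ultimately show False using consec[of "i - 1"] ij'(2) by metis
      next
        case False
        have "t i x = t (Suc i) x" if "x \<in> X" for x
          using braid_on_eq_step[OF t ij'(1) ij(3,1) ij'(2), of "Suc i"] eq ij False that by auto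
        then show False using consec[of i] ij by auto
      qed
    qed
  qed
  have meet: "M i \<inter> M (Suc i) \<noteq> {}" "M i \<noteq> M (Suc i)" if i: "1 \<le> i" "Suc i < m" for i
  proof -
    have i': "i < m" "1 \<le> Suc i" using i by auto
    show "M i \<noteq> M (Suc i)" using eqM[OF i(1) i' i(2)] consec[OF i] by blast
    show "M i \<inter> M (Suc i) \<noteq> {}"
    proof
      assume d: "M i \<inter> M (Suc i) = {}"
      have "t i x = t (Suc i) x" if "x \<in> X" for x
        by (rule commuting_braid_eq[OF bij[OF i(1) i'(1)] bij[OF i'(2) i(2)] _ _ that])
          (use disjoint_moved_commute[OF bij[OF i(1) i'(1)] bij[OF i'(2) i(2)]] d
            braid_on_braid[OF t i] in \<open>auto simp: M_def\<close>)
      then show False using consec[OF i] by blast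
    qed
  qed
  have outer: "\<exists>x. x \<in> M i \<and> x \<notin> M j" if "1 \<le> i" "i < m" "1 \<le> j" "j < m" "M i \<noteq> M j" for i j
  proof -
    have "finite (M j)" using card2[of j] that by (metis card.infinite zero_neq_numeral)
    then have "\<not> M i \<subseteq> M j" using card_subset_eq card2 that by metis
    then show ?thesis by blast
  qed
  \<comment> \<open>An inner vertex is the common point of two consecutive supports. The two end
    vertices are instead chosen in the first and the last support, outside the neighbouring
    one.\<close>
  have "\<exists>x. (i < m \<longrightarrow> x \<in> M i) \<and> (1 < i \<longrightarrow> x \<in> M (i - 1)) \<and> (i = 1 \<longrightarrow> x \<notin> M 2)
      \<and> (i = m \<longrightarrow> x \<notin> M (m - 2))" if i: "1 \<le> i" "i \<le> m" for i
  proof -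
    consider "i = 1" | "1 < i" "i < m" | "i = m" using i by linarith
    then show ?thesis
    proof cases
      case 1
      have "\<exists>x. x \<in> M 1 \<and> x \<notin> M (Suc 1)" using outer[of 1 "Suc 1"] meet(2)[of 1] m by auto
      then show ?thesis using 1 m by (auto simp: numeral_2_eq_2)
    next
      case 2
      then have "1 \<le> i - 1" "Suc (i - 1) = i" by auto
      then show ?thesis using meet(1)[of "i - 1"] 2 by auto
    next
      case 3
      have "Suc (m - 2) = m - 1" "1 \<le> m - 2" "1 \<le> m - 1" "m - 1 < m" "m - 2 < m" using m by auto
      then have "\<exists>x. x \<in> M (m - 1) \<and> x \<notin> M (m - 2)"
        using outer[of "m - 1" "m - 2"] meet(2)[of "m - 2"] by metis
      then show ?thesis using 3 m by auto
    qed
  qed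
  then obtain p where p: "\<And>i. 1 \<le> i \<Longrightarrow> i < m \<Longrightarrow> p i \<in> M i"
    "\<And>i. 1 < i \<Longrightarrow> i \<le> m \<Longrightarrow> p i \<in> M (i - 1)" "p 1 \<notin> M 2" "p m \<notin> M (m - 2)"
    using m by (metis (no_types, lifting) le_trans less_imp_le_nat one_le_numeral order_refl)
  have mem: "p i \<in> M k \<longleftrightarrow> k = i \<or> Suc k = i" if "1 \<le> i" "i \<le> m" "1 \<le> k" "k < m" for i k
  proof
    assume pk: "p i \<in> M k"
    show "k = i \<or> Suc k = i"
    proof (rule ccontr)
      assume far: "\<not> (k = i \<or> Suc k = i)"
      consider "i + 2 \<le> k" | "k = Suc i" | "k + 3 \<le> i" | "i = k + 2" using far by linarith
      then show False
      proof cases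
        case 1
        then show False using disj[of i k] p(1)[of i] pk that by auto
      next
        case 2
        show False
        proof (cases "i = 1")
          case True
          then show False using 2 p(3) pk by (simp add: numeral_2_eq_2)
        next
          case False
          then have "1 \<le> i - 1" "i - 1 + 2 \<le> k" "1 < i" using 2 that by auto
          then show False using disj[of "i - 1" k] p(2)[of i] pk that by blast
        qed
      next
        case 3
        then have "k + 2 \<le> i - 1" "i - 1 < m" "1 < i" using that by auto
        then show False using disj[of k "i - 1"] p(2)[of i] pk that by blast
      next
        case 4
        then show False using disj[of k i] p(1)[of i] p(4) pk that by (cases "i = m") auto
      qed
    qed
  next
    assume "k = i \<or> Suc k = i"
    then show "p i \<in> M k" using p(1)[of i] p(2)[of i] that by auto
  qed
  \<comment> \<open>For \<open>j < m\<close> the support \<open>M j\<close> contains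
    \<open>p j\<close> but not \<open>p i\<close>. There is no \<open>M m\<close>: among the earlier
    vertices \<open>M (m - 1)\<close> leaves only \<open>p (m - 1)\<close>, which
    \<open>M (m - 2)\<close> separates from \<open>p m\<close>.\<close>
  have neq: "p i \<noteq> p j" if "1 \<le> i" "i < j" "j \<le> m" for i j
  proof (cases "j < m")
    case True
    then show ?thesis using mem[of i j] mem[of j j] that by auto
  next
    case False
    then have j: "j = m" using that by simp
    show ?thesis
    proof
      assume e: "p i = p j"
      have "p j \<in> M (m - 1)" using mem[of j "m - 1"] j m by auto
      then have "i = m - 1" using mem[of i "m - 1"] e j that m by auto
      then have "p j \<in> M (m - 2)" using mem[of i "m - 2"] e m by auto
      then show False using p(4) j by simp
    qed
  qed
  show thesis
  proof (rule that)
    show "inj_on p {1..m}"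
      by (rule linorder_inj_onI) (use neq in auto)
    show "p ` {1..m} \<subseteq> X"
    proof
      fix y assume "y \<in> p ` {1..m}"
      then obtain i where "1 \<le> i" "i \<le> m" "y = p i" by auto
      then show "y \<in> X" using p(1)[of i] p(2)[of i] MX m by (cases "i < m") auto
    qed
    fix i assume i: "1 \<le> i" "i < m"
    have "p i \<in> M i" "p (Suc i) \<in> M i" "p i \<noteq> p (Suc i)"
      using p(1)[of i] p(2)[of "Suc i"] neq[of i "Suc i"] i by auto
    then show "moved (t i) X = {p i, p (Suc i)}"
      using card2[OF i] unfolding card_2_iff M_def by auto
  qed
qed

section \<open>The induction on the number of strands\<close>

lemma braid_on_fixed:
  assumes t: "braid_on m X t" and X: "finite X" and c: "bij_betw c X X"
    and tc: "\<And>i x. 1 \<le> i \<Longrightarrow> i < m \<Longrightarrow> x \<in> X \<Longrightarrow> t i (c x) = c (t i x)"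
  shows "braid_on m (X - moved c X) t"
proof (rule braid_on_subset[OF t])
  fix i assume i: "1 \<le> i" "i < m"
  have "t i ` moved c X = moved c X" using moved_image[OF c X braid_on_bij[OF t i] tc[OF i]] by blast
  then show "t i ` (X - moved c X) = X - moved c X"
    using inj_on_image_set_diff[OF bij_betw_imp_inj_on[OF braid_on_bij[OF t i]], of X "moved c X"]
      bij_betw_imp_surj_on[OF braid_on_bij[OF t i]] by (auto simp: moved_def)
qed auto

text \<open>The strands \<open>3, \<dots>, m\<close> act on the fixed points of \<open>t 1\<close>, and this action must be
  non-trivial if they act trivially on the rest.\<close>

lemma many_fixed_points:
  assumes t: "braid_on m X t" and X: "finite X" and m: "5 \<le> m" and ne: "\<not> all_equal_on m X t"
    and agree: "\<And>x. x \<in> moved (t 1) X \<Longrightarrow> t 3 x = t 4 x"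
    and small: "braid_on (m - 2) (X - moved (t 1) X) (\<lambda>i. t (i + 2)) \<Longrightarrow>
      card (X - moved (t 1) X) < k \<Longrightarrow> all_equal_on (m - 2) (X - moved (t 1) X) (\<lambda>i. t (i + 2))"
  shows "card (moved (t 1) X) + k \<le> card X"
proof (rule ccontr)
  let ?M = "moved (t 1) X"
  assume "\<not> ?thesis"
  moreover have "card (X - ?M) = card X - card ?M" "card ?M \<le> card X"
    using X by (auto simp: moved_def intro: card_Diff_subset card_mono)
  ultimately have small_card: "card (X - ?M) < k" by linarith
  have s: "braid_on (m - 2) X (\<lambda>i. t (i + 2))" using braid_on_shift[of "m - 2" 2 X t] t le_add_diff_inverse2[of 2 m] m by simp
  have "braid_on (m - 2) (X - ?M) (\<lambda>i. t (i + 2))"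
    by (rule braid_on_fixed[OF s X braid_on_bij[OF t]])
      (use m braid_on_commute[OF t] in auto)
  then have "all_equal_on (m - 2) (X - ?M) (\<lambda>i. t (i + 2))" using small small_card by blast
  then have "t 3 x = t 4 x" if "x \<in> X - ?M" for x
    using all_equal_onD[of "m - 2" "X - ?M" "\<lambda>i. t (i + 2)" 1 2 x] that m
    by (simp add: eval_nat_numeral less_diff_conv)
  then have "t 3 x = t (Suc 3) x" if "x \<in> X" for x using agree that by (cases "x \<in> ?M") auto
  then show False using all_equal_onI_consecutive[OF t, of 3] m ne by auto
qed

text \<open>\<open>t 6\<close> commutes with \<open>t 1\<close>, \<open>t 3\<close> and
  \<open>t 4\<close>, and by \<open>eq\<close> it agrees with \<open>t 3\<close> and
  \<open>t 4\<close> modulo the cycles of \<open>t 1\<close>. Hence \<open>t 3\<close> and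
  \<open>t 4\<close> commute on the moved points, and being braided they coincide there. Seven
  strands are what makes \<open>t 6\<close> available.\<close>

lemma eq_on_moved:
  assumes t: "braid_on m X t" and X: "finite X" and m: "7 \<le> m"
    and eq: "all_equal_on (m - 2) (cycle_rep (t 1) ` moved (t 1) X) (\<lambda>i x. cycle_rep (t 1) (t (i + 2) x))"
    and x: "x \<in> moved (t 1) X"
  shows "t 3 x = t 4 x"
proof -
  let ?c = "t 1" and ?M = "moved (t 1) X"
  have c: "bij_betw ?c X X" using braid_on_bij[OF t] m by simp
  have s: "braid_on (m - 2) X (\<lambda>i. t (i + 2))" using braid_on_shift[of "m - 2" 2 X t] t le_add_diff_inverse2[of 2 m] m by simp
  have tc: "t i (?c y) = ?c (t i y)" if "3 \<le> i" "i < m" "y \<in> X" for i y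
    using braid_on_commute[OF t, of i 1 y] that by auto
  have MX: "?M \<subseteq> X" by (auto simp: moved_def)
  have same: "same_cycle ?c (t i y) (t j y)" if "3 \<le> i" "i < m" "3 \<le> j" "j < m" "y \<in> ?M" for i j y
    using all_equal_on_cycle_reps[OF c X s _ eq, of "i - 2" "j - 2" y] tc that m
      le_add_diff_inverse2[of 2 i] le_add_diff_inverse2[of 2 j] by auto
  have tM: "t i ` ?M = ?M" if "3 \<le> i" "i < m" for i
    by (rule moved_image[OF c X braid_on_bij[OF t]]) (use tc that in auto)
  have bM: "bij_betw f ?M ?M" if "bij_betw f X X" "f ` ?M = ?M" for f
    using bij_betw_subset[OF that(1) MX that(2)] .
  have b: "bij_betw (t i) ?M ?M" if "3 \<le> i" "i < m" for i
    using bM[OF braid_on_bij[OF t] tM[OF that]] that by simp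
  have cM: "bij_betw ?c ?M ?M" by (rule bM[OF c moved_image[OF c X c HOL.refl]])
  show ?thesis
  proof (rule commuting_braid_eq[OF b b _ _ x])
    fix y assume y: "y \<in> ?M"
    then have yX: "y \<in> X" using MX by blast
    show "t 3 (t 4 y) = t 4 (t 3 y)"
    proof (rule commute_modulo_cycles[OF c, where w = "t 6"])
      show "t 3 \<in> X \<rightarrow> X" "t 4 \<in> X \<rightarrow> X" "t 6 \<in> X \<rightarrow> X" using braid_on_closed[OF t] m by auto
    qed (use y yX m tc same braid_on_commute[OF t] in auto)
    show "t 3 (t 4 (t 3 y)) = t 4 (t 3 (t 4 y))" using braid_on_braid[OF t, of 3] yX m by auto
  qed (use m in auto)
qed

text \<open>On the moved points of \<open>c\<close> there are at most two cycles. If \<open>u\<close> preserves one of them, then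
  \<open>u\<close> and \<open>v\<close> act there as powers of \<open>c\<close>; otherwise five points only leave room for cycles of
  length two, and the braid relation forces \<open>v = c\<^sup>k u\<close> to have trivial \<open>c\<^sup>k\<close>.\<close>

lemma braid_eq_on_two_cycles:
  assumes c: "bij_betw c X X" and X: "finite X" "card X \<le> 5" "moved c X = X"
    and u: "bij_betw u X X" and v: "bij_betw v X X"
    and uc: "\<And>x. x \<in> X \<Longrightarrow> u (c x) = c (u x)" and vc: "\<And>x. x \<in> X \<Longrightarrow> v (c x) = c (v x)"
    and uv: "\<And>x. x \<in> X \<Longrightarrow> same_cycle c (u x) (v x)"
    and b: "\<And>x. x \<in> X \<Longrightarrow> u (v (u x)) = v (u (v x))"
    and x: "x \<in> X"
  shows "u x = v x"
proof (cases "\<forall>x\<in>X. same_cycle c x (u x)")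
  case True
  show ?thesis
  proof (rule commuting_braid_eq[OF u v _ b x])
    fix y assume y: "y \<in> X"
    have *: "same_cycle c (id y) (u y)" "same_cycle c (id y) (v y)"
      using True y same_cycle_trans[OF _ uv[OF y]] by auto
    have "u \<in> X \<rightarrow> X" "v \<in> X \<rightarrow> X" "id \<in> X \<rightarrow> X" using bij_betwE[OF u] bij_betwE[OF v] by auto
    then show "u (v y) = v (u y)"
      by (rule commute_modulo_cycles[of c X u v id y, OF c _ _ _ _ _ _ _ _ * y]) (simp_all add: uc vc)
  qed
next
  case False
  then obtain z where z: "z \<in> X" "\<not> same_cycle c z (u z)" by blast
  have uX: "u y \<in> X" and vX: "v y \<in> X" and cX: "c y \<in> X" if "y \<in> X" for y
    using bij_betwE[OF u] bij_betwE[OF v] bij_betwE[OF c] that by auto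
  have sym: "same_cycle c y w" if "same_cycle c w y" "w \<in> X" for w y
    using same_cycle_sym[OF c X(1) that(2,1)] .
  have join: "same_cycle c w y" if "same_cycle c w a" "same_cycle c y a" "w \<in> X" "y \<in> X" for w y a
    using same_cycle_trans[OF that(1) sym[OF that(2,4)]] .
  have cinj: "y = w" if "c y = c w" "y \<in> X" "w \<in> X" for y w
    using inj_onD[OF bij_betw_imp_inj_on[OF c]] that by blast
  have uinj: "y = w" if "u y = u w" "y \<in> X" "w \<in> X" for y w
    using inj_onD[OF bij_betw_imp_inj_on[OF u]] that by blast
  have ne: "c y \<noteq> y" if "y \<in> X" for y using X(3) that by (auto simp: moved_def)
  let ?r = "cycle_rep c"
  have R: "card (?r ` X) \<le> 2" using card_cycle_reps[OF c X(1)] X by simp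
  have two: "same_cycle c y z \<or> same_cycle c y (u z)" if "y \<in> X" for y
  proof (rule ccontr)
    assume n: "\<not> ?thesis"
    have "{?r z, ?r (u z), ?r y} \<subseteq> ?r ` X" using z(1) uX that by auto
    moreover have "card {?r z, ?r (u z), ?r y} = 3"
      using cycle_rep_eq_iff[OF c X(1)] z uX[OF z(1)] that n sym by (auto simp: card_insert_if)
    ultimately show False using R X(1) card_mono[of "?r ` X" "{?r z, ?r (u z), ?r y}"] by simp
  qed
  have umap: "same_cycle c (u y) (u w)" if "same_cycle c y w" "y \<in> X" for y w
    using same_cycle_map[of c X u, OF c uc that(2,1)] by blast
  \<comment> \<open>\<open>u\<close> permutes at most two cycles and moves the cycle of
    \<open>z\<close>, so it exchanges them.\<close>
  have uswap: "\<not> same_cycle c y (u y)" if y: "y \<in> X" for y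
  proof
    assume s: "same_cycle c y (u y)"
    show False
    proof (cases "same_cycle c y z")
      case True
      then have "same_cycle c (u y) (u z)" using umap y by blast
      then have "same_cycle c z (u z)" using s True sym same_cycle_trans y by metis
      then show False using z by blast
    next
      case False
      then have yz: "same_cycle c y (u z)" using two y by blast
      then have "same_cycle c (u z) (u (u z))"
        using umap[OF yz y] s sym[OF yz y] same_cycle_trans by metis
      then obtain k where "u (u z) = (c ^^ k) (u z)" by (auto simp: same_cycle_def)
      then have "u (u z) = u ((c ^^ k) z)" using funpow_commute_on[of c X u, OF c uc z(1)] by simp
      then have "u z = (c ^^ k) z" using uinj uX z funpow_closed[OF c] by blast
      then show False using z by (auto simp: same_cycle_def)
    qed
  qed
  \<comment> \<open>A cycle with at least three points, together with its disjoint image under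
    \<open>u\<close>, would need six points.\<close>
  have square: "c (c y) = y" if y: "y \<in> X" for y
  proof (rule ccontr)
    assume n: "c (c y) \<noteq> y"
    let ?A = "{y, c y, c (c y)}"
    have A: "?A \<subseteq> X" using y cX by auto
    have cardA: "card ?A = 3" using n ne[OF y] ne[OF cX[OF y]] by auto
    have cardU: "card (u ` ?A) = 3"
      using cardA inj_on_subset[OF bij_betw_imp_inj_on[OF u] A] by (simp only: card_image)
    have "?A \<inter> u ` ?A = {}"
    proof (rule equals0I)
      fix w assume "w \<in> ?A \<inter> u ` ?A"
      then obtain a a' where a: "a \<in> ?A" "w = a" "a' \<in> ?A" "w = u a'" by blast
      have st: "same_cycle c y b" if "b \<in> ?A" for b
        using that same_cycle_refl[of c y] same_cycle_step[of c y] same_cycle_trans[OF same_cycle_step[of c y] same_cycle_step[of c "c y"]] by blast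
      have "same_cycle c y a" "same_cycle c y a'" using st[OF a(1)] st[OF a(3)] by blast+
      moreover have "same_cycle c (u y) (u a')" using umap calculation(2) y by blast
      ultimately have "same_cycle c y (u y)" using a sym[of "u y" "u a'"] uX[OF y] same_cycle_trans by metis
      then show False using uswap y by blast
    qed
    then have "card (?A \<union> u ` ?A) = 6" using card_Un_disjoint[of ?A "u ` ?A"] cardA cardU by simp
    moreover have "?A \<union> u ` ?A \<subseteq> X" using A uX by blast
    ultimately show False using X(1,2) card_mono[of X "?A \<union> u ` ?A"] by simp
  qed
  have vu: "v y = u y \<or> v y = c (u y)" if y: "y \<in> X" for y
  proof -
    obtain k where k: "v y = (c ^^ k) (u y)" using uv[OF y] by (auto simp: same_cycle_def)
    have "(c ^^ k) (u y) = u y \<or> (c ^^ k) (u y) = c (u y)"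
      by (induction k) (use square uX[OF y] in auto)
    then show ?thesis using k by simp
  qed
  have uu: "u (u y) = y \<or> u (u y) = c y" if y: "y \<in> X" for y
  proof -
    have "same_cycle c y (u (u y))"
    proof -
      have "same_cycle c w w'" if "w \<in> X" "w' \<in> X" "\<not> same_cycle c w (u y)" "\<not> same_cycle c w' (u y)" for w w'
      proof (cases "same_cycle c (u y) z")
        case True
        then have "\<not> same_cycle c w z" "\<not> same_cycle c w' z" using join uX[OF y] that by blast+
        then show ?thesis using two join that by blast
      next
        case False
        then have "same_cycle c (u y) (u z)" using two uX[OF y] by blast
        then have "\<not> same_cycle c w (u z)" "\<not> same_cycle c w' (u z)" using join uX[OF y] that by blast+
        then show ?thesis using two join that by blast
      qed
      moreover have "\<not> same_cycle c (u (u y)) (u y)" using uswap sym uX y by blast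
      ultimately show ?thesis using uswap y uX by blast
    qed
    then obtain k where k: "u (u y) = (c ^^ k) y" by (auto simp: same_cycle_def)
    have "(c ^^ k) y = y \<or> (c ^^ k) y = c y"
      by (induction k) (use square y in auto)
    then show ?thesis using k by simp
  qed
  \<comment> \<open>At every point \<open>v\<close> is either \<open>u\<close> or
    \<open>c u\<close>, and since \<open>u (u y)\<close> lies in the cycle of \<open>y\<close>, the
    same alternative holds at \<open>y\<close> and at \<open>u (u y)\<close>. If \<open>v\<close>
    were \<open>c u\<close> at \<open>u y\<close>, the left side of the braid relation at
    \<open>y\<close> would contain one factor \<open>c\<close> and the right side none or two; but
    \<open>c\<close> has order two and no fixed point.\<close>
  have "v (u y) = u (u y)" if y: "y \<in> X" for y
  proof (rule ccontr)
    assume n: "v (u y) \<noteq> u (u y)"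
    note cl = y uX[OF y] cX[OF y] cX[OF uX[OF y]] uX[OF uX[OF y]]
    have vuy: "v (u y) = c (u (u y))" using vu[OF cl(2)] n by blast
    have vc': "v (c y) = c (v y)" "u (c y) = c (u y)" "u (c (u y)) = c (u (u y))" "v (c (u y)) = c (v (u y))"
      using vc uc cl by auto
    have "u (v (u y)) = c (u (u (u y)))" using vuy uc[OF cl(5)] by simp
    moreover have "v (u (v y)) = u (u (u y))"
    proof (cases "v y = u y")
      case True
      have "v (u (u y)) = u (u (u y))"
        using uu[OF y] True vc'(1,2) by auto
      then show ?thesis using True by simp
    next
      case False
      then have "v y = c (u y)" using vu y by blast
      moreover have "v (u (u y)) = c (u (u (u y)))"
        using uu[OF y] calculation vc'(1,2) by auto
      ultimately show ?thesis using vc'(3) vc[OF cl(5)] square[OF uX[OF cl(5)]] by simp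
    qed
    ultimately show False using b[OF y] ne[OF uX[OF cl(5)]] by simp
  qed
  moreover obtain y where "y \<in> X" "x = u y" using x bij_betw_imp_surj_on[OF u] by blast
  ultimately show ?thesis by simp
qed

lemma card_moved_eq_two:
  assumes "braid_on m X t" "finite X" "2 \<le> m" "\<not> all_equal_on m X t" "card (moved (t 1) X) \<le> 2"
  shows "card (moved (t 1) X) = 2"
  using card_moved_ge_two[OF braid_on_bij[OF assms(1)] assms(2) moved_nonempty[OF assms(1,4)]] assms(3,5)
  by simp

text \<open>Otherwise \<open>t 1\<close> moves exactly two points, and the path of supports would
  have \<open>m\<close> distinct vertices in a smaller set.\<close>

lemma few_points_all_equal:
  assumes t: "braid_on m X t" and X: "finite X" "card X < m" and m: "5 \<le> m"
    and bound: "\<not> all_equal_on m X t \<Longrightarrow> card (moved (t 1) X) \<le> 2"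
  shows "all_equal_on m X t"
proof (rule ccontr)
  assume ne: "\<not> all_equal_on m X t"
  have two: "card (moved (t 1) X) = 2"
    using card_moved_eq_two[OF t X(1) _ ne bound[OF ne]] m by simp
  have m4: "3 \<le> m" "m \<noteq> 4" using m by auto
  obtain p where p: "inj_on p {1..m}" "p ` {1..m} \<subseteq> X"
    by (rule transposition_path[OF t X(1) m4 ne two])
  then have "card {1..m} \<le> card X" using card_inj_on_le X(1) by blast
  then show False using X(2) by simp
qed

text \<open>The start of the induction. Without a generator \<open>t 6\<close>, agreement of
  \<open>t 3\<close> and \<open>t 4\<close> on the moved points rests on there being at most two
  non-trivial cycles. The remaining three strands then act non-trivially on the fixed points, so
  there are at least three of these.\<close>

lemma card_moved_le_two_5:
  assumes t: "braid_on 5 X t" and X: "finite X" "card X \<le> 5" and ne: "\<not> all_equal_on 5 X t"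
  shows "card (moved (t 1) X) \<le> 2"
proof -
  let ?c = "t 1" and ?M = "moved (t 1) X"
  have c: "bij_betw ?c X X" using braid_on_bij[OF t] by simp
  have s: "braid_on 3 X (\<lambda>i. t (i + 2))" using braid_on_shift[of 3 2 X t] t by simp
  have tc: "t i (?c y) = ?c (t i y)" if "3 \<le> i" "i < 5" "y \<in> X" for i y
    using braid_on_commute[OF t, of i 1 y] that by auto
  have MX: "?M \<subseteq> X" by (auto simp: moved_def)
  have M5: "card ?M \<le> 5" using card_mono[OF X(1) MX] X(2) by simp
  have sc: "t (i + 2) (?c y) = ?c (t (i + 2) y)" if "1 \<le> i" "i < 3" "y \<in> X" for i y
    using tc[of "i + 2" y] that by simp
  have R: "braid_on 3 (cycle_rep ?c ` ?M) (\<lambda>i x. cycle_rep ?c (t (i + 2) x))"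
    using braid_on_cycle_reps[OF c X(1) s sc] by blast
  have "2 * card (cycle_rep ?c ` ?M) \<le> 5" using card_cycle_reps[OF c X(1)] M5 by linarith
  moreover have "finite (cycle_rep ?c ` ?M)" using X(1) MX finite_subset by blast
  ultimately have eq: "all_equal_on 3 (cycle_rep ?c ` ?M) (\<lambda>i x. cycle_rep ?c (t (i + 2) x))"
    using all_equal_on_two_points[OF R] by linarith
  have same: "same_cycle ?c (t 3 x) (t 4 x)" if "x \<in> ?M" for x
    using all_equal_on_cycle_reps[OF c X(1) s sc eq, of 1 2 x] that by (simp add: eval_nat_numeral)
  have bM: "bij_betw f ?M ?M" if "bij_betw f X X" "f ` ?M = ?M" for f
    using bij_betw_subset[OF that(1) MX that(2)] .
  have tM: "t i ` ?M = ?M" if "3 \<le> i" "i < 5" for i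
    by (rule moved_image[OF c X(1) braid_on_bij[OF t]]) (use tc that in auto)
  have cM: "bij_betw ?c ?M ?M" by (rule bM[OF c moved_image[OF c X(1) c HOL.refl]])
  have b: "bij_betw (t 3) ?M ?M" "bij_betw (t 4) ?M ?M"
    by (rule bM[OF braid_on_bij[OF t] tM]; simp)+
  have fM: "finite ?M" using X(1) MX finite_subset by blast
  have mM: "moved ?c ?M = ?M" by (auto simp: moved_def)
  have agree: "t 3 x = t 4 x" if x: "x \<in> ?M" for x
  proof (rule braid_eq_on_two_cycles[OF cM fM M5 mM b _ _ same _ x])
    fix y assume "y \<in> ?M"
    then have y: "y \<in> X" using MX by blast
    show "t 3 (?c y) = ?c (t 3 y)" "t 4 (?c y) = ?c (t 4 y)" using tc y by auto
    show "t 3 (t 4 (t 3 y)) = t 4 (t 3 (t 4 y))" using braid_on_braid[OF t, of 3] y by simp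
  qed
  have "card ?M + 3 \<le> card X"
  proof (rule many_fixed_points[OF t X(1) _ ne agree])
    assume F: "braid_on (5 - 2) (X - ?M) (\<lambda>i. t (i + 2))" "card (X - ?M) < 3"
    show "all_equal_on (5 - 2) (X - ?M) (\<lambda>i. t (i + 2))"
      using all_equal_on_two_points[OF F(1)] F(2) X(1) by simp
  qed simp
  then show ?thesis using X(2) by simp
qed

text \<open>Six strands on six points are excluded because of the outer automorphism of the
  symmetric group of degree six.\<close>

lemma card_moved_le_two:
  assumes "braid_on m X t" "finite X" "card X \<le> m" "m = 6 \<Longrightarrow> card X \<le> 5" "5 \<le> m" "\<not> all_equal_on m X t"
  shows "card (moved (t 1) X) \<le> 2"
  using assms
proof (induction m arbitrary: X t rule: less_induct)
  case (less m)
  note t = less.prems(1) and X = less.prems(2,3) and ne = less.prems(6)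
  consider "m = 5" | "m = 6" | "7 \<le> m" using less.prems(5) by linarith
  then show ?case
  proof cases
    case 1
    then show ?thesis using card_moved_le_two_5 t X ne by blast
  next
    case 2
    \<comment> \<open>The first five strands act on at most five points. Their action is not cyclic
      either, because \<open>t 1 = t 2\<close> would spread to the sixth strand.\<close>
    have t5: "braid_on 5 X t" using braid_on_mono[OF t] 2 by simp
    have "\<not> all_equal_on 5 X t"
    proof
      assume "all_equal_on 5 X t"
      then have "t 1 x = t (Suc 1) x" if "x \<in> X" for x
        using all_equal_onD[of 5 X t 1 "Suc 1" x] that by simp
      then show False using all_equal_onI_consecutive[OF t, of 1] ne 2 by simp
    qed
    then show ?thesis using card_moved_le_two_5[OF t5 X(1)] less.prems(4) 2 by simp
  next
    case 3
    let ?c = "t 1" and ?M = "moved (t 1) X"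
    \<comment> \<open>The induction hypothesis for \<open>m - 2\<close> strands. For
      \<open>m = 8\<close> its restriction on six strands is met, since \<open>Y\<close> then has
      fewer than six points.\<close>
    have P: "all_equal_on (m - 2) Y s" if "braid_on (m - 2) Y s" "finite Y" "card Y < m - 2"
      for Y :: "'a set" and s
      by (rule few_points_all_equal[OF that]) (use less.IH[OF _ that(1,2)] that(3) 3 in auto)
    have c: "bij_betw ?c X X" using braid_on_bij[OF t] 3 by simp
    have s: "braid_on (m - 2) X (\<lambda>i. t (i + 2))"
      using braid_on_shift[of "m - 2" 2 X t] t le_add_diff_inverse2[of 2 m] 3 by simp
    have sc: "t (i + 2) (?c y) = ?c (t (i + 2) y)" if "1 \<le> i" "i < m - 2" "y \<in> X" for i y
      using braid_on_commute[OF t, of "i + 2" 1 y] that by auto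
    have MX: "?M \<subseteq> X" by (auto simp: moved_def)
    have "2 * card (cycle_rep ?c ` ?M) \<le> m"
      using card_cycle_reps[OF c X(1)] card_mono[OF X(1) MX] X(2) by linarith
    then have R: "card (cycle_rep ?c ` ?M) < m - 2" using 3 by linarith
    have "finite (cycle_rep ?c ` ?M)" using X(1) MX finite_subset by blast
    then have eq: "all_equal_on (m - 2) (cycle_rep ?c ` ?M) (\<lambda>i x. cycle_rep ?c (t (i + 2) x))"
      using P braid_on_cycle_reps[OF c X(1) s sc] R by blast
    have "card ?M + (m - 2) \<le> card X"
    proof (rule many_fixed_points[OF t X(1) _ ne eq_on_moved[OF t X(1) 3 eq]])
      show "all_equal_on (m - 2) (X - ?M) (\<lambda>i. t (i + 2))"
        if "braid_on (m - 2) (X - ?M) (\<lambda>i. t (i + 2))" "card (X - ?M) < m - 2"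
        using P[OF that(1) _ that(2)] X(1) by simp
    qed (use 3 in auto)
    then show ?thesis using X(2) 3 by linarith
  qed
qed

lemma cyclic_commute:
  assumes "u a = b \<and> u b = c \<and> u c = a \<or> u a = c \<and> u b = a \<and> u c = b"
    and "v a = b \<and> v b = c \<and> v c = a \<or> v a = c \<and> v b = a \<and> v c = b"
    and "y \<in> {a, b, c}"
  shows "u (v y) = v (u y)"
  using assms by (elim disjE conjE insertE emptyE) simp_all

text \<open>If \<open>t 1\<close> moved all three points, so would \<open>t 2\<close>; both would be
  3-cycles of the same three points, and these commute.\<close>

lemma card_moved_le_two_3:
  assumes t: "braid_on 3 X t" and X: "card X = 3" and ne: "\<not> all_equal_on 3 X t"
  shows "card (moved (t 1) X) \<le> 2"
proof (rule ccontr)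
  assume n: "\<not> ?thesis"
  obtain a b c where abc: "X = {a, b, c}" "a \<noteq> b" "a \<noteq> c" "b \<noteq> c"
    using X by (auto simp: card_3_iff)
  have fX: "finite X" using abc by simp
  have all: "moved (t i) X = X" if "i = 1 \<or> i = 2" for i
  proof (rule card_subset_eq[OF fX])
    show "moved (t i) X \<subseteq> X" by (auto simp: moved_def)
    then show "card (moved (t i) X) = card X"
      using braid_on_card_moved[OF t, of i] n X that card_mono[OF fX, of "moved (t i) X"] by auto
  qed
  have cyc: "(t i a = b \<and> t i b = c \<and> t i c = a) \<or> (t i a = c \<and> t i b = a \<and> t i c = b)" if "i = 1 \<or> i = 2" for i
  proof -
    have bij: "bij_betw (t i) X X" using braid_on_bij[OF t] that by auto
    have X: "a \<in> X" "b \<in> X" "c \<in> X" using abc by auto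
    have "t i a \<in> {a, b, c}" "t i b \<in> {a, b, c}" "t i c \<in> {a, b, c}"
      using bij_betwE[OF bij] X abc(1) by blast+
    moreover have "t i a \<noteq> t i b" "t i a \<noteq> t i c" "t i b \<noteq> t i c"
      using inj_onD[OF bij_betw_imp_inj_on[OF bij]] X abc(2-4) by blast+
    moreover have "t i x \<noteq> x" if "x \<in> X" for x
      using all[OF \<open>i = 1 \<or> i = 2\<close>] that by (auto simp: moved_def)
    then have "t i a \<noteq> a" "t i b \<noteq> b" "t i c \<noteq> c" using X by blast+
    ultimately show ?thesis by auto
  qed
  have "t 1 x = t (Suc 1) x" if "x \<in> X" for x
  proof (rule commuting_braid_eq[OF _ _ _ _ that])
    show "bij_betw (t 1) X X" "bij_betw (t (Suc 1)) X X" using braid_on_bij[OF t] by auto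
    show "t 1 (t (Suc 1) y) = t (Suc 1) (t 1 y)" if "y \<in> X" for y
    proof -
      have "Suc 1 = 1 \<or> Suc 1 = (2::nat)" by simp
      from cyc[OF disjI1[OF HOL.refl]] cyc[OF this] show ?thesis
        using cyclic_commute[of "t 1" a b c "t (Suc 1)" y] that abc(1) by blast
    qed
    show "t 1 (t (Suc 1) (t 1 y)) = t (Suc 1) (t 1 (t (Suc 1) y))" if "y \<in> X" for y
      using braid_on_braid[OF t, of 1] that by simp
  qed
  then show False using all_equal_onI_consecutive[OF t, of 1] ne by simp
qed

lemma artin_odd:
  assumes t: "braid_on m X t" and X: "finite X" "card X = m" and m: "3 \<le> m" "odd m"
    and ne: "\<not> all_equal_on m X t"
  obtains p where "bij_betw p {1..m} X"
    "\<And>i. 1 \<le> i \<Longrightarrow> i < m \<Longrightarrow> moved (t i) X = {p i, p (Suc i)}"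
proof -
  have m46: "m \<noteq> 4" "m \<noteq> 6" using m(2) by auto
  have "card (moved (t 1) X) \<le> 2"
  proof (cases "m = 3")
    case True
    then show ?thesis using card_moved_le_two_3 t X ne by blast
  next
    case False
    then have "5 \<le> m" using m m46(1) by linarith
    then show ?thesis using card_moved_le_two[OF t X(1)] X m46 ne by simp
  qed
  then have "card (moved (t 1) X) = 2" using card_moved_eq_two[OF t X(1) _ ne] m by simp
  then obtain p where p: "inj_on p {1..m}" "p ` {1..m} \<subseteq> X"
    "\<And>i. 1 \<le> i \<Longrightarrow> i < m \<Longrightarrow> moved (t i) X = {p i, p (Suc i)}"
    using transposition_path[OF t X(1) m(1) m46(1) ne] by blast
  moreover have "p ` {1..m} = X"
    by (rule card_subset_eq[OF X(1) p(2)]) (use card_image[OF p(1)] X(2) in simp)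
  ultimately show thesis using that[of p] by (simp add: bij_betw_def)
qed

section \<open>Groups given by generators and relations\<close>

lemma list_product_Nil [simp]: "list_product G [] = \<one>\<^bsub>G\<^esub>"
  by (simp add: list_product_def)

lemma list_product_Cons [simp]: "list_product G (g # gs) = g \<otimes>\<^bsub>G\<^esub> list_product G gs"
  by (simp add: list_product_def)

lemma (in monoid) list_product_closed: "set gs \<subseteq> carrier G \<Longrightarrow> list_product G gs \<in> carrier G"
  by (induction gs) auto

lemma (in monoid) list_product_append:
  "set gs \<subseteq> carrier G \<Longrightarrow> set hs \<subseteq> carrier G \<Longrightarrow>
    list_product G (gs @ hs) = list_product G gs \<otimes> list_product G hs"
  by (induction gs) (auto simp: list_product_closed m_assoc)

lemma hom_list_product:
  assumes "group G" "group H" "h \<in> hom G H" "set gs \<subseteq> carrier G"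
  shows "h (list_product G gs) = list_product H (map h gs)"
proof -
  interpret group_hom G H h
    using assms(1-3) by (simp add: group_hom_def group_hom_axioms_def)
  show ?thesis using assms(4) by (induction gs) (auto simp: G.list_product_closed)
qed

definition word_eval :: "('g, 'b) monoid_scheme \<Rightarrow> ('a \<Rightarrow> 'g) \<Rightarrow> 'a word \<Rightarrow> 'g" where
  "word_eval H f u = list_product H (map (\<lambda>(x, b). if b then f x else inv\<^bsub>H\<^esub> f x) u)"

lemma word_eval_positive: "word_eval H f (positive_word xs) = list_product H (map f xs)"
  by (simp add: word_eval_def positive_word_def comp_def)

lemma word_letters_closed:
  assumes "group H" "f \<in> X \<rightarrow> carrier H" "u \<in> words X"
  shows "set (map (\<lambda>(x, b). if b then f x else inv\<^bsub>H\<^esub> f x) u) \<subseteq> carrier H"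
  using assms group.inv_closed by (fastforce simp: words_def Pi_iff split: if_splits)

lemma word_eval_closed:
  "group H \<Longrightarrow> f \<in> X \<rightarrow> carrier H \<Longrightarrow> u \<in> words X \<Longrightarrow> word_eval H f u \<in> carrier H"
  unfolding word_eval_def by (rule monoid.list_product_closed[OF group.is_monoid word_letters_closed])

lemma word_eval_append:
  assumes "group H" "f \<in> X \<rightarrow> carrier H" "u \<in> words X" "v \<in> words X"
  shows "word_eval H f (u @ v) = word_eval H f u \<otimes>\<^bsub>H\<^esub> word_eval H f v"
  using monoid.list_product_append[OF group.is_monoid[OF assms(1)]
      word_letters_closed[OF assms(1,2,3)] word_letters_closed[OF assms(1,2,4)]]
  by (simp add: word_eval_def)

lemma word_eval_word_eq:
  assumes H: "group H" and f: "f \<in> X \<rightarrow> carrier H"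
    and R: "\<And>u v. (u, v) \<in> R \<Longrightarrow> u \<in> words X \<Longrightarrow> v \<in> words X \<Longrightarrow> word_eval H f u = word_eval H f v"
  shows "word_eq X R u v \<Longrightarrow> word_eval H f u = word_eval H f v"
proof (induction rule: word_eq.induct)
  case (cancel x b)
  interpret group H by (fact H)
  have "f x \<in> carrier H" using cancel f by blast
  then show ?case by (simp add: word_eval_def)
next
  case (cong u u' v v')
  then show ?case using word_eq_in_words word_eval_append[OF H f] by metis
qed (use R in auto)

text \<open>The universal property of the presentation. Evaluation is constant on the classes of
  \<open>word_eq\<close>, so its value can be read off from any chosen word of a class.\<close>

lemma presented_group_hom_exists:
  fixes X :: "'a set"
  assumes H: "group H" and f: "f \<in> X \<rightarrow> carrier H"
    and R: "\<And>u v. (u, v) \<in> R \<Longrightarrow> u \<in> words X \<Longrightarrow> v \<in> words X \<Longrightarrow> word_eval H f u = word_eval H f v"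
  obtains h where "h \<in> hom (presented_group X R) H \<inter> extensional (carrier (presented_group X R))"
    "\<And>x. x \<in> X \<Longrightarrow> h (word_class X R (positive_word [x])) = f x"
proof -
  let ?P = "presented_group X R"
  define h where "h = restrict (\<lambda>U. word_eval H f (SOME u. u \<in> U)) (carrier ?P)"
  have car: "carrier ?P = word_class X R ` words X" by (simp add: presented_group_def)
  have h: "h (word_class X R u) = word_eval H f u" if u: "u \<in> words X" for u
  proof -
    have "(SOME v. v \<in> word_class X R u) \<in> word_class X R u"
      by (rule someI[of _ u]) (simp add: word_class_def u word_eq.refl)
    then have "word_eq X R u (SOME v. v \<in> word_class X R u)" by (simp add: word_class_def)
    then have "word_eval H f (SOME v. v \<in> word_class X R u) = word_eval H f u"
      using word_eval_word_eq[OF H f R] by metis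
    then show ?thesis using u by (simp add: h_def car)
  qed
  have app: "u @ v \<in> words X" if "u \<in> words X" "v \<in> words X" for u v :: "'a word"
    using that by (auto simp: words_def)
  have "h \<in> hom ?P H"
  proof (rule homI)
    show "h U \<in> carrier H" if "U \<in> carrier ?P" for U
      using that h word_eval_closed[OF H f] by (auto simp: car)
    show "h (U \<otimes>\<^bsub>?P\<^esub> V) = h U \<otimes>\<^bsub>H\<^esub> h V" if UV: "U \<in> carrier ?P" "V \<in> carrier ?P" for U V
    proof -
      from UV obtain u v where "u \<in> words X" "U = word_class X R u" "v \<in> words X" "V = word_class X R v"
        by (auto simp: car)
      then show ?thesis using h app word_eval_append[OF H f] by (simp add: presented_group_mult)
    qed
  qed
  moreover have "h \<in> extensional (carrier ?P)" by (simp add: h_def)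
  moreover have "h (word_class X R (positive_word [x])) = f x" if "x \<in> X" for x
    using h[of "positive_word [x]"] that f word_eval_positive[of H f "[x]"]
      monoid.r_one[OF group.is_monoid[OF H], of "f x"]
    by (auto simp: words_def positive_word_def Pi_iff)
  ultimately show thesis using that by blast
qed

lemma word_class_letter_closed:
  "x \<in> X \<Longrightarrow> word_class X R (positive_word [x]) \<in> carrier (presented_group X R)"
  by (auto simp: presented_group_def words_def positive_word_def)

text \<open>Generation is put as the absence of a smaller subgroup containing the letters; a
  property of all elements then follows as soon as it defines a subgroup.\<close>

lemma presented_group_generated:
  assumes K: "subgroup K (presented_group X R)"
    and gen: "\<And>x. x \<in> X \<Longrightarrow> word_class X R (positive_word [x]) \<in> K"
  shows "K = carrier (presented_group X R)"
proof
  let ?P = "presented_group X R"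
  interpret group ?P by (rule group_presented_group)
  show "K \<subseteq> carrier ?P" using K by (rule subgroup.subset)
  have letter: "word_class X R [(x, b)] \<in> K" if x: "x \<in> X" for x b
  proof (cases b)
    case True
    then show ?thesis using gen[OF x] by (simp add: positive_word_def)
  next
    case False
    have w: "[(x, True)] \<in> words X" "[(x, False)] \<in> words X" "[(x, False), (x, True)] \<in> words X"
      using x by (auto simp: words_def)
    have "word_class X R [(x, False), (x, True)] = word_class X R []"
      using word_eq.cancel[OF x, of R False] word_class_eq_iff[OF w(3), of R "[]"] by simp
    then have "word_class X R [(x, False)] \<otimes>\<^bsub>?P\<^esub> word_class X R [(x, True)] = \<one>\<^bsub>?P\<^esub>"
      unfolding presented_group_mult[OF w(2,1)] by (simp add: presented_group_def)
    moreover have "word_class X R [(x, True)] \<in> carrier ?P" "word_class X R [(x, False)] \<in> carrier ?P"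
      using w by (auto simp: presented_group_def)
    ultimately have "word_class X R [(x, False)] = inv\<^bsub>?P\<^esub> (word_class X R [(x, True)])"
      using inv_equality by metis
    then show ?thesis
      using gen[OF x] False subgroup.m_inv_closed[OF K] by (simp add: positive_word_def)
  qed
  have "word_class X R u \<in> K" if "u \<in> words X" for u
    using that
  proof (induction u)
    case Nil
    then show ?case using subgroup.one_closed[OF K] by (simp add: presented_group_def)
  next
    case (Cons a u)
    obtain x b where a: "a = (x, b)" by (cases a)
    have "x \<in> X" "u \<in> words X" "[(x, b)] \<in> words X" using Cons.prems a by (auto simp: words_def)
    moreover from this have "word_class X R (a # u) = word_class X R [(x, b)] \<otimes>\<^bsub>?P\<^esub> word_class X R u"
      using presented_group_mult[of "[(x, b)]" X u R] a by simp
    ultimately show ?case using letter Cons.IH subgroup.m_closed[OF K] by metis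
  qed
  then show "carrier ?P \<subseteq> K" by (auto simp: presented_group_def)
qed

lemma word_class_positive_word:
  "set xs \<subseteq> X \<Longrightarrow> word_class X R (positive_word xs) =
    list_product (presented_group X R) (map (\<lambda>x. word_class X R (positive_word [x])) xs)"
proof (induction xs)
  case Nil
  then show ?case by (simp add: positive_word_def presented_group_def)
next
  case (Cons x xs)
  have "positive_word [x] \<in> words X" "positive_word xs \<in> words X"
    using Cons.prems by (auto simp: words_def positive_word_def)
  then have "word_class X R (positive_word (x # xs)) =
      word_class X R (positive_word [x]) \<otimes>\<^bsub>presented_group X R\<^esub> word_class X R (positive_word xs)"
    by (simp add: presented_group_mult positive_word_def)
  then show ?case using Cons by simp
qed

lemma presented_group_positive_relation:
  assumes "(positive_word xs, positive_word ys) \<in> R" "set xs \<subseteq> X" "set ys \<subseteq> X"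
  shows "list_product (presented_group X R) (map (\<lambda>x. word_class X R (positive_word [x])) xs) =
    list_product (presented_group X R) (map (\<lambda>x. word_class X R (positive_word [x])) ys)"
proof -
  have "positive_word xs \<in> words X" "positive_word ys \<in> words X"
    using assms(2,3) by (auto simp: words_def positive_word_def)
  then have "word_class X R (positive_word xs) = word_class X R (positive_word ys)"
    using assms(1) word_class_eq_iff word_eq.rel by metis
  then show ?thesis using word_class_positive_word assms(2,3) by metis
qed

lemma subgroup_equalizer:
  assumes "group G" "group H" "h \<in> hom G H" "k \<in> hom G H"
  shows "subgroup {x \<in> carrier G. h x = k x} G"
proof -
  interpret h: group_hom G H h
    using assms by (simp add: group_hom_def group_hom_axioms_def)
  interpret k: group_hom G H k
    using assms by (simp add: group_hom_def group_hom_axioms_def)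
  show ?thesis by unfold_locales auto
qed

lemma subgroup_vimage:
  assumes "group G" "group H" "h \<in> hom G H" "subgroup K H"
  shows "subgroup {x \<in> carrier G. h x \<in> K} G"
proof -
  interpret h: group_hom G H h
    using assms by (simp add: group_hom_def group_hom_axioms_def)
  show ?thesis
    by unfold_locales (auto simp: subgroup.m_closed[OF assms(4)] subgroup.one_closed[OF assms(4)]
        subgroup.m_inv_closed[OF assms(4)])
qed

section \<open>The relations of type B\<close>

text \<open>The conditions on the images of the \<open>\<sigma> i\<close> under a homomorphism from
  the Artin group; every such tuple extends to one by \<open>artin_B_hom_exists\<close>. Products
  are nested to the right, as \<open>list_product\<close> produces them.\<close>

definition B_tuple :: "('g, 'b) monoid_scheme \<Rightarrow> nat \<Rightarrow> (nat \<Rightarrow> 'g) \<Rightarrow> bool" where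
  "B_tuple G n x \<longleftrightarrow>
     (\<forall>i. 1 \<le> i \<longrightarrow> i \<le> n \<longrightarrow> x i \<in> carrier G) \<and>
     (2 \<le> n \<longrightarrow> x 1 \<otimes>\<^bsub>G\<^esub> (x 2 \<otimes>\<^bsub>G\<^esub> (x 1 \<otimes>\<^bsub>G\<^esub> x 2)) = x 2 \<otimes>\<^bsub>G\<^esub> (x 1 \<otimes>\<^bsub>G\<^esub> (x 2 \<otimes>\<^bsub>G\<^esub> x 1))) \<and>
     (\<forall>i. 2 \<le> i \<longrightarrow> i < n \<longrightarrow>
        x i \<otimes>\<^bsub>G\<^esub> (x (Suc i) \<otimes>\<^bsub>G\<^esub> x i) = x (Suc i) \<otimes>\<^bsub>G\<^esub> (x i \<otimes>\<^bsub>G\<^esub> x (Suc i))) \<and>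
     (\<forall>i j. 1 \<le> i \<longrightarrow> i + 2 \<le> j \<longrightarrow> j \<le> n \<longrightarrow> x i \<otimes>\<^bsub>G\<^esub> x j = x j \<otimes>\<^bsub>G\<^esub> x i)"

lemma B_tupleD:
  assumes "B_tuple G n x"
  shows "1 \<le> i \<Longrightarrow> i \<le> n \<Longrightarrow> x i \<in> carrier G"
    and "2 \<le> n \<Longrightarrow> x 1 \<otimes>\<^bsub>G\<^esub> (x 2 \<otimes>\<^bsub>G\<^esub> (x 1 \<otimes>\<^bsub>G\<^esub> x 2)) = x 2 \<otimes>\<^bsub>G\<^esub> (x 1 \<otimes>\<^bsub>G\<^esub> (x 2 \<otimes>\<^bsub>G\<^esub> x 1))"
    and "2 \<le> i \<Longrightarrow> i < n \<Longrightarrow>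
      x i \<otimes>\<^bsub>G\<^esub> (x (Suc i) \<otimes>\<^bsub>G\<^esub> x i) = x (Suc i) \<otimes>\<^bsub>G\<^esub> (x i \<otimes>\<^bsub>G\<^esub> x (Suc i))"
    and "1 \<le> i \<Longrightarrow> i + 2 \<le> j \<Longrightarrow> j \<le> n \<Longrightarrow> x i \<otimes>\<^bsub>G\<^esub> x j = x j \<otimes>\<^bsub>G\<^esub> x i"
  using assms unfolding B_tuple_def by blast+

lemma B_tuple_hom:
  assumes "B_tuple G n x" "h \<in> hom G H" "group G" "group H"
  shows "B_tuple H n (\<lambda>i. h (x i))"
proof -
  interpret group_hom G H h
    using assms(2-4) by (simp add: group_hom_def group_hom_axioms_def)
  note x = B_tupleD[OF assms(1)]
  have [simp]: "x i \<in> carrier G" if "1 \<le> i" "i \<le> n" for i using x(1) that by blast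
  have m: "h a \<otimes>\<^bsub>H\<^esub> h b = h (a \<otimes>\<^bsub>G\<^esub> b)" if "a \<in> carrier G" "b \<in> carrier G" for a b
    using that by simp
  show ?thesis
    unfolding B_tuple_def
  proof (intro conjI allI impI)
    assume "2 \<le> n"
    then show "h (x 1) \<otimes>\<^bsub>H\<^esub> (h (x 2) \<otimes>\<^bsub>H\<^esub> (h (x 1) \<otimes>\<^bsub>H\<^esub> h (x 2))) =
        h (x 2) \<otimes>\<^bsub>H\<^esub> (h (x 1) \<otimes>\<^bsub>H\<^esub> (h (x 2) \<otimes>\<^bsub>H\<^esub> h (x 1)))"
      using x(2) by (simp add: m del: hom_mult)
  next
    fix i assume "2 \<le> i" "i < n"
    then show "h (x i) \<otimes>\<^bsub>H\<^esub> (h (x (Suc i)) \<otimes>\<^bsub>H\<^esub> h (x i)) =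
        h (x (Suc i)) \<otimes>\<^bsub>H\<^esub> (h (x i) \<otimes>\<^bsub>H\<^esub> h (x (Suc i)))"
      using x(3)[of i] by (simp add: m del: hom_mult)
  next
    fix i j assume "1 \<le> i" "i + 2 \<le> j" "j \<le> n"
    then show "h (x i) \<otimes>\<^bsub>H\<^esub> h (x j) = h (x j) \<otimes>\<^bsub>H\<^esub> h (x i)"
      using x(4)[of i j] by (simp add: m del: hom_mult)
  qed simp
qed

lemma set_alternating: "set (alternating x y k) \<subseteq> {x, y}"
  by (auto simp: alternating_def)

lemma alternating_2_3_4:
  "alternating x y 2 = [x, y]" "alternating x y 3 = [x, y, x]" "alternating x y 4 = [x, y, x, y]"
  by (simp_all add: alternating_def upt_conv_Cons)

lemma coxeter_B_cases:
  assumes "1 \<le> i" "i < j"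
  shows "coxeter_B i j = (if j = Suc i then if i = 1 then 4 else 3 else 2)"
    and "coxeter_B j i = (if j = Suc i then if i = 1 then 4 else 3 else 2)"
  using assms by (auto simp: coxeter_B_def doubleton_eq_iff)

text \<open>The presentation has one relation for each ordered pair of distinct generators. As the
  labels are symmetric, the relation for \<open>(j, i)\<close> is the one for \<open>(i, j)\<close>
  with its sides exchanged, so pairs with \<open>i < j\<close> suffice.\<close>

lemma B_tuple_iff_braid_relations:
  assumes "group G"
  shows "B_tuple G n x \<longleftrightarrow> x \<in> {1..n} \<rightarrow> carrier G \<and>
    (\<forall>i\<in>{1..n}. \<forall>j\<in>{1..n}. i \<noteq> j \<longrightarrow>
       list_product G (map x (alternating i j (coxeter_B i j))) =
       list_product G (map x (alternating j i (coxeter_B i j))))" (is "_ \<longleftrightarrow> ?C \<and> ?R")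
proof -
  interpret group G by (fact assms)
  let ?rel = "\<lambda>i j. list_product G (map x (alternating i j (coxeter_B i j))) =
      list_product G (map x (alternating j i (coxeter_B i j)))"
  have rel: "?rel i j \<longleftrightarrow>
      (if j = Suc i then
        if i = 1 then x 1 \<otimes>\<^bsub>G\<^esub> (x 2 \<otimes>\<^bsub>G\<^esub> (x 1 \<otimes>\<^bsub>G\<^esub> x 2)) = x 2 \<otimes>\<^bsub>G\<^esub> (x 1 \<otimes>\<^bsub>G\<^esub> (x 2 \<otimes>\<^bsub>G\<^esub> x 1))
        else x i \<otimes>\<^bsub>G\<^esub> (x (Suc i) \<otimes>\<^bsub>G\<^esub> x i) = x (Suc i) \<otimes>\<^bsub>G\<^esub> (x i \<otimes>\<^bsub>G\<^esub> x (Suc i))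
      else x i \<otimes>\<^bsub>G\<^esub> x j = x j \<otimes>\<^bsub>G\<^esub> x i)"
    if "1 \<le> i" "i < j" "j \<le> n" ?C for i j
  proof -
    have "x i \<in> carrier G" "x j \<in> carrier G" using that by (auto simp: Pi_iff)
    then show ?thesis
      using coxeter_B_cases[OF that(1,2)] by (auto simp: alternating_2_3_4 alternating_2_3_4(1)[unfolded numeral_2_eq_2] numeral_2_eq_2)
  qed
  have sym: "?rel j i" if "1 \<le> i" "i < j" "?rel i j" for i j
    using coxeter_B_cases[OF that(1,2)] that(3) by auto
  show ?thesis
  proof
    assume B: "B_tuple G n x"
    have C: ?C using B_tupleD(1)[OF B] by auto
    have *: "?rel i j" if "1 \<le> i" "i < j" "j \<le> n" for i j
      using rel[OF that C] B_tupleD(2)[OF B] B_tupleD(3)[OF B, of i] B_tupleD(4)[OF B, of i j] that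
      by (auto split: if_splits)
    have ?R
    proof (intro ballI impI)
      fix i j assume "i \<in> {1..n}" "j \<in> {1..n}" "i \<noteq> j"
      then show "?rel i j" using *[of i j] sym[OF _ _ *[of j i]] by (cases i j rule: linorder_cases) auto
    qed
    then show "?C \<and> ?R" using C by blast
  next
    assume CR: "?C \<and> ?R"
    have r: "if j = Suc i then
        if i = 1 then x 1 \<otimes>\<^bsub>G\<^esub> (x 2 \<otimes>\<^bsub>G\<^esub> (x 1 \<otimes>\<^bsub>G\<^esub> x 2)) = x 2 \<otimes>\<^bsub>G\<^esub> (x 1 \<otimes>\<^bsub>G\<^esub> (x 2 \<otimes>\<^bsub>G\<^esub> x 1))
        else x i \<otimes>\<^bsub>G\<^esub> (x (Suc i) \<otimes>\<^bsub>G\<^esub> x i) = x (Suc i) \<otimes>\<^bsub>G\<^esub> (x i \<otimes>\<^bsub>G\<^esub> x (Suc i))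
      else x i \<otimes>\<^bsub>G\<^esub> x j = x j \<otimes>\<^bsub>G\<^esub> x i" if "1 \<le> i" "i < j" "j \<le> n" for i j
    proof -
      have "i \<in> {1..n}" "j \<in> {1..n}" "i \<noteq> j" using that by auto
      then have "?rel i j" using CR by blast
      then show ?thesis using iffD1[OF rel[OF that conjunct1[OF CR]]] by blast
    qed
    show "B_tuple G n x"
      unfolding B_tuple_def
    proof (intro conjI allI impI)
      show "x i \<in> carrier G" if "1 \<le> i" "i \<le> n" for i using CR that by auto
      show "x 1 \<otimes>\<^bsub>G\<^esub> (x 2 \<otimes>\<^bsub>G\<^esub> (x 1 \<otimes>\<^bsub>G\<^esub> x 2)) = x 2 \<otimes>\<^bsub>G\<^esub> (x 1 \<otimes>\<^bsub>G\<^esub> (x 2 \<otimes>\<^bsub>G\<^esub> x 1))" if "2 \<le> n"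
        using r[of 1 2] that by simp
      show "x i \<otimes>\<^bsub>G\<^esub> (x (Suc i) \<otimes>\<^bsub>G\<^esub> x i) = x (Suc i) \<otimes>\<^bsub>G\<^esub> (x i \<otimes>\<^bsub>G\<^esub> x (Suc i))" if "2 \<le> i" "i < n" for i
        using r[of i "Suc i"] that by simp
      show "x i \<otimes>\<^bsub>G\<^esub> x j = x j \<otimes>\<^bsub>G\<^esub> x i" if "1 \<le> i" "i + 2 \<le> j" "j \<le> n" for i j
        using r[of i j] that by simp
    qed
  qed
qed

lemma braid_relationsE:
  assumes "(u, v) \<in> braid_relations X m"
  obtains i j where "i \<in> X" "j \<in> X" "i \<noteq> j"
    "u = positive_word (alternating i j (m i j))" "v = positive_word (alternating j i (m i j))"
  using assms unfolding braid_relations_def by blast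

lemma group_artin_group: "group (artin_group X m)" and group_coxeter_group: "group (coxeter_group X m)"
  by (simp_all add: artin_group_def coxeter_group_def group_presented_group)

lemma artin_gen_closed: "x \<in> X \<Longrightarrow> artin_gen X m x \<in> carrier (artin_group X m)"
  and coxeter_gen_closed: "x \<in> X \<Longrightarrow> coxeter_gen X m x \<in> carrier (coxeter_group X m)"
  by (simp_all add: artin_gen_def artin_group_def coxeter_gen_def coxeter_group_def word_class_letter_closed)

lemma artin_group_generated:
  "subgroup K (artin_group X m) \<Longrightarrow> (\<And>x. x \<in> X \<Longrightarrow> artin_gen X m x \<in> K) \<Longrightarrow>
    K = carrier (artin_group X m)"
  unfolding artin_group_def artin_gen_def by (rule presented_group_generated)

lemma coxeter_group_generated:
  "subgroup K (coxeter_group X m) \<Longrightarrow> (\<And>x. x \<in> X \<Longrightarrow> coxeter_gen X m x \<in> K) \<Longrightarrow>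
    K = carrier (coxeter_group X m)"
  unfolding coxeter_group_def coxeter_gen_def by (rule presented_group_generated)

lemma B_tuple_artin: "B_tuple (artin_B n) n (sigma_B n)"
  unfolding B_tuple_iff_braid_relations[OF group_artin_group]
proof (intro conjI ballI impI)
  show "sigma_B n \<in> {1..n} \<rightarrow> carrier (artin_B n)" by (intro Pi_I artin_gen_closed)
  fix i j assume ij: "i \<in> {1..n}" "j \<in> {1..n}" "i \<noteq> j"
  show "list_product (artin_B n) (map (sigma_B n) (alternating i j (coxeter_B i j))) =
      list_product (artin_B n) (map (sigma_B n) (alternating j i (coxeter_B i j)))"
    unfolding artin_group_def artin_gen_def
    by (rule presented_group_positive_relation)
      (use ij set_alternating[of i j "coxeter_B i j"] set_alternating[of j i "coxeter_B i j"]
        in \<open>auto simp: braid_relations_def\<close>)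
qed

lemma B_tuple_coxeter: "B_tuple (W_B n) n (s_B n)"
  unfolding B_tuple_iff_braid_relations[OF group_coxeter_group]
proof (intro conjI ballI impI)
  show "s_B n \<in> {1..n} \<rightarrow> carrier (W_B n)" by (intro Pi_I coxeter_gen_closed)
  fix i j assume ij: "i \<in> {1..n}" "j \<in> {1..n}" "i \<noteq> j"
  show "list_product (W_B n) (map (s_B n) (alternating i j (coxeter_B i j))) =
      list_product (W_B n) (map (s_B n) (alternating j i (coxeter_B i j)))"
    unfolding coxeter_group_def coxeter_gen_def
    by (rule presented_group_positive_relation)
      (use ij set_alternating[of i j "coxeter_B i j"] set_alternating[of j i "coxeter_B i j"]
        in \<open>auto simp: coxeter_relations_def braid_relations_def\<close>)
qed

lemma coxeter_gen_square:
  assumes "x \<in> X"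
  shows "coxeter_gen X m x \<otimes>\<^bsub>coxeter_group X m\<^esub> coxeter_gen X m x = \<one>\<^bsub>coxeter_group X m\<^esub>"
proof -
  interpret group "coxeter_group X m" by (rule group_coxeter_group)
  have "(positive_word [x, x], positive_word []) \<in> coxeter_relations X m"
    using assms by (auto simp: coxeter_relations_def positive_word_def)
  from presented_group_positive_relation[OF this, of X] show ?thesis
    using assms coxeter_gen_closed[OF assms, of m]
    unfolding coxeter_gen_def[symmetric] coxeter_group_def[symmetric] by simp
qed

lemma B_tuple_word_eval:
  assumes H: "group H" and x: "B_tuple H n x" and "(u, v) \<in> braid_relations {1..n} coxeter_B"
  shows "word_eval H x u = word_eval H x v"
proof -
  obtain i j where ij: "i \<in> {1..n}" "j \<in> {1..n}" "i \<noteq> j"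
    "u = positive_word (alternating i j (coxeter_B i j))" "v = positive_word (alternating j i (coxeter_B i j))"
    using braid_relationsE[OF assms(3)] .
  have "\<forall>i\<in>{1..n}. \<forall>j\<in>{1..n}. i \<noteq> j \<longrightarrow>
      list_product H (map x (alternating i j (coxeter_B i j))) =
      list_product H (map x (alternating j i (coxeter_B i j)))"
    using x unfolding B_tuple_iff_braid_relations[OF H] ..
  then show ?thesis unfolding ij(4,5) word_eval_positive using ij(1-3) by blast
qed

lemma artin_B_hom_exists:
  assumes H: "group H" and x: "B_tuple H n x"
  obtains h where "h \<in> hom (artin_B n) H \<inter> extensional (carrier (artin_B n))"
    "\<And>i. i \<in> {1..n} \<Longrightarrow> h (sigma_B n i) = x i"
proof -
  have xC: "x \<in> {1..n} \<rightarrow> carrier H" using x B_tuple_iff_braid_relations[OF H] by blast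
  show thesis
    by (rule presented_group_hom_exists[OF H xC B_tuple_word_eval[OF H x]])
      (use that in \<open>auto simp: artin_group_def artin_gen_def\<close>)
qed

lemma W_B_hom_exists:
  assumes H: "group H" and x: "B_tuple H n x" and sq: "\<And>i. i \<in> {1..n} \<Longrightarrow> x i \<otimes>\<^bsub>H\<^esub> x i = \<one>\<^bsub>H\<^esub>"
  obtains h where "h \<in> hom (W_B n) H" "\<And>i. i \<in> {1..n} \<Longrightarrow> h (s_B n i) = x i"
proof -
  interpret group H by (fact H)
  have xC: "x \<in> {1..n} \<rightarrow> carrier H" using x B_tuple_iff_braid_relations[OF H] by blast
  have rel: "word_eval H x u = word_eval H x v" if uv: "(u, v) \<in> coxeter_relations {1..n} coxeter_B" for u v
  proof (cases "(u, v) \<in> braid_relations {1..n} coxeter_B")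
    case True
    then show ?thesis by (rule B_tuple_word_eval[OF H x])
  next
    case False
    then obtain i where i: "i \<in> {1..n}" and uv': "u = positive_word [i, i]" "v = []"
      using uv unfolding coxeter_relations_def by blast
    have "x i \<in> carrier H" using i xC by blast
    then show ?thesis
      unfolding uv' word_eval_positive using sq[OF i] by (simp add: word_eval_def)
  qed
  show thesis
    by (rule presented_group_hom_exists[OF H xC rel])
      (use that in \<open>auto simp: coxeter_group_def coxeter_gen_def\<close>)
qed

lemma artin_group_hom_eqI:
  assumes "group H" "h \<in> hom (artin_group X m) H" "k \<in> hom (artin_group X m) H"
    and "\<And>x. x \<in> X \<Longrightarrow> h (artin_gen X m x) = k (artin_gen X m x)" "a \<in> carrier (artin_group X m)"
  shows "h a = k a"
proof -
  have "{a \<in> carrier (artin_group X m). h a = k a} = carrier (artin_group X m)"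
    by (rule artin_group_generated[OF subgroup_equalizer[OF group_artin_group assms(1-3)]])
      (use assms(4) artin_gen_closed in auto)
  then show ?thesis using assms(5) by blast
qed

section \<open>Coset representatives\<close>

definition desc :: "('g, 'b) monoid_scheme \<Rightarrow> (nat \<Rightarrow> 'g) \<Rightarrow> nat \<Rightarrow> nat \<Rightarrow> 'g" where
  "desc G s a b = list_product G (map s (rev [b..<Suc a]))"

definition asc :: "('g, 'b) monoid_scheme \<Rightarrow> (nat \<Rightarrow> 'g) \<Rightarrow> nat \<Rightarrow> nat \<Rightarrow> 'g" where
  "asc G s a b = list_product G (map s [a..<Suc b])"

text \<open>The first \<open>k\<close> letters of \<open>m, ..., 2, 1, 2, ..., m\<close>, for
  \<open>k < 2 * m\<close>. The first branch stops during the descent, at the latest after the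
  letter 1.\<close>

definition coset_word :: "nat \<Rightarrow> nat \<Rightarrow> nat list" where
  "coset_word m k = (if k \<le> m then rev [Suc m - k..<Suc m] else rev [1..<Suc m] @ [2..<Suc (Suc k - m)])"

lemma length_coset_word: "k < 2 * m \<Longrightarrow> length (coset_word m k) = k"
  by (auto simp: coset_word_def)

lemma set_coset_word: "k < 2 * m \<Longrightarrow> set (coset_word m k) \<subseteq> {1..m}"
  by (auto simp: coset_word_def)

locale B_involutions = group G for G (structure) +
  fixes n :: nat and s :: "nat \<Rightarrow> 'a"
  assumes tuple: "B_tuple G n s"
    and square: "\<And>i. 1 \<le> i \<Longrightarrow> i \<le> n \<Longrightarrow> s i \<otimes> s i = \<one>"
begin

lemma s_closed [simp]: "1 \<le> i \<Longrightarrow> i \<le> n \<Longrightarrow> s i \<in> carrier G"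
  using B_tupleD(1)[OF tuple] by blast

lemma s_commute: "1 \<le> i \<Longrightarrow> i \<le> n \<Longrightarrow> 1 \<le> j \<Longrightarrow> j \<le> n \<Longrightarrow> i + 2 \<le> j \<or> j + 2 \<le> i \<Longrightarrow>
    s i \<otimes> s j = s j \<otimes> s i"
  using B_tupleD(4)[OF tuple] by metis

lemma set_s_subset: "set is \<subseteq> {1..n} \<Longrightarrow> set (map s is) \<subseteq> carrier G"
  by auto

lemma desc_closed [simp]: "1 \<le> b \<Longrightarrow> a \<le> n \<Longrightarrow> desc G s a b \<in> carrier G"
  unfolding desc_def by (rule list_product_closed) auto

lemma asc_closed [simp]: "1 \<le> a \<Longrightarrow> b \<le> n \<Longrightarrow> asc G s a b \<in> carrier G"
  unfolding asc_def by (rule list_product_closed) auto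

lemma desc_split: "1 \<le> b \<Longrightarrow> b \<le> Suc c \<Longrightarrow> c \<le> a \<Longrightarrow> a \<le> n \<Longrightarrow>
    desc G s a b = desc G s a (Suc c) \<otimes> desc G s c b"
proof -
  assume *: "1 \<le> b" "b \<le> Suc c" "c \<le> a" "a \<le> n"
  have "[b..<Suc a] = [b..<Suc c] @ [Suc c..<Suc a]"
    using upt_add_eq_append[of b "Suc c" "a - c"] * by simp
  then have "map s (rev [b..<Suc a]) = map s (rev [Suc c..<Suc a]) @ map s (rev [b..<Suc c])" by simp
  moreover have "list_product G (map s (rev [Suc c..<Suc a]) @ map s (rev [b..<Suc c])) =
      list_product G (map s (rev [Suc c..<Suc a])) \<otimes> list_product G (map s (rev [b..<Suc c]))"
    by (rule list_product_append) (use * in \<open>auto intro!: s_closed\<close>)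
  ultimately show ?thesis by (simp only: desc_def)
qed

lemma asc_split: "1 \<le> a \<Longrightarrow> a \<le> Suc c \<Longrightarrow> c \<le> b \<Longrightarrow> b \<le> n \<Longrightarrow>
    asc G s a b = asc G s a c \<otimes> asc G s (Suc c) b"
proof -
  assume *: "1 \<le> a" "a \<le> Suc c" "c \<le> b" "b \<le> n"
  have "[a..<Suc b] = [a..<Suc c] @ [Suc c..<Suc b]"
    using upt_add_eq_append[of a "Suc c" "b - c"] * by simp
  then have "map s [a..<Suc b] = map s [a..<Suc c] @ map s [Suc c..<Suc b]" by simp
  moreover have "list_product G (map s [a..<Suc c] @ map s [Suc c..<Suc b]) =
      list_product G (map s [a..<Suc c]) \<otimes> list_product G (map s [Suc c..<Suc b])"
    by (rule list_product_append) (use * in \<open>auto intro!: s_closed\<close>)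
  ultimately show ?thesis by (simp only: asc_def)
qed

lemma desc_single: "1 \<le> a \<Longrightarrow> a \<le> n \<Longrightarrow> desc G s a a = s a"
  by (simp add: desc_def)

lemma asc_single: "1 \<le> a \<Longrightarrow> a \<le> n \<Longrightarrow> asc G s a a = s a"
  by (simp add: asc_def)

lemma asc_empty: "b < a \<Longrightarrow> asc G s a b = \<one>"
  by (simp add: asc_def)

lemma list_product_commute:
  assumes "g \<in> carrier G" "set gs \<subseteq> carrier G" "\<And>x. x \<in> set gs \<Longrightarrow> x \<otimes> g = g \<otimes> x"
  shows "list_product G gs \<otimes> g = g \<otimes> list_product G gs"
  using assms(2,3)
proof (induction gs)
  case Nil
  then show ?case using assms(1) by simp
next
  case (Cons a gs)
  then have a: "a \<in> carrier G" "list_product G gs \<in> carrier G" by (auto intro: list_product_closed)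
  have "list_product G gs \<otimes> g = g \<otimes> list_product G gs" using Cons by simp
  then have "a \<otimes> list_product G gs \<otimes> g = (a \<otimes> g) \<otimes> list_product G gs"
    using a assms(1) by (simp add: m_assoc)
  also have "a \<otimes> g = g \<otimes> a" using Cons.prems by simp
  finally show ?case using a assms(1) by (simp add: m_assoc)
qed

lemma desc_commute:
  assumes "1 \<le> b" "a \<le> n" "1 \<le> i" "i \<le> n" "i + 2 \<le> b \<or> a + 2 \<le> i"
  shows "desc G s a b \<otimes> s i = s i \<otimes> desc G s a b"
  unfolding desc_def
  by (rule list_product_commute) (use assms in \<open>auto intro!: s_commute\<close>)

lemma asc_commute:
  assumes "1 \<le> a" "b \<le> n" "1 \<le> i" "i \<le> n" "i + 2 \<le> a \<or> b + 2 \<le> i"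
  shows "asc G s a b \<otimes> s i = s i \<otimes> asc G s a b"
  unfolding asc_def
  by (rule list_product_commute) (use assms in \<open>auto intro!: s_commute\<close>)

text \<open>\<open>s i\<close> passes the factors below \<open>s (i - 1)\<close>, the braid relation
  replaces \<open>s i s (i - 1) s i\<close> by \<open>s (i - 1) s i s (i - 1)\<close>, and the new
  first factor passes everything above \<open>s i\<close>. The bound on \<open>i\<close> avoids the
  relation of length four.\<close>

lemma desc_shift:
  assumes "1 \<le> j" "j < i" "3 \<le> i" "i \<le> m" "m \<le> n"
  shows "desc G s m j \<otimes> s i = s (i - 1) \<otimes> desc G s m j"
proof -
  obtain k where k: "i = Suc k" "2 \<le> k" "j \<le> k" using assms by (cases i) auto
  let ?A = "desc G s m (Suc i)" and ?B = "desc G s (k - 1) j"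
  have kn: "k \<le> n" "Suc k \<le> n" "1 \<le> k" using k assms by auto
  have c: "?A \<in> carrier G" "?B \<in> carrier G" "s k \<in> carrier G" "s (Suc k) \<in> carrier G"
    using k assms by auto
  have "desc G s m j = ?A \<otimes> desc G s i j" using desc_split[of j i m] assms by simp
  also have "desc G s i j = s i \<otimes> desc G s k j"
    using desc_split[of j k i] desc_single[of i] assms k by simp
  also have "desc G s k j = s k \<otimes> ?B"
    using desc_split[of j "k - 1" k] desc_single[of k] assms k by simp
  finally have D: "desc G s m j = ?A \<otimes> (s (Suc k) \<otimes> (s k \<otimes> ?B))" using k by simp
  have comm: "?B \<otimes> s (Suc k) = s (Suc k) \<otimes> ?B" "?A \<otimes> s k = s k \<otimes> ?A"
    using desc_commute[of j "k - 1" "Suc k"] desc_commute[of "Suc i" m k] assms k by auto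
  have braid: "s (Suc k) \<otimes> (s k \<otimes> s (Suc k)) = s k \<otimes> (s (Suc k) \<otimes> s k)"
    using B_tupleD(3)[OF tuple, of k] k kn by simp
  have "desc G s m j \<otimes> s i = ?A \<otimes> (s (Suc k) \<otimes> (s k \<otimes> (?B \<otimes> s (Suc k))))"
    using c unfolding D k(1) by (simp add: m_assoc)
  also have "\<dots> = ?A \<otimes> ((s (Suc k) \<otimes> (s k \<otimes> s (Suc k))) \<otimes> ?B)"
    using c unfolding comm by (simp add: m_assoc)
  also have "\<dots> = (?A \<otimes> s k) \<otimes> (s (Suc k) \<otimes> (s k \<otimes> ?B))"
    using c unfolding braid by (simp add: m_assoc)
  also have "\<dots> = s k \<otimes> desc G s m j"
    using c unfolding comm D by (simp add: m_assoc)
  finally show ?thesis using k by simp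
qed

text \<open>The same use of the braid relation in an ascending product, where the index rises
  instead of falling.\<close>

lemma asc_shift:
  assumes "2 \<le> i" "i < j" "j \<le> n"
  shows "asc G s 2 j \<otimes> s i = s (Suc i) \<otimes> asc G s 2 j"
proof -
  let ?A = "asc G s 2 (i - 1)" and ?B = "asc G s (Suc (Suc i)) j"
  have c: "?A \<in> carrier G" "?B \<in> carrier G" "s i \<in> carrier G" "s (Suc i) \<in> carrier G"
    using assms by auto
  have "asc G s 2 j = asc G s 2 i \<otimes> asc G s (Suc i) j" using asc_split[of 2 i j] assms by simp
  also have "asc G s (Suc i) j = s (Suc i) \<otimes> ?B"
    using asc_split[of "Suc i" "Suc i" j] asc_single[of "Suc i"] assms by simp
  also have "asc G s 2 i = ?A \<otimes> s i"
    using asc_split[of 2 "i - 1" i] asc_single[of i] assms by simp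
  finally have U: "asc G s 2 j = ?A \<otimes> (s i \<otimes> (s (Suc i) \<otimes> ?B))" using c by (simp add: m_assoc)
  have comm: "?B \<otimes> s i = s i \<otimes> ?B" "?A \<otimes> s (Suc i) = s (Suc i) \<otimes> ?A"
    using asc_commute[of "Suc (Suc i)" j i] asc_commute[of 2 "i - 1" "Suc i"] assms by auto
  have braid: "s i \<otimes> (s (Suc i) \<otimes> s i) = s (Suc i) \<otimes> (s i \<otimes> s (Suc i))"
    using B_tupleD(3)[OF tuple, of i] assms by simp
  have "asc G s 2 j \<otimes> s i = ?A \<otimes> (s i \<otimes> (s (Suc i) \<otimes> (?B \<otimes> s i)))"
    using c unfolding U by (simp add: m_assoc)
  also have "\<dots> = ?A \<otimes> ((s i \<otimes> (s (Suc i) \<otimes> s i)) \<otimes> ?B)"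
    using c unfolding comm by (simp add: m_assoc)
  also have "\<dots> = (?A \<otimes> s (Suc i)) \<otimes> (s i \<otimes> (s (Suc i) \<otimes> ?B))"
    using c unfolding braid by (simp add: m_assoc)
  also have "\<dots> = s (Suc i) \<otimes> asc G s 2 j"
    using c unfolding comm U by (simp add: m_assoc)
  finally show ?thesis .
qed

text \<open>The relation of length four enters the normal forms here: after \<open>s 1\<close> has
  passed the factors from \<open>s 3\<close> on, the turning point reads
  \<open>s 2 s 1 s 2 s 1 = s 1 s 2 s 1 s 2\<close>, and its first factor passes the descent from
  \<open>s m\<close> to \<open>s 3\<close>.\<close>

lemma desc_asc_first:
  assumes "2 \<le> j" "j \<le> m" "m \<le> n"
  shows "desc G s m 1 \<otimes> asc G s 2 j \<otimes> s 1 = s 1 \<otimes> (desc G s m 1 \<otimes> asc G s 2 j)"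
proof -
  let ?A = "desc G s m 3" and ?B = "asc G s 3 j"
  have c: "?A \<in> carrier G" "?B \<in> carrier G" "s 1 \<in> carrier G" "s 2 \<in> carrier G"
    using assms by auto
  have "desc G s m 1 = ?A \<otimes> desc G s 2 1"
    using desc_split[of 1 2 m] assms by (simp add: eval_nat_numeral)
  moreover have "desc G s 2 1 = s 2 \<otimes> s 1"
    using desc_split[of 1 1 2] desc_single[of 1] desc_single[of 2] assms by (simp add: eval_nat_numeral)
  ultimately have D: "desc G s m 1 = ?A \<otimes> (s 2 \<otimes> s 1)" by simp
  have U: "asc G s 2 j = s 2 \<otimes> ?B"
    using asc_split[of 2 2 j] asc_single[of 2] assms by (simp add: eval_nat_numeral)
  have comm: "?B \<otimes> s 1 = s 1 \<otimes> ?B" "?A \<otimes> s 1 = s 1 \<otimes> ?A"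
    using asc_commute[of 3 j 1] desc_commute[of 3 m 1] assms by auto
  have braid: "s 1 \<otimes> (s 2 \<otimes> (s 1 \<otimes> s 2)) = s 2 \<otimes> (s 1 \<otimes> (s 2 \<otimes> s 1))"
    using B_tupleD(2)[OF tuple] assms by simp
  have "desc G s m 1 \<otimes> asc G s 2 j \<otimes> s 1 = ?A \<otimes> (s 2 \<otimes> (s 1 \<otimes> (s 2 \<otimes> (?B \<otimes> s 1))))"
    using c unfolding D U by (simp add: m_assoc)
  also have "\<dots> = ?A \<otimes> ((s 2 \<otimes> (s 1 \<otimes> (s 2 \<otimes> s 1))) \<otimes> ?B)"
    using c unfolding comm by (simp add: m_assoc)
  also have "\<dots> = (?A \<otimes> s 1) \<otimes> (s 2 \<otimes> (s 1 \<otimes> (s 2 \<otimes> ?B)))"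
    using c unfolding braid[symmetric] by (simp add: m_assoc)
  also have "\<dots> = s 1 \<otimes> (desc G s m 1 \<otimes> asc G s 2 j)"
    using c unfolding comm D U by (simp add: m_assoc)
  finally show ?thesis .
qed

definition coset_rep :: "nat \<Rightarrow> nat \<Rightarrow> 'a" where
  "coset_rep m k = list_product G (map s (coset_word m k))"

lemma coset_rep_desc: "1 \<le> j \<Longrightarrow> j \<le> Suc m \<Longrightarrow> coset_rep m (Suc m - j) = desc G s m j"
  by (simp add: coset_rep_def coset_word_def desc_def)

lemma coset_rep_asc:
  assumes "1 \<le> j" "j \<le> m" "m \<le> n"
  shows "coset_rep m (m + j - 1) = desc G s m 1 \<otimes> asc G s 2 j"
proof (cases "j = 1")
  case True
  then show ?thesis using assms coset_rep_desc[of 1 m] by (simp add: asc_empty)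
next
  case False
  then have cw: "coset_word m (m + j - 1) = rev [1..<Suc m] @ [2..<Suc j]"
    using assms by (simp add: coset_word_def)
  have "list_product G (map s (rev [1..<Suc m]) @ map s [2..<Suc j]) =
      list_product G (map s (rev [1..<Suc m])) \<otimes> list_product G (map s [2..<Suc j])"
    by (rule list_product_append) (use assms in \<open>auto intro!: s_closed\<close>)
  then show ?thesis by (simp only: coset_rep_def cw desc_def asc_def map_append)
qed

text \<open>The representatives describe the right cosets of the subgroup generated by
  \<open>s 1\<close> to \<open>s (m - 1)\<close>. A letter on the right either lengthens or shortens
  the word at its end, or it passes through the whole word and comes out on the left as a letter of
  that subgroup.\<close>

lemma coset_rep_mult:
  assumes k: "k < 2 * m" and i: "1 \<le> i" "i \<le> m" and m: "m \<le> n"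
  shows "(\<exists>k'<2 * m. coset_rep m k \<otimes> s i = coset_rep m k') \<or>
    (\<exists>i'. 1 \<le> i' \<and> i' < m \<and> coset_rep m k \<otimes> s i = s i' \<otimes> coset_rep m k)"
proof (cases "k \<le> m")
  case True
  define j where "j = Suc m - k"
  have j: "1 \<le> j" "j \<le> Suc m" "k = Suc m - j" using True by (auto simp: j_def)
  have X: "coset_rep m k = desc G s m j" using coset_rep_desc[OF j(1,2)] j(3) by simp
  consider "i + 2 \<le> j" | "j = Suc i" | "i = j" | "j < i" "3 \<le> i" | "j = 1" "i = 2"
    using i j by linarith
  then show ?thesis
  proof cases
    case 1
    then have "desc G s m j \<otimes> s i = s i \<otimes> desc G s m j" "i < m" 
      using desc_commute[of j m i] i m j by auto
    then show ?thesis using X i by auto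
  next
    case 2
    have "desc G s m j \<otimes> s i = desc G s m i"
      using desc_split[of i i m] desc_single[of i] i m 2 by simp
    then have "coset_rep m k \<otimes> s i = coset_rep m (Suc m - i)" using X coset_rep_desc[of i m] i by simp
    moreover have "Suc m - i < 2 * m" using i 2 j k by linarith
    ultimately show ?thesis by blast
  next
    case 3
    have "desc G s m j \<otimes> s i = desc G s m (Suc i) \<otimes> (s i \<otimes> s i)"
      using desc_split[of i i m] desc_single[of i] i m 3 by (simp add: m_assoc)
    then have "desc G s m j \<otimes> s i = desc G s m (Suc i)" using square[of i] i m by simp
    then have "coset_rep m k \<otimes> s i = coset_rep m (Suc m - Suc i)"
      using X coset_rep_desc[of "Suc i" m] i by simp
    moreover have "Suc m - Suc i < 2 * m" using i by linarith
    ultimately show ?thesis by blast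
  next
    case 4
    then show ?thesis using desc_shift[of j i m] X i m j by (auto intro!: exI[of _ "i - 1"])
  next
    case 5
    then have "coset_rep m k \<otimes> s i = coset_rep m (m + 2 - 1)"
      using coset_rep_asc[of 2 m] X i m by (simp add: asc_single)
    moreover have "m + 2 - 1 < 2 * m" using i 5 by linarith
    ultimately show ?thesis by blast
  qed
next
  case False
  define j where "j = Suc k - m"
  have j: "2 \<le> j" "j \<le> m" "k = m + j - 1" using False k by (auto simp: j_def)
  have X: "coset_rep m k = desc G s m 1 \<otimes> asc G s 2 j" using coset_rep_asc[of j m] j m by simp
  have c: "desc G s m 1 \<in> carrier G" "asc G s 2 j \<in> carrier G" "s i \<in> carrier G" using i j m by auto
  consider "i = 1" | "i = j" | "i = Suc j" | "2 \<le> i" "i < j" | "j + 2 \<le> i"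
    using i j by linarith
  then show ?thesis
  proof cases
    case 1
    then show ?thesis using desc_asc_first[of j m] X j m by (auto intro!: exI[of _ 1])
  next
    case 2
    have "asc G s 2 j = asc G s 2 (j - 1) \<otimes> s j"
      using asc_split[of 2 "j - 1" j] asc_single[of j] j m by simp
    then have "asc G s 2 j \<otimes> s i = asc G s 2 (j - 1)"
      using square[of j] j m 2 by (simp add: m_assoc)
    then have "coset_rep m k \<otimes> s i = coset_rep m (m + (j - 1) - 1)"
      using X coset_rep_asc[of "j - 1" m] j m c by (simp add: m_assoc)
    moreover have "m + (j - 1) - 1 < 2 * m" using j by linarith
    ultimately show ?thesis by blast
  next
    case 3
    have "asc G s 2 j \<otimes> s i = asc G s 2 (Suc j)"
      using asc_split[of 2 j "Suc j"] asc_single[of "Suc j"] j m i 3 by simp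
    then have "coset_rep m k \<otimes> s i = coset_rep m (m + Suc j - 1)"
      using X coset_rep_asc[of "Suc j" m] j m c i 3 by (simp add: m_assoc)
    moreover have "m + Suc j - 1 < 2 * m" using i 3 by linarith
    ultimately show ?thesis by blast
  next
    case 4
    \<comment> \<open>The ascent raises the index to \<open>Suc i\<close> and the descent lowers it
      back to \<open>i\<close>.\<close>
    have "coset_rep m k \<otimes> s i = desc G s m 1 \<otimes> s (Suc i) \<otimes> asc G s 2 j"
      using X asc_shift[of i j] j m 4 c by (simp add: m_assoc)
    also have "desc G s m 1 \<otimes> s (Suc i) = s i \<otimes> desc G s m 1"
      using desc_shift[of 1 "Suc i" m] j m 4 by simp
    finally have "coset_rep m k \<otimes> s i = s i \<otimes> coset_rep m k" using X c by (simp add: m_assoc)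
    moreover have "1 \<le> i" "i < m" using 4 j by auto
    ultimately show ?thesis by blast
  next
    case 5
    have c': "s (i - 1) \<in> carrier G" using 5 i m by simp
    have "coset_rep m k \<otimes> s i = desc G s m 1 \<otimes> s i \<otimes> asc G s 2 j"
      using X asc_commute[of 2 j i] j m i 5 c by (simp add: m_assoc)
    also have "desc G s m 1 \<otimes> s i = s (i - 1) \<otimes> desc G s m 1"
      using desc_shift[of 1 i m] j m i 5 by simp
    finally have "coset_rep m k \<otimes> s i = s (i - 1) \<otimes> coset_rep m k" using X c c' by (simp add: m_assoc)
    then show ?thesis using 5 i by (auto intro!: exI[of _ "i - 1"])
  qed
qed

end

section \<open>Normal forms\<close>

primrec normal_word :: "nat \<Rightarrow> (nat \<Rightarrow> nat) \<Rightarrow> nat list" where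
  "normal_word 0 \<kappa> = []"
| "normal_word (Suc m) \<kappa> = normal_word m \<kappa> @ coset_word (Suc m) (\<kappa> (Suc m))"

definition admissible :: "nat \<Rightarrow> (nat \<Rightarrow> nat) \<Rightarrow> bool" where
  "admissible m \<kappa> \<longleftrightarrow> (\<forall>i. 1 \<le> i \<longrightarrow> i \<le> m \<longrightarrow> \<kappa> i < 2 * i)"

lemma normal_word_cong: "(\<And>i. 1 \<le> i \<Longrightarrow> i \<le> m \<Longrightarrow> \<kappa> i = \<kappa>' i) \<Longrightarrow> normal_word m \<kappa> = normal_word m \<kappa>'"
  by (induction m) auto

lemma length_normal_word: "admissible m \<kappa> \<Longrightarrow> length (normal_word m \<kappa>) = (\<Sum>i=1..m. \<kappa> i)"
  by (induction m) (auto simp: admissible_def length_coset_word)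

lemma set_normal_word: "admissible m \<kappa> \<Longrightarrow> set (normal_word m \<kappa>) \<subseteq> {1..m}"
proof (induction m)
  case (Suc m)
  then have a: "admissible m \<kappa>" "\<kappa> (Suc m) < 2 * Suc m" by (auto simp: admissible_def)
  have "set (normal_word m \<kappa>) \<subseteq> {1..m}" "set (coset_word (Suc m) (\<kappa> (Suc m))) \<subseteq> {1..Suc m}"
    using Suc.IH[OF a(1)] set_coset_word[OF a(2)] .
  then show ?case by fastforce
qed simp

lemma sum_odd: "(\<Sum>i=1..m. 2 * i - 1) = m * (m::nat)"
  by (induction m) auto

lemma prod_even: "(\<Prod>i=1..m. 2 * i) = 2 ^ m * (fact m :: nat)"
  by (induction m) (auto simp: algebra_simps)

context B_involutions
begin

definition normal :: "nat \<Rightarrow> (nat \<Rightarrow> nat) \<Rightarrow> 'a" where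
  "normal m \<kappa> = list_product G (map s (normal_word m \<kappa>))"

lemma set_map_s_normal_word:
  "admissible m \<kappa> \<Longrightarrow> m \<le> n \<Longrightarrow> set (map s (normal_word m \<kappa>)) \<subseteq> carrier G"
  using set_normal_word[of m \<kappa>] by (fastforce intro!: s_closed)

lemma normal_closed: "admissible m \<kappa> \<Longrightarrow> m \<le> n \<Longrightarrow> normal m \<kappa> \<in> carrier G"
  unfolding normal_def by (rule list_product_closed[OF set_map_s_normal_word])

lemma coset_rep_closed: "k < 2 * m \<Longrightarrow> m \<le> n \<Longrightarrow> coset_rep m k \<in> carrier G"
  unfolding coset_rep_def
  by (rule list_product_closed) (use set_coset_word[of k m] in \<open>fastforce intro!: s_closed\<close>)

lemma normal_Suc:
  assumes "admissible (Suc m) \<kappa>" "Suc m \<le> n"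
  shows "normal (Suc m) \<kappa> = normal m \<kappa> \<otimes> coset_rep (Suc m) (\<kappa> (Suc m))"
proof -
  have a: "admissible m \<kappa>" "\<kappa> (Suc m) < 2 * Suc m" using assms(1) by (auto simp: admissible_def)
  have "set (map s (coset_word (Suc m) (\<kappa> (Suc m)))) \<subseteq> carrier G"
    using set_coset_word[OF a(2)] assms(2) by (fastforce intro!: s_closed)
  then show ?thesis
    using list_product_append[OF set_map_s_normal_word[OF a(1)]] assms(2)
    by (simp add: normal_def coset_rep_def)
qed

text \<open>A letter that passes through the last segment has a smaller index and is absorbed by the
  preceding segments, by induction.\<close>

lemma normal_mult:
  assumes "m \<le> n" "admissible m \<kappa>" "1 \<le> i" "i \<le> m"
  shows "\<exists>\<kappa>'. admissible m \<kappa>' \<and> normal m \<kappa> \<otimes> s i = normal m \<kappa>'"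
  using assms
proof (induction m arbitrary: \<kappa> i)
  case (Suc m)
  let ?k = "\<kappa> (Suc m)"
  have a: "admissible m \<kappa>" "?k < 2 * Suc m" using Suc.prems(2) by (auto simp: admissible_def)
  have upd: "admissible (Suc m) (\<kappa>'(Suc m := k))" "normal m (\<kappa>'(Suc m := k)) = normal m \<kappa>'"
    if "admissible m \<kappa>'" "k < 2 * Suc m" for \<kappa>' k
    using that normal_word_cong[of m "\<kappa>'(Suc m := k)" \<kappa>'] by (auto simp: admissible_def normal_def)
  have c: "normal m \<kappa> \<in> carrier G" "coset_rep (Suc m) ?k \<in> carrier G" "s i \<in> carrier G"
    using normal_closed[OF a(1)] coset_rep_closed[OF a(2)] Suc.prems by auto
  have N: "normal (Suc m) \<kappa> \<otimes> s i = normal m \<kappa> \<otimes> (coset_rep (Suc m) ?k \<otimes> s i)"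
    using normal_Suc[OF Suc.prems(2,1)] c by (simp add: m_assoc)
  consider k' where "k' < 2 * Suc m" "coset_rep (Suc m) ?k \<otimes> s i = coset_rep (Suc m) k'"
    | i' where "1 \<le> i'" "i' \<le> m" "coset_rep (Suc m) ?k \<otimes> s i = s i' \<otimes> coset_rep (Suc m) ?k"
    using coset_rep_mult[OF a(2) Suc.prems(3,4,1)] by (auto simp: less_Suc_eq_le)
  then show ?case
  proof cases
    case 1
    then have "normal (Suc m) \<kappa> \<otimes> s i = normal (Suc m) (\<kappa>(Suc m := k'))"
      using N normal_Suc[OF upd(1)[OF a(1) 1(1)] Suc.prems(1)] upd(2)[OF a(1) 1(1)] by simp
    then show ?thesis using upd(1)[OF a(1) 1(1)] by blast
  next
    case 2
    have "m \<le> n" using Suc.prems(1) by simp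
    from Suc.IH[OF this a(1) 2(1,2)] obtain \<kappa>' where
      \<kappa>': "admissible m \<kappa>'" "normal m \<kappa> \<otimes> s i' = normal m \<kappa>'" by blast
    have "s i' \<in> carrier G" using 2 Suc.prems(1) by simp
    then have "normal (Suc m) \<kappa> \<otimes> s i = normal m \<kappa>' \<otimes> coset_rep (Suc m) ?k"
      using N 2(3) c \<kappa>'(2) by (simp add: m_assoc[symmetric])
    also have "\<dots> = normal (Suc m) (\<kappa>'(Suc m := ?k))"
      using normal_Suc[OF upd(1)[OF \<kappa>'(1) a(2)] Suc.prems(1)] upd(2)[OF \<kappa>'(1) a(2)] by simp
    finally show ?thesis using upd(1)[OF \<kappa>'(1) a(2)] by blast
  qed
qed simp

end

locale B_generated = B_involutions +
  assumes generated: "\<And>K. subgroup K G \<Longrightarrow> (\<And>i. i \<in> {1..n} \<Longrightarrow> s i \<in> K) \<Longrightarrow> K = carrier G"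
begin

lemma normal_form:
  assumes "g \<in> carrier G"
  obtains \<kappa> where "admissible n \<kappa>" "g = normal n \<kappa>"
proof -
  define N where "N = {normal n \<kappa> | \<kappa>. admissible n \<kappa>}"
  \<comment> \<open>The biconditional makes this set closed under inverses, which one-sided
    preservation of \<open>N\<close> would not. For a generator the converse direction follows
    because \<open>s i\<close> is an involution.\<close>
  let ?K = "{w \<in> carrier G. \<forall>v\<in>carrier G. v \<in> N \<longleftrightarrow> v \<otimes> w \<in> N}"
  have "subgroup ?K G"
  proof
    fix x y assume x: "x \<in> ?K" and y: "y \<in> ?K"
    have xc: "x \<in> carrier G" and yc: "y \<in> carrier G" using x y by blast+
    have "v \<in> N \<longleftrightarrow> v \<otimes> (x \<otimes> y) \<in> N" if v: "v \<in> carrier G" for v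
    proof -
      have "v \<otimes> x \<in> carrier G" "v \<otimes> x \<otimes> y = v \<otimes> (x \<otimes> y)"
        using xc yc v by (auto simp: m_assoc)
      moreover have "v \<in> N \<longleftrightarrow> v \<otimes> x \<in> N" using x v by blast
      moreover have "v \<otimes> x \<in> N \<longleftrightarrow> v \<otimes> x \<otimes> y \<in> N" using y calculation(1) by blast
      ultimately show ?thesis by metis
    qed
    then show "x \<otimes> y \<in> ?K" using xc yc by blast
  next
    fix x assume x: "x \<in> ?K"
    have xc: "x \<in> carrier G" using x by blast
    have "v \<in> N \<longleftrightarrow> v \<otimes> inv x \<in> N" if v: "v \<in> carrier G" for v
    proof -
      have "v \<otimes> inv x \<in> carrier G" "v \<otimes> inv x \<otimes> x = v"
        using xc v by (auto simp: m_assoc)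
      moreover have "v \<otimes> inv x \<in> N \<longleftrightarrow> v \<otimes> inv x \<otimes> x \<in> N" using x calculation(1) by blast
      ultimately show ?thesis by metis
    qed
    then show "inv x \<in> ?K" using xc by blast
  qed auto
  moreover have "s i \<in> ?K" if i: "i \<in> {1..n}" for i
  proof -
    have Ns: "v \<otimes> s i \<in> N" if "v \<in> N" for v
      using that normal_mult[of n _ i] i by (fastforce simp: N_def)
    have "v \<in> N" if "v \<in> carrier G" "v \<otimes> s i \<in> N" for v
      using Ns[OF that(2)] that(1) i square[of i] by (simp add: m_assoc)
    moreover have "s i \<in> carrier G" using i by simp
    ultimately show ?thesis using Ns by blast
  qed
  ultimately have K: "?K = carrier G" by (rule generated)
  have "admissible n (\<lambda>_. 0)" by (simp add: admissible_def)
  moreover have "normal_word m (\<lambda>_. 0) = []" for m by (induction m) (auto simp: coset_word_def)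
  ultimately have "\<one> \<in> N" unfolding normal_def N_def by (auto intro!: exI[of _ "\<lambda>_. 0"])
  moreover have "g \<in> ?K" using assms K by simp
  ultimately have "\<one> \<otimes> g \<in> N" by blast
  then show thesis using that assms by (auto simp: N_def)
qed

lemma card_carrier_le: "finite (carrier G)" "card (carrier G) \<le> 2 ^ n * fact n"
proof -
  let ?A = "PiE {1..n} (\<lambda>i. {..<2 * i})"
  have sub: "carrier G \<subseteq> normal n ` ?A"
  proof
    fix g assume "g \<in> carrier G"
    then obtain \<kappa> where \<kappa>: "admissible n \<kappa>" "g = normal n \<kappa>" using normal_form by blast
    have "normal_word n \<kappa> = normal_word n (restrict \<kappa> {1..n})"
      by (rule normal_word_cong) auto
    then have "g = normal n (restrict \<kappa> {1..n})" using \<kappa>(2) by (simp add: normal_def)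
    moreover have "restrict \<kappa> {1..n} \<in> ?A" using \<kappa>(1) by (auto simp: admissible_def)
    ultimately show "g \<in> normal n ` ?A" by blast
  qed
  have fin: "finite ?A" by (intro finite_PiE) auto
  then show "finite (carrier G)" using sub finite_surj by blast
  have "card (carrier G) \<le> card ?A" using surj_card_le[OF fin sub] .
  also have "card ?A = (\<Prod>i=1..n. 2 * i)" by (simp add: card_PiE)
  also have "\<dots> = 2 ^ n * fact n" by (rule prod_even)
  finally show "card (carrier G) \<le> 2 ^ n * fact n" .
qed

lemma word_length_le:
  assumes "set is \<subseteq> {1..n}"
  shows "word_length G (s ` {1..n}) (list_product G (map s is)) \<le> length is"
  unfolding word_length_def
  by (rule Least_le) (use image_mono[OF assms, of s] in \<open>auto intro!: exI[of _ "map s is"]\<close>)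

lemma word_length_exists:
  assumes "g \<in> carrier G"
  obtains "is" where "set is \<subseteq> {1..n}" "length is = word_length G (s ` {1..n}) g"
    "list_product G (map s is) = g"
proof -
  obtain \<kappa> where \<kappa>: "admissible n \<kappa>" "g = normal n \<kappa>" using normal_form[OF assms] by blast
  have "\<exists>gs. set gs \<subseteq> s ` {1..n} \<and> length gs = length (normal_word n \<kappa>) \<and> list_product G gs = g"
    using set_normal_word[OF \<kappa>(1)] \<kappa>(2) unfolding normal_def
    by (intro exI[of _ "map s (normal_word n \<kappa>)"]) auto
  from LeastI[where P = "\<lambda>k. \<exists>gs. set gs \<subseteq> s ` {1..n} \<and> length gs = k \<and> list_product G gs = g", OF this]
  obtain gs where gs: "set gs \<subseteq> s ` {1..n}" "length gs = word_length G (s ` {1..n}) g" "list_product G gs = g"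
    unfolding word_length_def[symmetric] by blast
  have "gs \<in> map s ` lists {1..n}" using gs(1) lists_image[of s "{1..n}"] by auto
  then obtain ks where ks: "ks \<in> lists {1..n}" "gs = map s ks" by blast
  have "set ks \<subseteq> {1..n}" using ks(1) by (simp only: in_lists_conv_set subset_eq)
  then show thesis using that[of ks] gs(2,3) ks(2) by simp
qed

text \<open>A normal word has length at most 1 + 3 + ... + (2n - 1) = n^2, with equality only if
  every segment is complete.\<close>

lemma word_length_less:
  assumes g: "g \<in> carrier G" and ne: "g \<noteq> normal n (\<lambda>i. 2 * i - 1)"
  shows "word_length G (s ` {1..n}) g < n * n"
proof -
  obtain \<kappa> where \<kappa>: "admissible n \<kappa>" "g = normal n \<kappa>" using normal_form[OF g] by blast
  have le: "\<kappa> i \<le> 2 * i - 1" if "i \<in> {1..n}" for i using \<kappa>(1) that by (fastforce simp: admissible_def)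
  have "\<exists>i\<in>{1..n}. \<kappa> i \<noteq> 2 * i - 1"
  proof (rule ccontr)
    assume "\<not> ?thesis"
    then have "normal_word n \<kappa> = normal_word n (\<lambda>i. 2 * i - 1)" by (intro normal_word_cong) auto
    then show False using \<kappa>(2) ne by (simp add: normal_def)
  qed
  then have "\<exists>i\<in>{1..n}. \<kappa> i < 2 * i - 1" using le nat_less_le by blast
  then have "(\<Sum>i=1..n. \<kappa> i) < (\<Sum>i=1..n. 2 * i - 1)" using le by (intro sum_strict_mono_ex1) auto
  moreover have "word_length G (s ` {1..n}) g \<le> (\<Sum>i=1..n. \<kappa> i)"
    using word_length_le[OF set_normal_word[OF \<kappa>(1)]] length_normal_word[OF \<kappa>(1)] \<kappa>(2)
    by (simp add: normal_def)
  ultimately show ?thesis using sum_odd[of n] by linarith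
qed

text \<open>\<open>longest_element\<close> is a definite description, so uniqueness is required; it
  comes from the strict bound for all other elements.\<close>

lemma longest_element_eqI:
  assumes long: "n * n \<le> word_length G (s ` {1..n}) (normal n (\<lambda>i. 2 * i - 1))"
  shows "longest_element G (s ` {1..n}) = normal n (\<lambda>i. 2 * i - 1)"
proof -
  let ?w = "normal n (\<lambda>i. 2 * i - 1)" and ?l = "word_length G (s ` {1..n})"
  have w: "?w \<in> carrier G" by (rule normal_closed) (auto simp: admissible_def)
  have less: "?l v < ?l ?w" if "v \<in> carrier G" "v \<noteq> ?w" for v
    using word_length_less[OF that] long by linarith
  show ?thesis
    unfolding longest_element_def
  proof (rule the_equality)
    show "?w \<in> carrier G \<and> (\<forall>v\<in>carrier G. ?l v \<le> ?l ?w)" using w less by (metis less_imp_le order_refl)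
    show "v = ?w" if "v \<in> carrier G \<and> (\<forall>u\<in>carrier G. ?l u \<le> ?l v)" for v
      using that less w by (meson not_less)
  qed
qed

end

section \<open>Signed permutations\<close>

text \<open>The pair \<open>(v, p)\<close> stands for the signed permutation that sends \<open>i\<close> to \<open>p i\<close>, with a minus
  sign if \<open>v i\<close>; so the signs are attached to the sources, not to the targets.\<close>

definition signed_perms :: "nat \<Rightarrow> ((nat \<Rightarrow> bool) \<times> (nat \<Rightarrow> nat)) monoid" where
  "signed_perms n =
     \<lparr>carrier = {(v, p). (\<forall>i. v i \<longrightarrow> 1 \<le> i \<and> i \<le> n) \<and> p permutes {1..n}},
      monoid.mult = (\<lambda>(v, p) (w, q). (\<lambda>i. w i \<noteq> v (q i), p \<circ> q)),
      one = (\<lambda>_. False, id)\<rparr>"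

lemma sp_mult [simp]: "(v, p) \<otimes>\<^bsub>signed_perms n\<^esub> (w, q) = (\<lambda>i. w i \<noteq> v (q i), p \<circ> q)"
  by (simp add: signed_perms_def)

lemma sp_one [simp]: "\<one>\<^bsub>signed_perms n\<^esub> = (\<lambda>_. False, id)"
  by (simp add: signed_perms_def)

lemma sp_carrier [simp]:
  "(v, p) \<in> carrier (signed_perms n) \<longleftrightarrow> (\<forall>i. v i \<longrightarrow> 1 \<le> i \<and> i \<le> n) \<and> p permutes {1..n}"
  by (simp add: signed_perms_def)

lemma permutes_range: "p permutes {1..n} \<Longrightarrow> 1 \<le> p i \<and> p i \<le> n \<longleftrightarrow> 1 \<le> i \<and> i \<le> n"
  using permutes_in_image[of p "{1..n}" i] by simp

lemma group_signed_perms: "group (signed_perms n)"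
proof (rule groupI)
  fix x y z assume x: "x \<in> carrier (signed_perms n)" and y: "y \<in> carrier (signed_perms n)"
  obtain v p where vp: "x = (v, p)" by fastforce
  obtain w q where wq: "y = (w, q)" by fastforce
  have p: "p permutes {1..n}" and v: "\<And>i. v i \<Longrightarrow> 1 \<le> i \<and> i \<le> n" using x vp by auto
  have q: "q permutes {1..n}" and w: "\<And>i. w i \<Longrightarrow> 1 \<le> i \<and> i \<le> n" using y wq by auto
  have "1 \<le> i \<and> i \<le> n" if "w i \<noteq> v (q i)" for i
    using that w[of i] v[of "q i"] permutes_range[OF q, of i] by blast
  then show "x \<otimes>\<^bsub>signed_perms n\<^esub> y \<in> carrier (signed_perms n)"
    using permutes_compose[OF q p] vp wq by simp
  show "\<one>\<^bsub>signed_perms n\<^esub> \<otimes>\<^bsub>signed_perms n\<^esub> x = x" using vp by simp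
  have ip: "inv_into UNIV p permutes {1..n}" using p by (rule permutes_inv)
  have "(\<lambda>i. v (inv_into UNIV p i), inv_into UNIV p) \<in> carrier (signed_perms n)"
    using v permutes_range[OF ip] ip by auto
  moreover have "(\<lambda>i. v (inv_into UNIV p i), inv_into UNIV p) \<otimes>\<^bsub>signed_perms n\<^esub> x = \<one>\<^bsub>signed_perms n\<^esub>"
    using p vp by (simp add: permutes_inv_o permutes_inverses)
  ultimately show "\<exists>y\<in>carrier (signed_perms n). y \<otimes>\<^bsub>signed_perms n\<^esub> x = \<one>\<^bsub>signed_perms n\<^esub>" by blast
  assume "z \<in> carrier (signed_perms n)"
  obtain u r where "z = (u, r)" by fastforce
  then show "x \<otimes>\<^bsub>signed_perms n\<^esub> y \<otimes>\<^bsub>signed_perms n\<^esub> z = x \<otimes>\<^bsub>signed_perms n\<^esub> (y \<otimes>\<^bsub>signed_perms n\<^esub> z)"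
    using vp wq by (auto simp: comp_assoc)
qed simp

lemma card_signed_perms: "card (carrier (signed_perms n)) = 2 ^ n * fact n"
proof -
  have "carrier (signed_perms n) = {v. \<forall>i. v i \<longrightarrow> 1 \<le> i \<and> i \<le> n} \<times> {p. p permutes {1..n}}"
    by (auto simp: signed_perms_def)
  moreover have "{v. \<forall>i. v i \<longrightarrow> 1 \<le> i \<and> i \<le> n} = (\<lambda>A i. i \<in> A) ` Pow {1..n}"
  proof
    show "{v. \<forall>i. v i \<longrightarrow> 1 \<le> i \<and> i \<le> n} \<subseteq> (\<lambda>A i. i \<in> A) ` Pow {1..n}"
    proof
      fix v :: "nat \<Rightarrow> bool" assume "v \<in> {v. \<forall>i. v i \<longrightarrow> 1 \<le> i \<and> i \<le> n}"
      then have "v = (\<lambda>i. i \<in> {i. v i})" "{i. v i} \<in> Pow {1..n}" by auto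
      then show "v \<in> (\<lambda>A i. i \<in> A) ` Pow {1..n}" by (rule image_eqI)
    qed
  qed auto
  moreover have "inj_on (\<lambda>A i. i \<in> A) (Pow {1..n})" by (rule inj_onI) (metis Collect_mem_eq)
  moreover have "card {p. p permutes {1..n}} = fact n" using card_permutations[of "{1..n}" n] by simp
  ultimately show ?thesis by (simp add: card_cartesian_product card_image card_Pow)
qed

definition signed_gen :: "nat \<Rightarrow> (nat \<Rightarrow> bool) \<times> (nat \<Rightarrow> nat)" where
  "signed_gen i = (if i = 1 then (\<lambda>j. j = 1, id) else (\<lambda>_. False, transpose (i - 1) i))"

lemma transpose_permutes: "1 \<le> a \<Longrightarrow> a \<le> n \<Longrightarrow> 1 \<le> b \<Longrightarrow> b \<le> n \<Longrightarrow> transpose a b permutes {1..n}"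
  by (rule permutes_swap_id) auto

lemma signed_gen_closed: "1 \<le> i \<Longrightarrow> i \<le> n \<Longrightarrow> signed_gen i \<in> carrier (signed_perms n)"
  using transpose_permutes[of "i - 1" n i] by (auto simp: signed_gen_def permutes_id)

lemma signed_gen_list_closed: "set ks \<subseteq> {1..n} \<Longrightarrow> set (map signed_gen ks) \<subseteq> carrier (signed_perms n)"
proof
  fix g assume "set ks \<subseteq> {1..n}" "g \<in> set (map signed_gen ks)"
  then obtain k where "k \<in> {1..n}" "g = signed_gen k" by auto
  then show "g \<in> carrier (signed_perms n)" using signed_gen_closed by simp
qed

lemma signed_gen_square: "signed_gen i \<otimes>\<^bsub>signed_perms n\<^esub> signed_gen i = \<one>\<^bsub>signed_perms n\<^esub>"
  by (auto simp: signed_gen_def)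

lemma transpose_braid:
  assumes "a \<noteq> b" "b \<noteq> c" "a \<noteq> c"
  shows "transpose a b \<circ> (transpose b c \<circ> transpose a b) = transpose b c \<circ> (transpose a b \<circ> transpose b c)"
proof
  fix x
  consider "x = a" | "x = b" | "x = c" | "x \<noteq> a" "x \<noteq> b" "x \<noteq> c" by blast
  then show "(transpose a b \<circ> (transpose b c \<circ> transpose a b)) x = (transpose b c \<circ> (transpose a b \<circ> transpose b c)) x"
    by cases (use assms in \<open>simp_all add: transpose_apply_other\<close>)
qed

lemma transpose_disjoint:
  assumes "a \<noteq> c" "a \<noteq> d" "b \<noteq> c" "b \<noteq> d"
  shows "transpose a b \<circ> transpose c d = transpose c d \<circ> transpose a b"
proof
  fix x
  consider "x = a" | "x = b" | "x = c" | "x = d" | "x \<noteq> a" "x \<noteq> b" "x \<noteq> c" "x \<noteq> d" by blast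
  then show "(transpose a b \<circ> transpose c d) x = (transpose c d \<circ> transpose a b) x"
    by cases (use assms in \<open>simp_all add: transpose_apply_other\<close>)
qed

lemma B_tuple_signed_gen: "B_tuple (signed_perms n) n signed_gen"
  unfolding B_tuple_def
proof (intro conjI allI impI)
  show "signed_gen i \<in> carrier (signed_perms n)" if "1 \<le> i" "i \<le> n" for i
    using signed_gen_closed that .
  show "signed_gen 1 \<otimes>\<^bsub>signed_perms n\<^esub> (signed_gen 2 \<otimes>\<^bsub>signed_perms n\<^esub> (signed_gen 1 \<otimes>\<^bsub>signed_perms n\<^esub> signed_gen 2)) =
    signed_gen 2 \<otimes>\<^bsub>signed_perms n\<^esub> (signed_gen 1 \<otimes>\<^bsub>signed_perms n\<^esub> (signed_gen 2 \<otimes>\<^bsub>signed_perms n\<^esub> signed_gen 1))"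
    by (auto simp: signed_gen_def fun_eq_iff transpose_def)
next
  fix i :: nat assume i: "2 \<le> i"
  have g: "signed_gen i = (\<lambda>_. False, transpose (i - 1) i)" "signed_gen (Suc i) = (\<lambda>_. False, transpose i (Suc i))"
    using i by (auto simp: signed_gen_def)
  have "i - 1 \<noteq> i" "i \<noteq> Suc i" "i - 1 \<noteq> Suc i" using i by auto
  from transpose_braid[OF this] show "signed_gen i \<otimes>\<^bsub>signed_perms n\<^esub> (signed_gen (Suc i) \<otimes>\<^bsub>signed_perms n\<^esub> signed_gen i) =
    signed_gen (Suc i) \<otimes>\<^bsub>signed_perms n\<^esub> (signed_gen i \<otimes>\<^bsub>signed_perms n\<^esub> signed_gen (Suc i))"
    unfolding g by simp
next
  fix i j :: nat assume ij: "1 \<le> i" "i + 2 \<le> j"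
  have j: "signed_gen j = (\<lambda>_. False, transpose (j - 1) j)" using ij by (simp add: signed_gen_def)
  show "signed_gen i \<otimes>\<^bsub>signed_perms n\<^esub> signed_gen j = signed_gen j \<otimes>\<^bsub>signed_perms n\<^esub> signed_gen i"
  proof (cases "i = 1")
    case True
    have "transpose (j - 1) j k = 1 \<longleftrightarrow> k = 1" for k using ij True by (auto simp: transpose_def)
    then show ?thesis using j True by (simp add: signed_gen_def)
  next
    case False
    have i: "signed_gen i = (\<lambda>_. False, transpose (i - 1) i)" using False by (simp add: signed_gen_def)
    have "i - 1 \<noteq> j - 1" "i - 1 \<noteq> j" "i \<noteq> j - 1" "i \<noteq> j" using ij by auto
    from transpose_disjoint[OF this] show ?thesis unfolding i j by simp
  qed
qed

text \<open>Adjacent transpositions generate all permutations, conjugating the sign change at 1 by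
  transpositions yields those at all other positions, and their products are the diagonal
  elements.\<close>

lemma signed_perms_subgroup_eqI:
  assumes K: "subgroup K (signed_perms n)"
    and perms: "\<And>i. 2 \<le> i \<Longrightarrow> i \<le> n \<Longrightarrow> (\<lambda>_. False, transpose (i - 1) i) \<in> K"
    and flip: "(\<lambda>j. j = 1, id) \<in> K"
  shows "K = carrier (signed_perms n)"
proof
  show "K \<subseteq> carrier (signed_perms n)" using K by (rule subgroup.subset)
  have m: "(\<lambda>i. w i \<noteq> v (q i), p \<circ> q) \<in> K" if "(v, p) \<in> K" "(w, q) \<in> K" for v p w q
    using subgroup.m_closed[OF K that] by simp
  have one: "(\<lambda>_. False, id) \<in> K" using subgroup.one_closed[OF K] by simp
  have pm: "(\<lambda>_. False, p \<circ> q) \<in> K" if "(\<lambda>_. False, p) \<in> K" "(\<lambda>_. False, q) \<in> K" for p q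
    using m[OF that] by simp
  have t: "(\<lambda>_. False, transpose a b) \<in> K" if "1 \<le> a" "a < b" "b \<le> n" for a b
  proof -
    have "Suc a \<le> b" using that by simp
    then have "b \<le> n \<longrightarrow> (\<lambda>_. False, transpose a b) \<in> K"
    proof (induction b rule: dec_induct)
      case base
      then show ?case using perms[of "Suc a"] that by simp
    next
      case (step b)
      have eq: "transpose a (Suc b) = transpose b (Suc b) \<circ> (transpose a b \<circ> transpose b (Suc b))"
        using step(1) by (auto simp: fun_eq_iff transpose_def)
      show ?case
      proof
        assume "Suc b \<le> n"
        then have "(\<lambda>_. False, transpose b (Suc b)) \<in> K" "(\<lambda>_. False, transpose a b) \<in> K"
          using perms[of "Suc b"] step that by auto
        then show "(\<lambda>_. False, transpose a (Suc b)) \<in> K" unfolding eq by (intro pm)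
      qed
    qed
    then show ?thesis using that by blast
  qed
  have p: "(\<lambda>_. False, p) \<in> K" if "p permutes {1..n}" for p
    using that finite_atLeastAtMost
  proof (induction p rule: permutes_induct)
    case (swap a b p)
    have "(\<lambda>_. False, transpose a b) \<in> K"
      using t[of a b] t[of b a] swap by (cases a b rule: linorder_cases) (auto simp: transpose_commute)
    then show ?case using pm swap by blast
  next
    case id
    then show ?case by (rule one)
  qed
  have f: "(\<lambda>j. j = k, id) \<in> K" if "1 \<le> k" "k \<le> n" for k
  proof (cases "k = 1")
    case False
    have "(\<lambda>_. False, transpose 1 k) \<in> K" using t[of 1 k] False that by simp
    from m[OF m[OF this flip] this] have "(\<lambda>i. transpose 1 k i = 1, transpose 1 k \<circ> transpose 1 k) \<in> K"
      by simp
    moreover have "(\<lambda>i. transpose 1 k i = 1) = (\<lambda>j. j = k)"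
      using False by (auto simp: transpose_def fun_eq_iff)
    ultimately show ?thesis by simp
  qed (use flip in simp)
  have d: "(\<lambda>i. i \<in> A, id) \<in> K" if "finite A" "A \<subseteq> {1..n}" for A
    using that
  proof (induction A rule: finite_induct)
    case (insert k A)
    have k: "(\<lambda>j. j = k, id) \<in> K" using insert.prems by (intro f) auto
    have A: "(\<lambda>i. i \<in> A, id) \<in> K" using insert.prems by (intro insert.IH) auto
    from m[OF k A] have "(\<lambda>i. (i \<in> A) \<noteq> (i = k), id) \<in> K" by simp
    moreover have "(\<lambda>i. (i \<in> A) \<noteq> (i = k)) = (\<lambda>i. i \<in> insert k A)" using insert.hyps by auto
    ultimately show ?case by metis
  qed (use one in simp)
  show "carrier (signed_perms n) \<subseteq> K"
  proof
    fix x assume x: "x \<in> carrier (signed_perms n)"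
    obtain v q where vq: "x = (v, q)" by fastforce
    have "finite {i. v i}" "{i. v i} \<subseteq> {1..n}" using x vq by (auto intro: finite_subset[of _ "{1..n}"])
    then have "(v, id) \<in> K" using d[of "{i. v i}"] by simp
    moreover have "(\<lambda>_. False, q) \<in> K" using p x vq by simp
    ultimately show "x \<in> K" using m[of "\<lambda>_. False" q v id] vq by simp
  qed
qed

lemma signed_perms_generated:
  assumes "subgroup K (signed_perms n)" "1 \<le> n" "\<And>i. i \<in> {1..n} \<Longrightarrow> signed_gen i \<in> K"
  shows "K = carrier (signed_perms n)"
proof (rule signed_perms_subgroup_eqI[OF assms(1)])
  show "(\<lambda>_. False, transpose (i - 1) i) \<in> K" if "2 \<le> i" "i \<le> n" for i
    using assms(3)[of i] that by (simp add: signed_gen_def)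
  show "(\<lambda>j. j = 1, id) \<in> K" using assms(3)[of 1] assms(2) by (simp add: signed_gen_def)
qed

lemma subgroup_hom_image:
  assumes "group G" "group H" "h \<in> hom G H"
  shows "subgroup (h ` carrier G) H"
proof -
  interpret group_hom G H h
    using assms by (simp add: group_hom_def group_hom_axioms_def)
  show ?thesis by (rule img_is_subgroup)
qed

lemma B_generated_W_B: "B_generated (W_B n) n (s_B n)"
proof -
  interpret group "W_B n" by (rule group_coxeter_group)
  show ?thesis
  proof unfold_locales
    show "B_tuple (W_B n) n (s_B n)" by (rule B_tuple_coxeter)
    show "s_B n i \<otimes>\<^bsub>W_B n\<^esub> s_B n i = \<one>\<^bsub>W_B n\<^esub>" if "1 \<le> i" "i \<le> n" for i
      using coxeter_gen_square[of i "{1..n}" coxeter_B] that by simp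
    show "K = carrier (W_B n)" if "subgroup K (W_B n)" "\<And>i. i \<in> {1..n} \<Longrightarrow> s_B n i \<in> K" for K
      using coxeter_group_generated[OF that] .
  qed
qed

text \<open>The upper bound for the order of the presented group makes the surjection bijective.\<close>

lemma W_B_iso_signed_perms:
  assumes n: "1 \<le> n"
  obtains \<pi> where "\<pi> \<in> iso (W_B n) (signed_perms n)" "\<And>i. i \<in> {1..n} \<Longrightarrow> \<pi> (s_B n i) = signed_gen i"
proof -
  interpret B_generated "W_B n" n "s_B n" by (rule B_generated_W_B)
  obtain \<pi> where \<pi>: "\<pi> \<in> hom (W_B n) (signed_perms n)" "\<And>i. i \<in> {1..n} \<Longrightarrow> \<pi> (s_B n i) = signed_gen i"
    using W_B_hom_exists[OF group_signed_perms B_tuple_signed_gen signed_gen_square] by blast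
  have surj: "\<pi> ` carrier (W_B n) = carrier (signed_perms n)"
  proof (rule signed_perms_generated[OF subgroup_hom_image[OF is_group group_signed_perms \<pi>(1)] n])
    show "signed_gen i \<in> \<pi> ` carrier (W_B n)" if "i \<in> {1..n}" for i
      using \<pi>(2)[OF that, symmetric] coxeter_gen_closed[OF that] by (rule image_eqI)
  qed
  have "card (carrier (W_B n)) \<le> card (carrier (signed_perms n))"
    using card_carrier_le(2) by (simp add: card_signed_perms)
  moreover have "card (\<pi> ` carrier (W_B n)) \<le> card (carrier (W_B n))"
    by (rule card_image_le[OF card_carrier_le(1)])
  ultimately have "card (\<pi> ` carrier (W_B n)) = card (carrier (W_B n))" using surj by simp
  then have "inj_on \<pi> (carrier (W_B n))" by (rule eq_card_imp_inj_on[OF card_carrier_le(1)])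
  then have "\<pi> \<in> iso (W_B n) (signed_perms n)" using \<pi>(1) surj by (simp add: iso_def bij_betw_def)
  then show thesis using that \<pi>(2) by blast
qed

section \<open>The longest element\<close>

definition signed_value :: "(nat \<Rightarrow> bool) \<times> (nat \<Rightarrow> nat) \<Rightarrow> nat \<Rightarrow> int" where
  "signed_value g i = (if fst g i then - int (snd g i) else int (snd g i))"

text \<open>For \<open>i < j\<close> the two terms count which of the positive roots
  \<open>x_j - x_i\<close> and \<open>x_j + x_i\<close> become negative; \<open>inversions\<close>
  adds the short roots \<open>x_i\<close>. The total is the root-theoretic formula for Coxeter
  length in type B.\<close>

definition pair_weight :: "(nat \<Rightarrow> int) \<Rightarrow> nat \<times> nat \<Rightarrow> nat" where
  "pair_weight f = (\<lambda>(j, i). of_bool (f i > f j) + of_bool (f i + f j < 0))"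

definition inversions :: "nat \<Rightarrow> (nat \<Rightarrow> int) \<Rightarrow> nat" where
  "inversions n f = (\<Sum>x\<in>(SIGMA j:{1..n}. {1..<j}). pair_weight f x) + (\<Sum>i=1..n. of_bool (f i < 0))"

text \<open>Negating \<open>f 1\<close> exchanges the two conditions in the weight of each pair
  \<open>(j, 1)\<close>, so only the count of negative values changes.\<close>

lemma inversions_flip:
  assumes n: "1 \<le> n"
  shows "inversions n (f(1 := - f 1)) \<le> inversions n f + 1"
proof -
  let ?f = "f(1 := - f 1)"
  have "pair_weight ?f x = pair_weight f x" if "x \<in> (SIGMA j:{1..n}. {1..<j})" for x
    using that by (auto simp: pair_weight_def)
  then have 1: "(\<Sum>x\<in>(SIGMA j:{1..n}. {1..<j}). pair_weight ?f x) =
      (\<Sum>x\<in>(SIGMA j:{1..n}. {1..<j}). pair_weight f x)" by (rule sum.cong[OF HOL.refl])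
  have split: "(\<Sum>i=1..n. of_bool (g i < 0)) = of_bool (g 1 < 0) + (\<Sum>i\<in>{1..n} - {1}. of_bool (g i < 0))"
    for g :: "nat \<Rightarrow> int"
    using n by (intro sum.remove) auto
  have "(\<Sum>i\<in>{1..n} - {1}. of_bool (?f i < 0)) = (\<Sum>i\<in>{1..n} - {1}. of_bool (f i < 0) :: nat)"
    by (rule sum.cong) auto
  then have "(\<Sum>i=1..n. of_bool (?f i < 0)) \<le> (\<Sum>i=1..n. of_bool (f i < 0)) + (1::nat)"
    unfolding split[of ?f] split[of f] by (simp add: of_bool_def)
  then show ?thesis using 1 by (simp add: inversions_def)
qed

text \<open>The transposition permutes the pairs other than \<open>(Suc k, k)\<close> among
  themselves. In that pair the condition on the sum is symmetric, so at most the comparison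
  changes.\<close>

lemma inversions_swap:
  assumes k: "1 \<le> k" "k < n"
  shows "inversions n (f \<circ> transpose k (Suc k)) \<le> inversions n f + 1"
proof -
  let ?t = "transpose k (Suc k)" and ?P = "SIGMA j:{1..n}. {1..<j}"
  let ?Q = "?P - {(Suc k, k)}"
  have fin: "finite ?P" by auto
  have kP: "(Suc k, k) \<in> ?P" using k by auto
  have maps: "map_prod ?t ?t x \<in> ?Q" if "x \<in> ?Q" for x
  proof -
    obtain j i where x: "x = (j, i)" by fastforce
    have ij: "1 \<le> i" "i < j" "j \<le> n" "j = Suc k \<Longrightarrow> i \<noteq> k" using that x by auto
    have "?t i < ?t j \<and> 1 \<le> ?t i \<and> ?t j \<le> n \<and> (?t j = Suc k \<longrightarrow> ?t i \<noteq> k)"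
      by (cases "j = k"; cases "j = Suc k"; cases "i = k"; cases "i = Suc k")
        (use ij k in \<open>simp_all add: transpose_apply_other\<close>)
    then show ?thesis using x by simp
  qed
  have "bij_betw (map_prod ?t ?t) ?Q ?Q"
  proof (rule bij_betw_byWitness[where f' = "map_prod ?t ?t"])
    have "map_prod ?t ?t (map_prod ?t ?t x) = x" for x by (cases x) simp
    then show "\<forall>x\<in>?Q. map_prod ?t ?t (map_prod ?t ?t x) = x" "\<forall>x\<in>?Q. map_prod ?t ?t (map_prod ?t ?t x) = x"
      by blast+
    show "map_prod ?t ?t ` ?Q \<subseteq> ?Q" "map_prod ?t ?t ` ?Q \<subseteq> ?Q"
      by (rule image_subsetI, erule maps)+
  qed
  then have "(\<Sum>x\<in>?Q. pair_weight f (map_prod ?t ?t x)) = (\<Sum>x\<in>?Q. pair_weight f x)"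
    by (rule sum.reindex_bij_betw)
  moreover have "pair_weight (f \<circ> ?t) x = pair_weight f (map_prod ?t ?t x)" for x
    by (cases x) (simp add: pair_weight_def)
  ultimately have 1: "(\<Sum>x\<in>?Q. pair_weight (f \<circ> ?t) x) = (\<Sum>x\<in>?Q. pair_weight f x)" by simp
  have 2: "pair_weight (f \<circ> ?t) (Suc k, k) \<le> pair_weight f (Suc k, k) + 1"
    by (auto simp: pair_weight_def add.commute)
  have "?t permutes {1..n}" using k by (intro transpose_permutes) auto
  then have 3: "(\<Sum>i=1..n. of_bool ((f \<circ> ?t) i < 0)) = (\<Sum>i=1..n. of_bool (f i < 0) :: nat)"
    using sum.permute[of ?t "{1..n}" "\<lambda>i. of_bool (f i < 0) :: nat"] by (simp add: comp_def)
  show ?thesis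
    unfolding inversions_def 3 sum.remove[OF fin kP] 1 using 2 by simp
qed

lemma signed_value_mult_gen:
  assumes "1 \<le> k"
  shows "signed_value (g \<otimes>\<^bsub>signed_perms n\<^esub> signed_gen k) =
    (if k = 1 then (signed_value g)(1 := - signed_value g 1)
     else signed_value g \<circ> transpose (k - 1) k)"
  by (cases g) (auto simp: signed_value_def signed_gen_def fun_eq_iff)

lemma inversions_le_length:
  assumes "set is \<subseteq> {1..n}"
  shows "inversions n (signed_value (list_product (signed_perms n) (map signed_gen is))) \<le> length is"
  using assms
proof (induction "is" rule: rev_induct)
  case Nil
  then show ?case by (auto simp: inversions_def signed_value_def pair_weight_def intro!: sum.neutral)
next
  case (snoc k ks)
  interpret group "signed_perms n" by (rule group_signed_perms)
  let ?g = "list_product (signed_perms n) (map signed_gen ks)"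
  have k: "1 \<le> k" "k \<le> n" using snoc.prems by auto
  have "set (map signed_gen ks) \<subseteq> carrier (signed_perms n)"
    by (rule signed_gen_list_closed) (use snoc.prems in simp)
  then have "list_product (signed_perms n) (map signed_gen (ks @ [k])) = ?g \<otimes>\<^bsub>signed_perms n\<^esub> signed_gen k"
    using list_product_append[of "map signed_gen ks" "[signed_gen k]"] signed_gen_closed[OF k]
    by (simp del: sp_one)
  moreover have "inversions n (signed_value (?g \<otimes>\<^bsub>signed_perms n\<^esub> signed_gen k)) \<le> inversions n (signed_value ?g) + 1"
    unfolding signed_value_mult_gen[OF k(1)]
    using inversions_flip[of n "signed_value ?g"] inversions_swap[of "k - 1" n "signed_value ?g"] k
    by auto
  ultimately show ?case using snoc by simp
qed

lemma inversions_negative: "inversions n (\<lambda>i. - int i) = n * n"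
proof -
  have "(\<Sum>x\<in>(SIGMA j:{1..n}. {1..<j}). pair_weight (\<lambda>i. - int i) x) = (\<Sum>x\<in>(SIGMA j:{1..n}. {1..<j}). 2)"
    by (rule sum.cong) (auto simp: pair_weight_def)
  also have "\<dots> = 2 * (\<Sum>j=1..n. j - 1)" by (simp add: card_SigmaI)
  finally have "inversions n (\<lambda>i. - int i) = 2 * (\<Sum>j=1..n. j - 1) + n" by (simp add: inversions_def)
  also have "\<dots> = n * n" by (induction n) (auto simp: algebra_simps)
  finally show ?thesis .
qed

text \<open>Conjugating the sign change at \<open>m\<close> by the transposition of \<open>m\<close>
  and \<open>m + 1\<close> moves it to \<open>m + 1\<close>. The word is both that of
  \<open>e_B\<close> and the complete segment in the longest normal form.\<close>

lemma list_product_reflection: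
  assumes "1 \<le> m" "m \<le> n"
  shows "list_product (signed_perms n) (map signed_gen (rev [1..<Suc m] @ [2..<Suc m])) = (\<lambda>j. j = m, id)"
  using assms
proof (induction m rule: dec_induct)
  case base
  then show ?case by (simp add: signed_gen_def fun_eq_iff)
next
  case (step m)
  interpret group "signed_perms n" by (rule group_signed_perms)
  let ?w = "map signed_gen (rev [1..<Suc m] @ [2..<Suc m])"
  have w: "set ?w \<subseteq> carrier (signed_perms n)" using step.prems by (auto intro!: signed_gen_closed)
  have c: "signed_gen (Suc m) \<in> carrier (signed_perms n)" using step.prems by (auto intro!: signed_gen_closed)
  have "map signed_gen (rev [1..<Suc (Suc m)] @ [2..<Suc (Suc m)]) = signed_gen (Suc m) # ?w @ [signed_gen (Suc m)]"
    using step.hyps(1) by simp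
  then have "list_product (signed_perms n) (map signed_gen (rev [1..<Suc (Suc m)] @ [2..<Suc (Suc m)])) =
      signed_gen (Suc m) \<otimes>\<^bsub>signed_perms n\<^esub>
        (list_product (signed_perms n) ?w \<otimes>\<^bsub>signed_perms n\<^esub> signed_gen (Suc m))"
    using list_product_append[OF w, of "[signed_gen (Suc m)]"] c by (simp del: sp_one map_append)
  also have "list_product (signed_perms n) ?w = (\<lambda>j. j = m, id)"
    using step.IH[OF Suc_leD[OF step.prems(1)]] .
  also have "signed_gen (Suc m) \<otimes>\<^bsub>signed_perms n\<^esub> ((\<lambda>j. j = m, id) \<otimes>\<^bsub>signed_perms n\<^esub> signed_gen (Suc m)) =
      (\<lambda>j. j = Suc m, id)"
  proof -
    have g: "signed_gen (Suc m) = (\<lambda>_. False, transpose m (Suc m))" using step.hyps(1) by (simp add: signed_gen_def)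
    have "transpose m (Suc m) j = m \<longleftrightarrow> j = Suc m" for j by (auto simp: transpose_def)
    then show ?thesis unfolding g by (simp add: fun_eq_iff)
  qed
  finally show ?case .
qed

lemma list_product_longest:
  assumes "m \<le> n"
  shows "list_product (signed_perms n) (map signed_gen (normal_word m (\<lambda>i. 2 * i - 1))) =
    (\<lambda>i. 1 \<le> i \<and> i \<le> m, id)"
  using assms
proof (induction m)
  case 0
  then show ?case by auto
next
  case (Suc m)
  interpret group "signed_perms n" by (rule group_signed_perms)
  let ?w = "normal_word m (\<lambda>i. 2 * i - 1)" and ?c = "coset_word (Suc m) (2 * Suc m - 1)"
  have a: "admissible m (\<lambda>i. 2 * i - 1)" by (auto simp: admissible_def)
  have w: "set (map signed_gen ?w) \<subseteq> carrier (signed_perms n)"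
    by (rule signed_gen_list_closed) (use set_normal_word[OF a] Suc.prems in auto)
  have c: "set (map signed_gen ?c) \<subseteq> carrier (signed_perms n)"
    by (rule signed_gen_list_closed)
      (rule subset_trans[OF set_coset_word], use Suc.prems in auto)
  have "?c = rev [1..<Suc (Suc m)] @ [2..<Suc (Suc m)]"
  proof (cases "m = 0")
    case False
    then have "\<not> 2 * Suc m - 1 \<le> Suc m" "Suc (Suc (2 * Suc m - 1) - Suc m) = Suc (Suc m)" by auto
    then show ?thesis unfolding coset_word_def by simp
  qed (simp add: coset_word_def)
  then have "list_product (signed_perms n) (map signed_gen ?c) = (\<lambda>j. j = Suc m, id)"
    using list_product_reflection[of "Suc m" n] Suc.prems by simp
  moreover have "list_product (signed_perms n) (map signed_gen (normal_word (Suc m) (\<lambda>i. 2 * i - 1))) =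
      list_product (signed_perms n) (map signed_gen ?w) \<otimes>\<^bsub>signed_perms n\<^esub>
      list_product (signed_perms n) (map signed_gen ?c)"
    using list_product_append[OF w c] by simp
  ultimately show ?case using Suc by (auto simp: fun_eq_iff)
qed

lemma signed_perm_of_w0:
  assumes n: "1 \<le> n" and \<pi>: "\<pi> \<in> iso (W_B n) (signed_perms n)" "\<And>i. i \<in> {1..n} \<Longrightarrow> \<pi> (s_B n i) = signed_gen i"
  shows "w0_B n \<in> carrier (W_B n)" "\<pi> (w0_B n) = (\<lambda>i. 1 \<le> i \<and> i \<le> n, id)"
proof -
  interpret B_generated "W_B n" n "s_B n" by (rule B_generated_W_B)
  have \<pi>_hom: "\<pi> \<in> hom (W_B n) (signed_perms n)" using \<pi>(1) by (simp add: iso_def)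
  have \<pi>_list: "\<pi> (list_product (W_B n) (map (s_B n) ks)) = list_product (signed_perms n) (map signed_gen ks)"
    if "set ks \<subseteq> {1..n}" for ks
  proof -
    have "map \<pi> (map (s_B n) ks) = map signed_gen ks" using \<pi>(2) that by auto
    then show ?thesis
      using hom_list_product[OF is_group group_signed_perms \<pi>_hom, of "map (s_B n) ks"] set_s_subset[OF that] by metis
  qed
  let ?w = "normal n (\<lambda>i. 2 * i - 1)"
  have a: "admissible n (\<lambda>i. 2 * i - 1)" by (auto simp: admissible_def)
  have w: "?w \<in> carrier (W_B n)" using normal_closed[OF a] by simp
  have \<pi>w: "\<pi> ?w = (\<lambda>i. 1 \<le> i \<and> i \<le> n, id)"
    unfolding normal_def using \<pi>_list[OF set_normal_word[OF a]] list_product_longest[of n n] by simp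
  obtain ks where ks: "set ks \<subseteq> {1..n}" "length ks = word_length (W_B n) (s_B n ` {1..n}) ?w"
    "list_product (W_B n) (map (s_B n) ks) = ?w"
    using word_length_exists[OF w] by blast
  have "inversions n (signed_value (\<lambda>i. 1 \<le> i \<and> i \<le> n, id)) = n * n"
  proof -
    have "inversions n (signed_value (\<lambda>i. 1 \<le> i \<and> i \<le> n, id)) = inversions n (\<lambda>i. - int i)"
      unfolding inversions_def
      by (intro arg_cong2[where f = "(+)"] sum.cong) (auto simp: signed_value_def pair_weight_def)
    then show ?thesis by (simp add: inversions_negative)
  qed
  moreover have "list_product (signed_perms n) (map signed_gen ks) = (\<lambda>i. 1 \<le> i \<and> i \<le> n, id)"
    using \<pi>_list[OF ks(1)] ks(3) \<pi>w by simp
  ultimately have "n * n \<le> length ks" using inversions_le_length[OF ks(1)] by simp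
  then have "w0_B n = ?w" unfolding w0_B_def using longest_element_eqI ks(2) by simp
  then show "w0_B n \<in> carrier (W_B n)" "\<pi> (w0_B n) = (\<lambda>i. 1 \<le> i \<and> i \<le> n, id)" using w \<pi>w by auto
qed

lemma signed_perm_of_e:
  assumes \<pi>: "\<pi> \<in> hom (W_B n) (signed_perms n)" "\<And>i. i \<in> {1..n} \<Longrightarrow> \<pi> (s_B n i) = signed_gen i"
    and i: "1 \<le> i" "i \<le> n"
  shows "e_B n i \<in> carrier (W_B n)" "\<pi> (e_B n i) = (\<lambda>j. j = i, id)"
proof -
  interpret group "W_B n" by (rule group_coxeter_group)
  let ?ks = "rev [2..<i + 1] @ [1] @ [2..<i + 1]"
  have ks: "?ks = rev [1..<Suc i] @ [2..<Suc i]"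
    using i upt_conv_Cons[of 1 "Suc i"] by (simp add: numeral_2_eq_2)
  have sub: "set (map (s_B n) ?ks) \<subseteq> carrier (W_B n)"
    using i by (auto intro!: coxeter_gen_closed)
  have "set ?ks \<subseteq> {1..n}" using i by auto
  then have m: "map \<pi> (map (s_B n) ?ks) = map signed_gen ?ks" using \<pi>(2) by auto
  show "e_B n i \<in> carrier (W_B n)" unfolding e_B_def by (rule list_product_closed[OF sub])
  have "\<pi> (e_B n i) = list_product (signed_perms n) (map signed_gen ?ks)"
    unfolding e_B_def hom_list_product[OF is_group group_signed_perms \<pi>(1) sub] m ..
  then show "\<pi> (e_B n i) = (\<lambda>j. j = i, id)" unfolding ks list_product_reflection[OF i] .
qed

section \<open>Automorphisms\<close>

text \<open>Conjugation by \<open>r\<close>, described without inverses so that in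
  \<open>signed_perms\<close> the components of both sides can be compared directly.\<close>

lemma (in group) conj_auto:
  assumes r: "r \<in> carrier G"
  obtains \<alpha> where "\<alpha> \<in> auto G" "\<And>g. g \<in> carrier G \<Longrightarrow> r \<otimes> \<alpha> g = g \<otimes> r"
proof -
  define \<alpha> where "\<alpha> = (\<lambda>g\<in>carrier G. inv r \<otimes> g \<otimes> r)"
  have e: "r \<otimes> \<alpha> g = g \<otimes> r" if "g \<in> carrier G" for g
    using that r by (simp add: \<alpha>_def m_assoc[symmetric])
  have "\<alpha> \<in> hom G G"
  proof (rule homI)
    show "\<alpha> g \<in> carrier G" if "g \<in> carrier G" for g using that r by (simp add: \<alpha>_def)
    fix g h assume gh: "g \<in> carrier G" "h \<in> carrier G"
    have "\<alpha> (g \<otimes> h) = inv r \<otimes> (g \<otimes> (h \<otimes> r))" using gh r by (simp add: \<alpha>_def m_assoc)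
    also have "\<dots> = inv r \<otimes> (g \<otimes> (r \<otimes> \<alpha> h))" using e[OF gh(2)] by simp
    also have "\<dots> = \<alpha> g \<otimes> \<alpha> h" using gh r by (simp add: \<alpha>_def m_assoc)
    finally show "\<alpha> (g \<otimes> h) = \<alpha> g \<otimes> \<alpha> h" .
  qed
  moreover have "bij_betw \<alpha> (carrier G) (carrier G)"
  proof (rule bij_betw_byWitness[where f' = "\<lambda>g. r \<otimes> g \<otimes> inv r"])
    show "\<forall>g\<in>carrier G. r \<otimes> \<alpha> g \<otimes> inv r = g" using e r by (simp add: m_assoc)
    show "\<forall>g\<in>carrier G. \<alpha> (r \<otimes> g \<otimes> inv r) = g"
    proof
      fix g assume g: "g \<in> carrier G"
      have "\<alpha> (r \<otimes> g \<otimes> inv r) = inv r \<otimes> (r \<otimes> (g \<otimes> (inv r \<otimes> r)))"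
        using g r by (simp add: \<alpha>_def m_assoc del: l_inv r_inv)
      also have "\<dots> = inv r \<otimes> r \<otimes> g" using g r by (simp add: m_assoc[symmetric])
      finally show "\<alpha> (r \<otimes> g \<otimes> inv r) = g" using g r by simp
    qed
  qed (use r in \<open>auto simp: \<alpha>_def\<close>)
  ultimately have "\<alpha> \<in> auto G" by (simp add: auto_def Bij_def \<alpha>_def)
  then show thesis using that e by blast
qed

lemma autoD:
  assumes "\<alpha> \<in> auto G"
  shows "\<alpha> \<in> hom G G" "bij_betw \<alpha> (carrier G) (carrier G)" "\<alpha> \<in> extensional (carrier G)"
  using assms by (auto simp: auto_def Bij_def)

lemma auto_closed: "\<alpha> \<in> auto G \<Longrightarrow> x \<in> carrier G \<Longrightarrow> \<alpha> x \<in> carrier G"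
  by (auto simp: auto_def hom_def)

lemma (in group) compose_auto:
  assumes "\<alpha> \<in> auto G" "\<beta> \<in> auto G"
  shows "compose (carrier G) \<alpha> \<beta> \<in> auto G"
proof -
  have "compose (carrier G) \<alpha> \<beta> \<in> hom G G"
    by (rule hom_compose) (use assms autoD in auto)
  then show ?thesis using assms compose_Bij by (auto simp: auto_def)
qed

lemma (in group) inv_auto:
  assumes "\<alpha> \<in> auto G"
  obtains \<beta> where "\<beta> \<in> auto G" "\<And>x. x \<in> carrier G \<Longrightarrow> \<beta> (\<alpha> x) = x"
proof -
  let ?\<beta> = "restrict (inv_into (carrier G) \<alpha>) (carrier G)"
  have "?\<beta> \<in> auto G"
    using assms restrict_inv_into_hom restrict_inv_into_Bij by (auto simp: auto_def simp del: restrict_apply)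
  moreover have "?\<beta> (\<alpha> x) = x" if "x \<in> carrier G" for x
    using that autoD(2)[OF assms] auto_closed[OF assms that] bij_betw_inv_into_left[of \<alpha>] by simp
  ultimately show thesis using that by blast
qed

lemma fst_sp_mult: "fst (x \<otimes>\<^bsub>signed_perms n\<^esub> y) i = (fst y i \<noteq> fst x (snd y i))"
  and snd_sp_mult: "snd (x \<otimes>\<^bsub>signed_perms n\<^esub> y) = snd x \<circ> snd y"
  by (cases x; cases y; simp)+

lemma sp_permutes: "x \<in> carrier (signed_perms n) \<Longrightarrow> snd x permutes {1..n}"
  by (cases x) simp

lemma sp_fst_range: "x \<in> carrier (signed_perms n) \<Longrightarrow> fst x i \<Longrightarrow> 1 \<le> i \<and> i \<le> n"
  by (cases x) simp

text \<open>Elements with odd underlying permutation are multiplied by \<open>w\<^sub>0\<close>.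
  This respects products because \<open>w\<^sub>0\<close> is central of order at most two and parity
  is multiplicative; it is its own inverse because \<open>w\<^sub>0\<close> itself has even
  permutation.\<close>

lemma sign_twist_auto:
  "(\<lambda>x\<in>carrier (signed_perms n). (\<lambda>i. fst x i \<noteq> (\<not> evenperm (snd x) \<and> 1 \<le> i \<and> i \<le> n), snd x))
    \<in> auto (signed_perms n)" (is "?\<theta> \<in> _")
proof -
  let ?S = "signed_perms n"
  interpret group ?S by (rule group_signed_perms)
  have cl: "?\<theta> x \<in> carrier ?S" if "x \<in> carrier ?S" for x
    using that by (cases x) auto
  have "?\<theta> \<in> hom ?S ?S"
  proof (rule homI)
    show "?\<theta> x \<in> carrier ?S" if "x \<in> carrier ?S" for x using cl[OF that] .
    fix x y assume xy: "x \<in> carrier ?S" "y \<in> carrier ?S"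
    obtain v p where vp: "x = (v, p)" by fastforce
    obtain w q where wq: "y = (w, q)" by fastforce
    have p: "p permutes {1..n}" "q permutes {1..n}" using xy vp wq by auto
    have ev: "evenperm (p \<circ> q) \<longleftrightarrow> evenperm p = evenperm q"
      using evenperm_comp[of p q] p permutation_permutes by blast
    have xyc: "x \<otimes>\<^bsub>?S\<^esub> y \<in> carrier ?S" using xy by simp
    show "?\<theta> (x \<otimes>\<^bsub>?S\<^esub> y) = ?\<theta> x \<otimes>\<^bsub>?S\<^esub> ?\<theta> y"
    proof (rule prod_eqI)
      show "snd (?\<theta> (x \<otimes>\<^bsub>?S\<^esub> y)) = snd (?\<theta> x \<otimes>\<^bsub>?S\<^esub> ?\<theta> y)"
        using xy xyc by (simp add: snd_sp_mult)
      show "fst (?\<theta> (x \<otimes>\<^bsub>?S\<^esub> y)) = fst (?\<theta> x \<otimes>\<^bsub>?S\<^esub> ?\<theta> y)"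
      proof
        fix i
        have "1 \<le> q i \<and> q i \<le> n \<longleftrightarrow> 1 \<le> i \<and> i \<le> n" using permutes_range[OF p(2)] .
        then show "fst (?\<theta> (x \<otimes>\<^bsub>?S\<^esub> y)) i = fst (?\<theta> x \<otimes>\<^bsub>?S\<^esub> ?\<theta> y) i"
          using xy xyc ev by (simp add: fst_sp_mult snd_sp_mult) (auto simp: vp wq)
      qed
    qed
  qed
  moreover have "bij_betw ?\<theta> (carrier ?S) (carrier ?S)"
  proof (rule bij_betw_byWitness[where f' = ?\<theta>])
    have "?\<theta> (?\<theta> x) = x" if "x \<in> carrier ?S" for x
      using cl[OF that] that by (auto simp: prod_eq_iff fun_eq_iff)
    then show "\<forall>x\<in>carrier ?S. ?\<theta> (?\<theta> x) = x" "\<forall>x\<in>carrier ?S. ?\<theta> (?\<theta> x) = x" by blast+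
    show "?\<theta> ` carrier ?S \<subseteq> carrier ?S" "?\<theta> ` carrier ?S \<subseteq> carrier ?S" using cl by blast+
  qed
  ultimately show ?thesis unfolding auto_def Bij_def by blast
qed

section \<open>Classification of the tuples\<close>

lemma B_tuple_braid_on:
  assumes "B_tuple (signed_perms n) n x"
  shows "braid_on n {1..n} (\<lambda>i. snd (x (Suc i)))"
proof (rule braid_onI)
  show "bij_betw (snd (x (Suc i))) {1..n} {1..n}" if "1 \<le> i" "i < n" for i
    using sp_permutes[OF B_tupleD(1)[OF assms, of "Suc i"]] that permutes_imp_bij by auto
  show "snd (x (Suc i)) (snd (x (Suc j)) k) = snd (x (Suc j)) (snd (x (Suc i)) k)"
    if "1 \<le> i" "i + 2 \<le> j" "j < n" for i j k
  proof -
    have "snd (x (Suc i)) \<circ> snd (x (Suc j)) = snd (x (Suc j)) \<circ> snd (x (Suc i))"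
      using arg_cong[where f = snd, OF B_tupleD(4)[OF assms, of "Suc i" "Suc j"]] that
      by (simp add: snd_sp_mult)
    then show ?thesis by (metis comp_apply)
  qed
  show "snd (x (Suc i)) (snd (x (Suc (Suc i))) (snd (x (Suc i)) k)) =
      snd (x (Suc (Suc i))) (snd (x (Suc i)) (snd (x (Suc (Suc i))) k))" if "1 \<le> i" "Suc i < n" for i k
  proof -
    have "snd (x (Suc i)) \<circ> (snd (x (Suc (Suc i))) \<circ> snd (x (Suc i))) =
        snd (x (Suc (Suc i))) \<circ> (snd (x (Suc i)) \<circ> snd (x (Suc (Suc i))))"
      using arg_cong[where f = snd, OF B_tupleD(3)[OF assms, of "Suc i"]] that
      by (simp add: snd_sp_mult)
    then show ?thesis by (metis comp_apply)
  qed
qed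

lemma standard_perms:
  assumes B: "B_tuple (signed_perms n) n x" and n: "3 \<le> n" "odd n"
    and ne: "\<not> all_equal_on n {1..n} (\<lambda>i. snd (x (Suc i)))"
  obtains \<alpha> where "\<alpha> \<in> auto (signed_perms n)"
    "\<And>i. 2 \<le> i \<Longrightarrow> i \<le> n \<Longrightarrow> snd (\<alpha> (x i)) = transpose (i - 1) i"
proof -
  let ?S = "signed_perms n"
  interpret group ?S by (rule group_signed_perms)
  let ?t = "\<lambda>i. snd (x (Suc i))"
  obtain p where p: "bij_betw p {1..n} {1..n}"
    "\<And>i. 1 \<le> i \<Longrightarrow> i < n \<Longrightarrow> moved (?t i) {1..n} = {p i, p (Suc i)}"
    by (rule artin_odd[OF B_tuple_braid_on[OF B] _ _ n ne]) auto
  \<comment> \<open>\<open>p\<close> is controlled only on \<open>{1..n}\<close>; outside it has to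
    be replaced by the identity to give a permutation.\<close>
  define \<rho> where "\<rho> k = (if k \<in> {1..n} then p k else k)" for k
  have "bij_betw \<rho> {1..n} {1..n}" using p(1) bij_betw_cong[of "{1..n}" p \<rho>] by (simp add: \<rho>_def)
  then have \<rho>: "\<rho> permutes {1..n}" by (rule bij_imp_permutes) (auto simp: \<rho>_def)
  have \<rho>_inj: "\<rho> a = \<rho> b \<longleftrightarrow> a = b" for a b using permutes_inj[OF \<rho>] by (auto dest: injD)
  have moved: "moved (snd (x i)) {1..n} = {\<rho> (i - 1), \<rho> i}" if "2 \<le> i" "i \<le> n" for i
  proof -
    have "1 \<le> i - 1" "i - 1 < n" "Suc (i - 1) = i" "i - 1 \<in> {1..n}" "i \<in> {1..n}" using that by auto
    then show ?thesis using p(2)[of "i - 1"] unfolding \<rho>_def by simp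
  qed
  have xc: "x i \<in> carrier ?S" if "1 \<le> i" "i \<le> n" for i using B_tupleD(1)[OF B that] .
  have t: "snd (x i) (\<rho> k) = \<rho> (transpose (i - 1) i k)" if i: "2 \<le> i" "i \<le> n" for i k
  proof -
    have xp: "snd (x i) permutes {1..n}" using sp_permutes[OF xc[of i]] i by simp
    have pair: "snd (x i) (\<rho> (i - 1)) = \<rho> i" "snd (x i) (\<rho> i) = \<rho> (i - 1)"
      using moved_pair[OF permutes_imp_bij[OF xp] moved[OF i]] .
    show ?thesis
    proof (cases "k = i - 1 \<or> k = i")
      case True
      then show ?thesis using pair by auto
    next
      case False
      then have "\<rho> k \<notin> moved (snd (x i)) {1..n}" using moved[OF i] \<rho>_inj by auto
      moreover have "snd (x i) (\<rho> k) = \<rho> k" if "\<rho> k \<notin> {1..n}"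
        using permutes_not_in[OF xp that] .
      ultimately have "snd (x i) (\<rho> k) = \<rho> k" by (auto simp: moved_def)
      then show ?thesis using False by (simp add: transpose_apply_other)
    qed
  qed
  let ?r = "(\<lambda>_. False, \<rho>)"
  have "?r \<in> carrier ?S" using \<rho> by simp
  then obtain \<alpha> where \<alpha>: "\<alpha> \<in> auto ?S" "\<And>g. g \<in> carrier ?S \<Longrightarrow> ?r \<otimes>\<^bsub>?S\<^esub> \<alpha> g = g \<otimes>\<^bsub>?S\<^esub> ?r"
    by (rule conj_auto) blast
  have "snd (\<alpha> (x i)) = transpose (i - 1) i" if i: "2 \<le> i" "i \<le> n" for i
  proof
    fix k
    have "x i \<in> carrier ?S" using xc[of i] i by simp
    then have "\<rho> \<circ> snd (\<alpha> (x i)) = snd (x i) \<circ> \<rho>" using \<alpha>(2)[of "x i"] by (metis snd_conv snd_sp_mult)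
    then have "\<rho> (snd (\<alpha> (x i)) k) = snd (x i) (\<rho> k)" by (metis comp_apply)
    then show "snd (\<alpha> (x i)) k = transpose (i - 1) i k" using t[OF i] \<rho>_inj by simp
  qed
  then show thesis using that \<alpha>(1) by blast
qed

text \<open>The permutation of \<open>x 1\<close> commutes with the transpositions of
  \<open>j - 1\<close> and \<open>j\<close> for \<open>j \<ge> 3\<close>. For
  \<open>n \<ge> 4\<close> this already forces the identity; for \<open>n = 3\<close> it leaves the
  transposition of 2 and 3, which the relation of length four with \<open>x 2\<close>
  excludes.\<close>

lemma standard_perm_first:
  assumes B: "B_tuple (signed_perms n) n x" and n: "3 \<le> n"
    and x: "\<And>i. 2 \<le> i \<Longrightarrow> i \<le> n \<Longrightarrow> snd (x i) = transpose (i - 1) i"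
  shows "snd (x 1) = id"
proof -
  let ?S = "signed_perms n"
  let ?q = "snd (x 1)"
  have "x 1 \<in> carrier ?S" using B_tupleD(1)[OF B] n by simp
  then have q: "?q permutes {1..n}" by (rule sp_permutes)
  have q_inj: "?q a = ?q b \<longleftrightarrow> a = b" for a b using permutes_inj[OF q] by (auto dest: injD)
  have q_range: "?q k \<in> {1..n} \<longleftrightarrow> k \<in> {1..n}" for k using permutes_in_image[OF q] .
  have comm: "?q (transpose (j - 1) j k) = transpose (j - 1) j (?q k)" if "3 \<le> j" "j \<le> n" for j k
  proof -
    have "?q \<circ> snd (x j) = snd (x j) \<circ> ?q"
      using arg_cong[where f = snd, OF B_tupleD(4)[OF B, of 1 j]] that by (simp add: snd_sp_mult)
    then show ?thesis using x[of j] that by (simp add: fun_eq_iff)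
  qed
  have stable: "?q k = j - 1 \<or> ?q k = j" if "3 \<le> j" "j \<le> n" "k = j - 1 \<or> k = j" for j k
  proof -
    have "transpose (j - 1) j k \<noteq> k" using that by (auto simp: transpose_def)
    then have "transpose (j - 1) j (?q k) \<noteq> ?q k" using comm[OF that(1,2)] q_inj by metis
    then show ?thesis by (auto simp: transpose_def split: if_splits)
  qed
  have q1: "?q 1 = 1"
  proof (rule ccontr)
    assume n1: "?q 1 \<noteq> 1"
    \<comment> \<open>This picks a transposition that fixes 1 and moves \<open>?q 1\<close>; the
      maximum covers the case \<open>?q 1 = 2\<close>.\<close>
    let ?j = "max 3 (?q 1)"
    have r: "2 \<le> ?q 1" "?q 1 \<le> n" using q_range[of 1] n n1 by auto
    then have j: "3 \<le> ?j" "?j \<le> n" using n by auto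
    have "transpose (?j - 1) ?j (?q 1) = ?q (transpose (?j - 1) ?j 1)" using comm[OF j, of 1] by simp
    moreover have "transpose (?j - 1) ?j 1 = 1" using j by (auto simp: transpose_def)
    moreover have "transpose (?j - 1) ?j (?q 1) \<noteq> ?q 1" using r by (auto simp: transpose_def max_def)
    ultimately show False by simp
  qed
  have q2: "?q 2 = 2"
  proof (rule ccontr)
    assume "?q 2 \<noteq> 2"
    then have q23: "?q 2 = 3" using stable[of 3 2] n by simp
    have "?q \<circ> (snd (x 2) \<circ> (?q \<circ> snd (x 2))) = snd (x 2) \<circ> (?q \<circ> (snd (x 2) \<circ> ?q))"
      using arg_cong[where f = snd, OF B_tupleD(2)[OF B]] n by (simp add: snd_sp_mult)
    from fun_cong[OF this, of 1]
    have "?q (transpose 1 2 (?q (transpose 1 2 1))) = transpose 1 2 (?q (transpose 1 2 (?q 1)))"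
      using x[of 2] n by simp
    then have "?q 3 = 3" using q1 q23 by (simp add: transpose_def)
    then show False using q23 q_inj[of 2 3] by simp
  qed
  have "?q k = k" if "2 \<le> k" "k \<le> n" for k
    using that
  proof (induction k rule: dec_induct)
    case base
    then show ?case using q2 by simp
  next
    case (step k)
    then have "?q k = k" "?q (Suc k) = k \<or> ?q (Suc k) = Suc k" using stable[of "Suc k" "Suc k"] by auto
    then show ?case using q_inj[of k "Suc k"] by auto
  qed
  then have "?q k = k" for k
    using q1 permutes_not_in[OF q, of k] by (cases "k = 1"; cases "2 \<le> k \<and> k \<le> n") auto
  then show ?thesis by auto
qed

text \<open>The first entry is \<open>w\<^sub>0\<close> if \<open>b\<close>, times
  \<open>s 1\<close> if \<open>a\<close>. The others are \<open>s i\<close>, or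
  \<open>e (i - 1)\<close> times \<open>s i\<close> if \<open>c\<close>: as signs belong to sources,
  the sign change after the transposition, at \<open>i - 1\<close>, is recorded at \<open>i\<close>.
  The triples \<open>(c, a, b)\<close> of the three representatives are
  \<open>(False, True, True)\<close>, \<open>(True, True, True)\<close> and
  \<open>(True, False, False)\<close>.\<close>

definition normal_tuple :: "nat \<Rightarrow> bool \<Rightarrow> bool \<Rightarrow> bool \<Rightarrow> nat \<Rightarrow> (nat \<Rightarrow> bool) \<times> (nat \<Rightarrow> nat)" where
  "normal_tuple n c a b i = (if i = 1 then (\<lambda>k. 1 \<le> k \<and> k \<le> n \<and> b \<noteq> (a \<and> k = 1), id)
     else (\<lambda>k. c \<and> k = i, transpose (i - 1) i))"

text \<open>The two data that diagonal conjugation cannot change: \<open>d\<close> is the sign of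
  \<open>x i\<close> at the points its permutation fixes, and \<open>c\<close> tells whether the
  square of \<open>x i\<close> is non-trivial. The braid relations between neighbours make both
  independent of \<open>i\<close>.\<close>

lemma standard_signs:
  assumes B: "B_tuple (signed_perms n) n x" and n: "3 \<le> n"
    and x: "\<And>i. 2 \<le> i \<Longrightarrow> i \<le> n \<Longrightarrow> snd (x i) = transpose (i - 1) i"
  obtains d c where
    "\<And>i k. 2 \<le> i \<Longrightarrow> i \<le> n \<Longrightarrow> 1 \<le> k \<Longrightarrow> k \<le> n \<Longrightarrow> k \<noteq> i \<Longrightarrow> Suc k \<noteq> i \<Longrightarrow> fst (x i) k = d"
    "\<And>i. 2 \<le> i \<Longrightarrow> i \<le> n \<Longrightarrow> (fst (x i) (i - 1) \<noteq> fst (x i) i) = c"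
proof -
  let ?v = "\<lambda>i. fst (x i)"
  have braid: "((?v i k \<noteq> ?v (Suc i) (transpose (i - 1) i k)) \<noteq> ?v i (transpose i (Suc i) (transpose (i - 1) i k))) =
      ((?v (Suc i) k \<noteq> ?v i (transpose i (Suc i) k)) \<noteq> ?v (Suc i) (transpose (i - 1) i (transpose i (Suc i) k)))"
    if "2 \<le> i" "i < n" for i k
  proof -
    have s: "snd (x i) = transpose (i - 1) i" "snd (x (Suc i)) = transpose i (Suc i)"
      using x[of i] x[of "Suc i"] that by auto
    show ?thesis
      using arg_cong[where f = "\<lambda>g. fst g k", OF B_tupleD(3)[OF B that]]
      unfolding fst_sp_mult snd_sp_mult s by simp
  qed
  have tr: "transpose (i - 1) i (i - 1) = i" "transpose (i - 1) i i = i - 1"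
    "transpose (i - 1) i (Suc i) = Suc i" "transpose i (Suc i) (i - 1) = i - 1"
    "transpose i (Suc i) i = Suc i" "transpose i (Suc i) (Suc i) = i" if "2 \<le> i" for i :: nat
    using that by (auto simp: transpose_def)
  have across: "?v i (Suc i) = ?v (Suc i) (i - 1)" if "2 \<le> i" "i < n" for i
    using braid[OF that, of "Suc i"] unfolding tr[OF that(1)] by blast
  have parity: "(?v i (i - 1) \<noteq> ?v i i) = (?v (Suc i) i \<noteq> ?v (Suc i) (Suc i))" if "2 \<le> i" "i < n" for i
    using braid[OF that, of i] across[OF that] unfolding tr[OF that(1)] by blast
  have outside: "?v i k = ?v (Suc i) k" if "2 \<le> i" "i < n" "k \<noteq> i - 1" "k \<noteq> i" "k \<noteq> Suc i" for i k
  proof -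
    have "transpose (i - 1) i k = k" "transpose i (Suc i) k = k" using that by (auto simp: transpose_def)
    note tk = this
    show ?thesis using braid[OF that(1,2), of k] unfolding tk by blast
  qed
  have right: "?v 2 (Suc k) = ?v 2 k" if k: "3 \<le> k" "k < n" for k
  proof -
    have s: "snd (x 2) = transpose 1 2" "snd (x (Suc k)) = transpose k (Suc k)"
      using x[of 2] x[of "Suc k"] k by auto
    have "x 2 \<otimes>\<^bsub>signed_perms n\<^esub> x (Suc k) = x (Suc k) \<otimes>\<^bsub>signed_perms n\<^esub> x 2"
      using B_tupleD(4)[OF B, of 2 "Suc k"] k by simp
    then have "fst (x 2 \<otimes>\<^bsub>signed_perms n\<^esub> x (Suc k)) (Suc k) = fst (x (Suc k) \<otimes>\<^bsub>signed_perms n\<^esub> x 2) (Suc k)"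
      by simp
    then show ?thesis unfolding fst_sp_mult s using k by (auto simp: transpose_def)
  qed
  have base: "?v 2 k = ?v 2 3" if "3 \<le> k" "k \<le> n" for k
    using that by (induction k rule: dec_induct) (auto simp: right)
  have d: "?v i k = ?v 2 3" if "2 \<le> i" "i \<le> n" "1 \<le> k" "k \<le> n" "k \<noteq> i" "Suc k \<noteq> i" for i k
  proof -
    have "i \<le> n \<longrightarrow> (\<forall>k. 1 \<le> k \<longrightarrow> k \<le> n \<longrightarrow> k \<noteq> i \<longrightarrow> Suc k \<noteq> i \<longrightarrow> ?v i k = ?v 2 3)"
      using that(1)
    proof (induction i rule: dec_induct)
      case base
      have "3 \<le> k" if "1 \<le> k" "k \<noteq> 2" "Suc k \<noteq> 2" for k using that by auto
      then show ?case using \<open>\<And>k. 3 \<le> k \<Longrightarrow> k \<le> n \<Longrightarrow> ?v 2 k = ?v 2 3\<close> by blast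
    next
      case (step i)
      show ?case
      proof (intro impI allI)
        fix k assume i: "Suc i \<le> n" and k: "1 \<le> k" "k \<le> n" "k \<noteq> Suc i" "Suc k \<noteq> Suc i"
        show "?v (Suc i) k = ?v 2 3"
        proof (cases "k = i - 1")
          case True
          then have "?v (Suc i) k = ?v i (Suc i)" using across[of i] step.hyps i by simp
          then show ?thesis using step.IH i by simp
        next
          case False
          then have "?v (Suc i) k = ?v i k" using outside[of i k] step.hyps i k by simp
          moreover have "Suc k \<noteq> i" "k \<noteq> i" using False k by auto
          ultimately show ?thesis using step.IH i k by simp
        qed
      qed
    qed
    then show ?thesis using that by blast
  qed
  have c: "(?v i (i - 1) \<noteq> ?v i i) = (?v 2 1 \<noteq> ?v 2 2)" if "2 \<le> i" "i \<le> n" for i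
    using that
  proof (induction i rule: dec_induct)
    case base
    then show ?case by simp
  next
    case (step i)
    then show ?case using parity[of i] by simp
  qed
  show thesis by (rule that[of "?v 2 3" "?v 2 1 \<noteq> ?v 2 2"]) (use d c in blast)+
qed

text \<open>Three automorphisms are composed: \<open>\<alpha>\<close> makes the permutations
  standard, the diagonal conjugation \<open>\<beta>\<close> brings the signs of each later entry to
  \<open>d\<close> except possibly at \<open>i\<close>, and the twist by \<open>w\<^sub>0\<close>
  then removes \<open>d\<close>. The twist does not affect the first entry, whose permutation is the
  identity.\<close>

lemma normal_tuple_exists:
  assumes B: "B_tuple (signed_perms n) n x" and n: "3 \<le> n" "odd n"
    and ne: "\<not> all_equal_on n {1..n} (\<lambda>i. snd (x (Suc i)))"
  obtains \<alpha> c a b where "\<alpha> \<in> auto (signed_perms n)"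
    "\<And>i. 1 \<le> i \<Longrightarrow> i \<le> n \<Longrightarrow> \<alpha> (x i) = normal_tuple n c a b i"
proof -
  let ?S = "signed_perms n"
  interpret group ?S by (rule group_signed_perms)
  note xc = B_tupleD(1)[OF B]
  obtain \<alpha> where \<alpha>: "\<alpha> \<in> auto ?S" "\<And>i. 2 \<le> i \<Longrightarrow> i \<le> n \<Longrightarrow> snd (\<alpha> (x i)) = transpose (i - 1) i"
    by (rule standard_perms[OF B n ne]) blast
  define y where "y i = \<alpha> (x i)" for i
  have y: "B_tuple ?S n y"
    unfolding y_def by (rule B_tuple_hom[OF B autoD(1)[OF \<alpha>(1)] is_group is_group])
  note yc = B_tupleD(1)[OF y]
  have ys: "snd (y i) = transpose (i - 1) i" if "2 \<le> i" "i \<le> n" for i using \<alpha>(2)[OF that] by (simp add: y_def)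
  have y1: "snd (y 1) = id" by (rule standard_perm_first[OF y n(1) ys])
  obtain d c where d: "\<And>i k. 2 \<le> i \<Longrightarrow> i \<le> n \<Longrightarrow> 1 \<le> k \<Longrightarrow> k \<le> n \<Longrightarrow> k \<noteq> i \<Longrightarrow> Suc k \<noteq> i \<Longrightarrow> fst (y i) k = d"
    and c: "\<And>i. 2 \<le> i \<Longrightarrow> i \<le> n \<Longrightarrow> (fst (y i) (i - 1) \<noteq> fst (y i) i) = c"
    by (rule standard_signs[OF y n(1) ys]) blast+
  \<comment> \<open>Conjugation by \<open>(w, id)\<close> changes the sign of \<open>y i\<close> at
    \<open>i - 1\<close> exactly if \<open>w (i - 1)\<close> and \<open>w i\<close> differ. The
    recursion accumulates the changes needed to reach \<open>d\<close>; the test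
    \<open>k \<noteq> 0\<close> skips the step from 0 to 1, to which no transposition
    belongs.\<close>
  define u where "u = rec_nat False (\<lambda>k r. r \<noteq> (k \<noteq> 0 \<and> fst (y (Suc k)) k \<noteq> d))"
  have u_Suc: "u (Suc k) = (u k \<noteq> (k \<noteq> 0 \<and> fst (y (Suc k)) k \<noteq> d))" for k by (simp add: u_def)
  define w where "w k \<longleftrightarrow> 1 \<le> k \<and> k \<le> n \<and> u k" for k
  have "(w, id) \<in> carrier ?S" by (auto simp: w_def permutes_id)
  then obtain \<beta> where \<beta>: "\<beta> \<in> auto ?S" "\<And>g. g \<in> carrier ?S \<Longrightarrow> (w, id) \<otimes>\<^bsub>?S\<^esub> \<beta> g = g \<otimes>\<^bsub>?S\<^esub> (w, id)"
    by (rule conj_auto) blast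
  define z where "z i = \<beta> (y i)" for i
  have zc: "z i \<in> carrier ?S" if "1 \<le> i" "i \<le> n" for i
    using auto_closed[OF \<beta>(1) yc[OF that]] by (simp add: z_def)
  have zs: "snd (z i) = snd (y i)" if "1 \<le> i" "i \<le> n" for i
    using arg_cong[where f = snd, OF \<beta>(2)[OF yc[OF that]]] by (simp add: snd_sp_mult z_def)
  have zf: "fst (z i) k = (fst (y i) k \<noteq> (w k \<noteq> w (snd (y i) k)))" if "1 \<le> i" "i \<le> n" for i k
    using arg_cong[where f = "\<lambda>g. fst g k", OF \<beta>(2)[OF yc[OF that]]] zs[OF that]
    by (auto simp: fst_sp_mult z_def)
  have z: "fst (z i) k = (d \<noteq> (c \<and> k = i))" if i: "2 \<le> i" "i \<le> n" and k: "1 \<le> k" "k \<le> n" for i k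
  proof -
    have wi: "(w (i - 1) \<noteq> w i) = (fst (y i) (i - 1) \<noteq> d)"
      using u_Suc[of "i - 1"] i by (auto simp: w_def)
    have zf': "fst (z i) k = (fst (y i) k \<noteq> (w k \<noteq> w (transpose (i - 1) i k)))"
      using zf[of i k] ys[OF i] i by simp
    consider "k = i" | "k = i - 1" "k \<noteq> i" | "k \<noteq> i" "Suc k \<noteq> i" using i by linarith
    then show ?thesis
    proof cases
      case 1
      then show ?thesis using zf' wi c[OF i] by auto
    next
      case 2
      then show ?thesis using zf' wi c[OF i] by auto
    next
      case 3
      then have "transpose (i - 1) i k = k" by (auto simp: transpose_def)
      then show ?thesis using zf' d[OF i k 3] 3 by simp
    qed
  qed
  have zB: "B_tuple ?S n z"
    unfolding z_def by (rule B_tuple_hom[OF y autoD(1)[OF \<beta>(1)] is_group is_group])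
  have z1s: "snd (z 1) = id" using zs[of 1] y1 n by simp
  \<comment> \<open>\<open>z 1\<close> is diagonal and commutes with the entries that exchange
    \<open>k\<close> and \<open>k + 1\<close> for \<open>k \<ge> 2\<close>, so only its sign at 1
    can differ from the rest.\<close>
  have z1_step: "fst (z 1) (Suc k) = fst (z 1) k" if "2 \<le> k" "k < n" for k
  proof -
    have s: "snd (z (Suc k)) = transpose k (Suc k)" using zs[of "Suc k"] ys[of "Suc k"] that by simp
    have "z 1 \<otimes>\<^bsub>?S\<^esub> z (Suc k) = z (Suc k) \<otimes>\<^bsub>?S\<^esub> z 1" using B_tupleD(4)[OF zB, of 1 "Suc k"] that by simp
    then have "fst (z 1 \<otimes>\<^bsub>?S\<^esub> z (Suc k)) (Suc k) = fst (z (Suc k) \<otimes>\<^bsub>?S\<^esub> z 1) (Suc k)" by simp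
    then show ?thesis unfolding fst_sp_mult s z1s by auto
  qed
  have z1: "fst (z 1) k = fst (z 1) 2" if "2 \<le> k" "k \<le> n" for k
    using that by (induction k rule: dec_induct) (auto simp: z1_step[unfolded One_nat_def])
  define b a where "b = fst (z 1) 2" and "a \<longleftrightarrow> fst (z 1) 1 \<noteq> fst (z 1) 2"
  let ?\<theta> = "\<lambda>x\<in>carrier ?S. (\<lambda>i. fst x i \<noteq> (\<not> evenperm (snd x) \<and> 1 \<le> i \<and> i \<le> n), snd x)"
  define \<gamma> where "\<gamma> = (if d then ?\<theta> else (\<lambda>x\<in>carrier ?S. x))"
  have \<gamma>: "\<gamma> \<in> auto ?S" using sign_twist_auto[of n] id_in_auto by (simp add: \<gamma>_def)
  have ztot: "z i = (\<lambda>k. 1 \<le> k \<and> k \<le> n \<and> fst (z i) k, snd (z i))" if "1 \<le> i" "i \<le> n" for i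
    using sp_fst_range[OF zc[OF that]] by (auto simp: prod_eq_iff fun_eq_iff)
  have fin: "\<gamma> (z i) = normal_tuple n c a b i" if i: "1 \<le> i" "i \<le> n" for i
  proof (cases "i = 1")
    case True
    have "z 1 = normal_tuple n c a b 1"
    proof (rule prod_eqI)
      show "snd (z 1) = snd (normal_tuple n c a b 1)" using z1s by (simp add: normal_tuple_def)
      show "fst (z 1) = fst (normal_tuple n c a b 1)"
      proof
        fix k
        show "fst (z 1) k = fst (normal_tuple n c a b 1) k"
        proof (cases "1 \<le> k \<and> k \<le> n")
          case True
          then show ?thesis using z1[of k] by (cases "k = 1") (auto simp: normal_tuple_def a_def b_def)
        next
          case False
          then show ?thesis using sp_fst_range[OF zc[of 1], of k] n by (auto simp: normal_tuple_def)
        qed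
      qed
    qed
    moreover have "\<gamma> (z 1) = z 1"
      using zc[of 1] n z1s by (auto simp: \<gamma>_def prod_eq_iff evenperm_id)
    ultimately show ?thesis using True by simp
  next
    case False
    then have i2: "2 \<le> i" using i by simp
    have s: "snd (z i) = transpose (i - 1) i" using zs[OF i] ys[OF i2 i(2)] by simp
    have odd: "\<not> evenperm (transpose (i - 1) i)" using evenperm_swap[of "i - 1" i] i2 by simp
    have "fst (\<gamma> (z i)) k = (c \<and> k = i)" for k
    proof (cases "1 \<le> k \<and> k \<le> n")
      case True
      then show ?thesis using z[OF i2 i(2), of k] zc[OF i] s odd by (auto simp: \<gamma>_def)
    next
      case False
      then have "\<not> fst (z i) k" using sp_fst_range[OF zc[OF i]] by blast
      then show ?thesis using False zc[OF i] i by (auto simp: \<gamma>_def)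
    qed
    moreover have "snd (\<gamma> (z i)) = snd (z i)" using zc[OF i] by (simp add: \<gamma>_def)
    ultimately show ?thesis using s i2 by (auto simp: normal_tuple_def prod_eq_iff fun_eq_iff)
  qed
  show thesis
  proof (rule that)
    show "compose (carrier ?S) \<gamma> (compose (carrier ?S) \<beta> \<alpha>) \<in> auto ?S"
      by (intro compose_auto \<gamma> \<beta>(1) \<alpha>(1))
    show "compose (carrier ?S) \<gamma> (compose (carrier ?S) \<beta> \<alpha>) (x i) = normal_tuple n c a b i" if "1 \<le> i" "i \<le> n" for i
      using fin[OF that] xc[OF that] by (simp add: compose_eq z_def y_def)
  qed
qed

section \<open>Transfer along isomorphisms\<close>

lemma hom_image_set_mult:
  assumes h: "h \<in> hom G H" and XY: "X \<subseteq> carrier G" "Y \<subseteq> carrier G"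
  shows "h ` (X <#>\<^bsub>G\<^esub> Y) = h ` X <#>\<^bsub>H\<^esub> h ` Y"
proof -
  have m: "h (x \<otimes>\<^bsub>G\<^esub> y) = h x \<otimes>\<^bsub>H\<^esub> h y" if "x \<in> X" "y \<in> Y" for x y
    using hom_mult[OF h] XY that by blast
  show ?thesis
  proof
    show "h ` (X <#>\<^bsub>G\<^esub> Y) \<subseteq> h ` X <#>\<^bsub>H\<^esub> h ` Y"
      unfolding set_mult_def using m by fastforce
    show "h ` X <#>\<^bsub>H\<^esub> h ` Y \<subseteq> h ` (X <#>\<^bsub>G\<^esub> Y)"
    proof
      fix z assume "z \<in> h ` X <#>\<^bsub>H\<^esub> h ` Y"
      then obtain x y where xy: "x \<in> X" "y \<in> Y" "z = h x \<otimes>\<^bsub>H\<^esub> h y" by (auto simp: set_mult_def)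
      then have "x \<otimes>\<^bsub>G\<^esub> y \<in> X <#>\<^bsub>G\<^esub> Y" by (auto simp: set_mult_def)
      then show "z \<in> h ` (X <#>\<^bsub>G\<^esub> Y)" using xy(3) m[OF xy(1,2)] by (metis image_eqI)
    qed
  qed
qed

lemma center_closed: "center G \<subseteq> carrier G"
  by (auto simp: center_def)

lemma isoD:
  assumes "h \<in> iso G H"
  shows "h \<in> hom G H" "inj_on h (carrier G)" "h ` carrier G = carrier H"
  using assms by (auto simp: iso_def bij_betw_def)

lemma iso_image_center:
  assumes "group G" and h: "h \<in> iso G H"
  shows "h ` center G = center H"
proof -
  interpret group G by (fact assms(1))
  note hom = isoD(1)[OF h] and inj = isoD(2)[OF h] and surj = isoD(3)[OF h]
  have m: "h (x \<otimes>\<^bsub>G\<^esub> y) = h x \<otimes>\<^bsub>H\<^esub> h y" if "x \<in> carrier G" "y \<in> carrier G" for x y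
    using hom that by (auto simp: hom_def)
  have iff: "h z \<in> center H \<longleftrightarrow> z \<in> center G" if z: "z \<in> carrier G" for z
  proof -
    have "h z \<in> center H \<longleftrightarrow> (\<forall>g\<in>carrier G. h z \<otimes>\<^bsub>H\<^esub> h g = h g \<otimes>\<^bsub>H\<^esub> h z)"
      using z unfolding center_def surj[symmetric] by (simp add: image_eqI)
    also have "\<dots> \<longleftrightarrow> (\<forall>g\<in>carrier G. h (z \<otimes>\<^bsub>G\<^esub> g) = h (g \<otimes>\<^bsub>G\<^esub> z))" using m z by simp
    also have "\<dots> \<longleftrightarrow> (\<forall>g\<in>carrier G. z \<otimes>\<^bsub>G\<^esub> g = g \<otimes>\<^bsub>G\<^esub> z)"
      using inj_on_eq_iff[OF inj] z by simp
    finally show ?thesis using z by (simp add: center_def)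
  qed
  show ?thesis
  proof
    show "h ` center G \<subseteq> center H"
    proof
      fix y assume "y \<in> h ` center G"
      then obtain z where z: "z \<in> center G" "y = h z" by blast
      have "z \<in> carrier G" using z(1) by (rule subsetD[OF center_closed])
      then show "y \<in> center H" using iff z by simp
    qed
    show "center H \<subseteq> h ` center G"
    proof
      fix y assume y: "y \<in> center H"
      have "y \<in> h ` carrier G" unfolding surj using y by (rule subsetD[OF center_closed])
      then obtain x where x: "x \<in> carrier G" "y = h x" by blast
      then have "x \<in> center G" using iff y by simp
      then show "y \<in> h ` center G" using x(2) by simp
    qed
  qed
qed

lemma up_to_center_iso_iff:
  assumes "group H" and h: "h \<in> iso H H'" and X: "X \<subseteq> carrier H"
  shows "carrier H = X <#>\<^bsub>H\<^esub> center H \<longleftrightarrow> carrier H' = h ` X <#>\<^bsub>H'\<^esub> center H'"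
    and "X = carrier H \<longleftrightarrow> h ` X = carrier H'"
proof -
  interpret group H by (fact assms(1))
  note inj = isoD(2)[OF h] and surj = isoD(3)[OF h]
  have "X <#>\<^bsub>H\<^esub> center H \<subseteq> carrier H" by (rule set_mult_closed[OF X center_closed])
  then have "carrier H = X <#>\<^bsub>H\<^esub> center H \<longleftrightarrow> h ` carrier H = h ` (X <#>\<^bsub>H\<^esub> center H)"
    by (metis inj inj_on_image_eq_iff order_refl)
  also have "h ` (X <#>\<^bsub>H\<^esub> center H) = h ` X <#>\<^bsub>H'\<^esub> center H'"
    unfolding hom_image_set_mult[OF isoD(1)[OF h] X center_closed] iso_image_center[OF assms(1) h] ..
  finally show "carrier H = X <#>\<^bsub>H\<^esub> center H \<longleftrightarrow> carrier H' = h ` X <#>\<^bsub>H'\<^esub> center H'"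
    unfolding surj .
  show "X = carrier H \<longleftrightarrow> h ` X = carrier H'"
    unfolding surj[symmetric] using inj_on_image_eq_iff[OF inj X order_refl] by simp
qed

lemma proper_up_to_center_epi_iff:
  "f \<in> proper_up_to_center_epi G H \<longleftrightarrow> f \<in> hom G H \<inter> extensional (carrier G) \<and>
    carrier H = f ` carrier G <#>\<^bsub>H\<^esub> center H \<and> f ` carrier G \<noteq> carrier H"
  by (auto simp: proper_up_to_center_epi_def up_to_center_epi_def epi_def)

lemma auto_iso: "\<alpha> \<in> auto G \<Longrightarrow> \<alpha> \<in> iso G G"
  using autoD by (auto simp: iso_def)

lemma proper_up_to_center_epi_compose:
  assumes "group G" "group H" and f: "f \<in> proper_up_to_center_epi G H" and \<alpha>: "\<alpha> \<in> auto H"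
  shows "compose (carrier G) \<alpha> f \<in> proper_up_to_center_epi G H"
proof -
  interpret group G by (fact assms(1))
  have f1: "f \<in> hom G H" using f by (simp add: proper_up_to_center_epi_iff)
  note f' = f1 hom_carrier[OF f1]
  have img: "compose (carrier G) \<alpha> f ` carrier G = \<alpha> ` f ` carrier G" by (auto simp: compose_def)
  note iff = up_to_center_iso_iff[OF assms(2) auto_iso[OF \<alpha>] f'(2)]
  have "compose (carrier G) \<alpha> f \<in> hom G H" by (rule hom_compose[OF f1 autoD(1)[OF \<alpha>]])
  moreover have "carrier H = f ` carrier G <#>\<^bsub>H\<^esub> center H" "f ` carrier G \<noteq> carrier H"
    using f unfolding proper_up_to_center_epi_iff by blast+
  ultimately show ?thesis
    using iffD1[OF iff(1)] iffD2[OF iff(2)] compose_extensional[of "carrier G" \<alpha> f]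
    unfolding proper_up_to_center_epi_iff img by blast
qed

lemma equiv_hom_equivalence:
  assumes G: "group G" and H: "group H"
  shows "equiv (hom G H \<inter> extensional (carrier G)) (hom_equivalence G H)"
proof (rule equivI)
  interpret G: group G by (fact G)
  interpret H: group H by (fact H)
  let ?A = "hom G H \<inter> extensional (carrier G)"
  have cl: "f a \<in> carrier H" if "f \<in> ?A" "a \<in> carrier G" for f a
    using that by (auto simp: hom_def)
  show "hom_equivalence G H \<subseteq> ?A \<times> ?A" by (auto simp: hom_equivalence_def)
  show "refl_on ?A (hom_equivalence G H)"
  proof (rule refl_onI)
    fix f assume f: "f \<in> ?A"
    have "f = compose (carrier G) (\<lambda>x\<in>carrier H. x) f"
      using f cl[OF f] by (auto simp: compose_def extensional_def fun_eq_iff)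
    then show "(f, f) \<in> hom_equivalence G H" using f H.id_in_auto by (auto simp: hom_equivalence_def)
  qed
  show "sym (hom_equivalence G H)"
  proof (rule symI)
    fix f g assume "(f, g) \<in> hom_equivalence G H"
    then obtain \<alpha> where fg: "f \<in> ?A" "g \<in> ?A" "\<alpha> \<in> auto H" "g = compose (carrier G) \<alpha> f"
      by (auto simp: hom_equivalence_def)
    obtain \<beta> where \<beta>: "\<beta> \<in> auto H" "\<And>x. x \<in> carrier H \<Longrightarrow> \<beta> (\<alpha> x) = x" using H.inv_auto[OF fg(3)] by blast
    have "f = compose (carrier G) \<beta> g"
      using fg(1) cl[OF fg(1)] \<beta>(2) by (auto simp: fg(4) compose_def extensional_def fun_eq_iff)
    then show "(g, f) \<in> hom_equivalence G H" using fg \<beta>(1) unfolding hom_equivalence_def by blast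
  qed
  show "trans (hom_equivalence G H)"
  proof (rule transI)
    fix f g k assume "(f, g) \<in> hom_equivalence G H" "(g, k) \<in> hom_equivalence G H"
    then obtain \<alpha> \<beta> where fg: "f \<in> ?A" "g = compose (carrier G) \<alpha> f" "\<alpha> \<in> auto H"
      and gk: "k \<in> ?A" "k = compose (carrier G) \<beta> g" "\<beta> \<in> auto H"
      unfolding hom_equivalence_def by blast
    have "k = compose (carrier G) (compose (carrier H) \<beta> \<alpha>) f"
      using cl[OF fg(1)] unfolding gk(2) fg(2) by (auto simp: compose_def fun_eq_iff)
    then show "(f, k) \<in> hom_equivalence G H"
      using fg gk H.compose_auto[OF gk(3) fg(3)] unfolding hom_equivalence_def by blast
  qed
qed

text \<open>The automorphism is \<open>\<alpha>\<close> conjugated by \<open>h\<close>, restricted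
  to the carrier because \<open>auto\<close> asks for extensional functions.\<close>

lemma auto_pullback:
  assumes "group G" and h: "h \<in> iso G H" and \<alpha>: "\<alpha> \<in> auto H"
  obtains \<beta> where "\<beta> \<in> auto G" "\<And>x. x \<in> carrier G \<Longrightarrow> h (\<beta> x) = \<alpha> (h x)"
proof -
  interpret group G by (fact assms(1))
  let ?k = "inv_into (carrier G) h"
  have k: "?k \<in> iso H G" by (rule iso_set_sym[OF h])
  have hk: "h (?k y) = y" "?k y \<in> carrier G" if "y \<in> carrier H" for y
    using that isoD(3)[OF h] by (auto simp: f_inv_into_f inv_into_into)
  have hc: "h x \<in> carrier H" if "x \<in> carrier G" for x using that isoD(3)[OF h] by blast
  have "?k \<circ> (\<alpha> \<circ> h) \<in> iso G G"
    by (intro iso_set_trans[OF _ k] iso_set_trans[OF h] auto_iso \<alpha>)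
  then have "?k \<circ> (\<alpha> \<circ> h) \<in> hom G G" "bij_betw (?k \<circ> (\<alpha> \<circ> h)) (carrier G) (carrier G)"
    by (auto simp: iso_def)
  moreover from this(1) have "restrict (?k \<circ> (\<alpha> \<circ> h)) (carrier G) \<in> hom G G"
    by (rule hom_restrict) simp
  ultimately have "restrict (?k \<circ> (\<alpha> \<circ> h)) (carrier G) \<in> auto G"
    by (simp add: auto_def Bij_def bij_betw_restrict_eq)
  moreover have "h (restrict (?k \<circ> (\<alpha> \<circ> h)) (carrier G) x) = \<alpha> (h x)" if "x \<in> carrier G" for x
    using that hk hc auto_closed[OF \<alpha>] by simp
  ultimately show thesis using that by blast
qed

section \<open>The normal tuples\<close>

lemma normal_tuple_1: "normal_tuple n c a b 1 = (\<lambda>k. 1 \<le> k \<and> k \<le> n \<and> b \<noteq> (a \<and> k = 1), id)"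
  by (simp add: normal_tuple_def)

lemma normal_tuple_ge_2: "2 \<le> i \<Longrightarrow> normal_tuple n c a b i = (\<lambda>k. c \<and> k = i, transpose (i - 1) i)"
  by (simp add: normal_tuple_def)

lemma normal_tuple_closed: "1 \<le> i \<Longrightarrow> i \<le> n \<Longrightarrow> normal_tuple n c a b i \<in> carrier (signed_perms n)"
  using transpose_permutes[of "i - 1" n i] by (auto simp: normal_tuple_def permutes_id)

lemma B_tuple_normal_tuple: "B_tuple (signed_perms n) n (normal_tuple n c a b)"
  unfolding B_tuple_def
proof (intro conjI allI impI)
  let ?x = "normal_tuple n c a b" and ?S = "signed_perms n"
  show "?x i \<in> carrier ?S" if "1 \<le> i" "i \<le> n" for i using normal_tuple_closed that .
  have "transpose 1 (2::nat) \<circ> transpose 1 2 = id" by simp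
  then show "?x 1 \<otimes>\<^bsub>?S\<^esub> (?x 2 \<otimes>\<^bsub>?S\<^esub> (?x 1 \<otimes>\<^bsub>?S\<^esub> ?x 2)) = ?x 2 \<otimes>\<^bsub>?S\<^esub> (?x 1 \<otimes>\<^bsub>?S\<^esub> (?x 2 \<otimes>\<^bsub>?S\<^esub> ?x 1))"
    unfolding normal_tuple_1 normal_tuple_ge_2[OF order_refl]
    by (simp only: sp_mult) (auto simp: fun_eq_iff)
next
  let ?x = "normal_tuple n c a b" and ?S = "signed_perms n"
  fix i :: nat assume i: "2 \<le> i"
  have g: "?x i = (\<lambda>k. c \<and> k = i, transpose (i - 1) i)" "?x (Suc i) = (\<lambda>k. c \<and> k = Suc i, transpose i (Suc i))"
    using i normal_tuple_ge_2[of i] normal_tuple_ge_2[of "Suc i"] by auto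
  have d: "i - 1 \<noteq> i" "i \<noteq> Suc i" "i - 1 \<noteq> Suc i" using i by auto
  have "((c \<and> k = i) \<noteq> (c \<and> transpose (i - 1) i k = Suc i)) \<noteq> (c \<and> transpose i (Suc i) (transpose (i - 1) i k) = i) \<longleftrightarrow>
      ((c \<and> k = Suc i) \<noteq> (c \<and> transpose i (Suc i) k = i)) \<noteq> (c \<and> transpose (i - 1) i (transpose i (Suc i) k) = Suc i)" for k
  proof -
    consider "k = i - 1" | "k = i" | "k = Suc i" | "k \<noteq> i - 1" "k \<noteq> i" "k \<noteq> Suc i" by blast
    then show ?thesis
      by cases (use d in \<open>simp_all add: transpose_apply_other\<close>)
  qed
  then show "?x i \<otimes>\<^bsub>?S\<^esub> (?x (Suc i) \<otimes>\<^bsub>?S\<^esub> ?x i) = ?x (Suc i) \<otimes>\<^bsub>?S\<^esub> (?x i \<otimes>\<^bsub>?S\<^esub> ?x (Suc i))"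
    unfolding g sp_mult transpose_braid[OF d] prod.inject fun_eq_iff by simp
next
  let ?x = "normal_tuple n c a b" and ?S = "signed_perms n"
  fix i j :: nat assume ij: "1 \<le> i" "i + 2 \<le> j" "j \<le> n"
  have j: "?x j = (\<lambda>k. c \<and> k = j, transpose (j - 1) j)" using ij by (simp add: normal_tuple_ge_2)
  show "?x i \<otimes>\<^bsub>?S\<^esub> ?x j = ?x j \<otimes>\<^bsub>?S\<^esub> ?x i"
  proof (cases "i = 1")
    case True
    have "1 \<le> transpose (j - 1) j k \<and> transpose (j - 1) j k \<le> n \<longleftrightarrow> 1 \<le> k \<and> k \<le> n" for k
      by (rule permutes_range[OF transpose_permutes]) (use ij True in auto)
    moreover have "transpose (j - 1) j k = 1 \<longleftrightarrow> k = 1" for k using ij True by (auto simp: transpose_def)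
    ultimately show ?thesis unfolding j True normal_tuple_1 sp_mult by (auto simp: fun_eq_iff)
  next
    case False
    then have i: "?x i = (\<lambda>k. c \<and> k = i, transpose (i - 1) i)" using ij by (simp add: normal_tuple_ge_2)
    have d: "i - 1 \<noteq> j - 1" "i - 1 \<noteq> j" "i \<noteq> j - 1" "i \<noteq> j" using ij by auto
    have "transpose (j - 1) j k = i \<longleftrightarrow> k = i" "transpose (i - 1) i k = j \<longleftrightarrow> k = j" for k
      using d by (auto simp: transpose_def)
    then show ?thesis unfolding i j sp_mult transpose_disjoint[OF d] by (auto simp: fun_eq_iff)
  qed
qed

section \<open>Subgroups of the group of signed permutations\<close>

lemma w0_in_center: "(\<lambda>i. 1 \<le> i \<and> i \<le> n, id) \<in> center (signed_perms n)"
proof -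
  have "(\<lambda>i. 1 \<le> i \<and> i \<le> n, id) \<otimes>\<^bsub>signed_perms n\<^esub> (v, p) = (v, p) \<otimes>\<^bsub>signed_perms n\<^esub> (\<lambda>i. 1 \<le> i \<and> i \<le> n, id)"
    if "(v, p) \<in> carrier (signed_perms n)" for v p
  proof -
    have p: "p permutes {1..n}" using that by simp
    show ?thesis using permutes_range[OF p] by (auto simp: fun_eq_iff)
  qed
  note comm = this
  have "(\<lambda>i. 1 \<le> i \<and> i \<le> n, id) \<in> carrier (signed_perms n)" by (simp add: permutes_id)
  then show ?thesis
    unfolding center_def
  proof (intro CollectI conjI ballI)
    fix g assume g: "g \<in> carrier (signed_perms n)"
    obtain v p where vp: "g = (v, p)" by fastforce
    show "(\<lambda>i. 1 \<le> i \<and> i \<le> n, id) \<otimes>\<^bsub>signed_perms n\<^esub> g = g \<otimes>\<^bsub>signed_perms n\<^esub> (\<lambda>i. 1 \<le> i \<and> i \<le> n, id)"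
      using comm[of v p] g unfolding vp .
  qed
qed

lemma center_signed_perms:
  assumes z: "z \<in> center (signed_perms n)" and q: "q permutes {1..n}"
  shows "snd z \<circ> q = q \<circ> snd z" "fst z (q i) = fst z i"
proof -
  have "(\<lambda>_. False, q) \<in> carrier (signed_perms n)" using q by simp
  then have e: "z \<otimes>\<^bsub>signed_perms n\<^esub> (\<lambda>_. False, q) = (\<lambda>_. False, q) \<otimes>\<^bsub>signed_perms n\<^esub> z"
    using z unfolding center_def by blast
  show "snd z \<circ> q = q \<circ> snd z" using arg_cong[where f = snd, OF e] by (simp add: snd_sp_mult)
  show "fst z (q i) = fst z i" using arg_cong[where f = "\<lambda>g. fst g i", OF e] by (simp add: fst_sp_mult)
qed

text \<open>These elements are the permutations and their multiples by \<open>w\<^sub>0\<close>. The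
  subgroup contains the center and obstructs the two normal tuples in which \<open>c\<close> and
  \<open>a\<close> are both false.\<close>

lemma subgroup_constant_signs:
  "subgroup {x \<in> carrier (signed_perms n). \<forall>j\<in>{1..n}. fst x j = fst x 1} (signed_perms n)" (is "subgroup ?K ?S")
proof -
  interpret group ?S by (rule group_signed_perms)
  have fst_mult: "fst (x \<otimes>\<^bsub>?S\<^esub> y) j = (fst y j \<noteq> fst x 1)"
    if "x \<in> ?K" "y \<in> carrier ?S" "j \<in> {1..n}" for x y j
  proof -
    have "snd y j \<in> {1..n}" using permutes_in_image[OF sp_permutes[OF that(2)]] that(3) by blast
    then show ?thesis using that(1) unfolding fst_sp_mult by blast
  qed
  show ?thesis
  proof
    fix x y assume x: "x \<in> ?K" and y: "y \<in> ?K"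
    have xy: "x \<in> carrier ?S" "y \<in> carrier ?S" using x y by blast+
    have "fst (x \<otimes>\<^bsub>?S\<^esub> y) j = fst (x \<otimes>\<^bsub>?S\<^esub> y) 1" if j: "j \<in> {1..n}" for j
    proof -
      have "1 \<in> {1..n}" using j by auto
      moreover have "fst y j = fst y 1" using y j by blast
      ultimately show ?thesis using fst_mult[OF x xy(2)] j by metis
    qed
    then show "x \<otimes>\<^bsub>?S\<^esub> y \<in> ?K" using xy by blast
  next
    fix x assume x: "x \<in> ?K"
    have xc: "x \<in> carrier ?S" using x by blast
    have "fst (inv\<^bsub>?S\<^esub> x) j = fst x 1" if j: "j \<in> {1..n}" for j
    proof -
      have "x \<otimes>\<^bsub>?S\<^esub> inv\<^bsub>?S\<^esub> x = \<one>\<^bsub>?S\<^esub>" using xc by (rule r_inv)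
      then have "fst (x \<otimes>\<^bsub>?S\<^esub> inv\<^bsub>?S\<^esub> x) j = False" by simp
      then show ?thesis using fst_mult[OF x inv_closed[OF xc] j] by simp
    qed
    then show "inv\<^bsub>?S\<^esub> x \<in> ?K" using inv_closed[OF xc] by auto
  qed (auto simp: permutes_id)
qed

text \<open>The preimage of a centralizer in the symmetric group; through it, commutation passes
  from generators to the group they generate.\<close>

lemma subgroup_perm_centralizer:
  "subgroup {x \<in> carrier (signed_perms n). \<forall>q\<in>T. snd x \<circ> q = q \<circ> snd x} (signed_perms n)" (is "subgroup ?K ?S")
proof -
  interpret group ?S by (rule group_signed_perms)
  show ?thesis
  proof
    fix x y assume x: "x \<in> ?K" and y: "y \<in> ?K"
    have "snd (x \<otimes>\<^bsub>?S\<^esub> y) \<circ> q = q \<circ> snd (x \<otimes>\<^bsub>?S\<^esub> y)" if "q \<in> T" for q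
    proof -
      have "snd x \<circ> q = q \<circ> snd x" "snd y \<circ> q = q \<circ> snd y" using x y that by blast+
      then show ?thesis unfolding snd_sp_mult by (metis comp_assoc)
    qed
    moreover have "x \<otimes>\<^bsub>?S\<^esub> y \<in> carrier ?S" using x y by blast
    ultimately show "x \<otimes>\<^bsub>?S\<^esub> y \<in> ?K" by blast
  next
    fix x assume x: "x \<in> ?K"
    have xc: "x \<in> carrier ?S" "inv\<^bsub>?S\<^esub> x \<in> carrier ?S" using x by auto
    have i: "snd x \<circ> snd (inv\<^bsub>?S\<^esub> x) = id" "snd (inv\<^bsub>?S\<^esub> x) \<circ> snd x = id"
      using r_inv[OF xc(1)] l_inv[OF xc(1)] by (metis snd_sp_mult sp_one snd_conv)+
    have "snd (inv\<^bsub>?S\<^esub> x) \<circ> q = q \<circ> snd (inv\<^bsub>?S\<^esub> x)" if "q \<in> T" for q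
    proof -
      have "snd x \<circ> q = q \<circ> snd x" using x that by blast
      then show ?thesis using i by (metis comp_assoc comp_id id_comp)
    qed
    then show "inv\<^bsub>?S\<^esub> x \<in> ?K" using xc(2) by blast
  qed auto
qed

text \<open>Two linear characters of W: the product of all signs, and the same multiplied by the
  sign of the permutation. They serve to show that images are proper subgroups.\<close>

definition sign_character :: "nat \<Rightarrow> bool \<Rightarrow> (nat \<Rightarrow> bool) \<times> (nat \<Rightarrow> nat) \<Rightarrow> int" where
  "sign_character n c x = (\<Prod>i=1..n. if fst x i then - 1 else 1) * (if c then sign (snd x) else 1)"

lemma sign_character_mult:
  assumes "x \<in> carrier (signed_perms n)" "y \<in> carrier (signed_perms n)"
  shows "sign_character n c (x \<otimes>\<^bsub>signed_perms n\<^esub> y) = sign_character n c x * sign_character n c y"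
proof -
  have p: "snd x permutes {1..n}" "snd y permutes {1..n}" using sp_permutes[OF assms(1)] sp_permutes[OF assms(2)] .
  have "(\<Prod>i=1..n. if fst (x \<otimes>\<^bsub>signed_perms n\<^esub> y) i then - 1 else 1 :: int) =
      (\<Prod>i=1..n. (if fst y i then - 1 else 1) * (if fst x (snd y i) then - 1 else 1))"
    by (rule prod.cong) (auto simp: fst_sp_mult)
  also have "\<dots> = (\<Prod>i=1..n. if fst y i then - 1 else 1) * (\<Prod>i=1..n. if fst x (snd y i) then - 1 else 1)"
    by (rule prod.distrib)
  also have "(\<Prod>i=1..n. if fst x (snd y i) then - 1 else 1 :: int) = (\<Prod>i=1..n. if fst x i then - 1 else 1)"
    using prod.permute[OF p(2), of "\<lambda>i. if fst x i then - 1 else 1 :: int"] by (simp add: comp_def)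
  finally have 1: "(\<Prod>i=1..n. if fst (x \<otimes>\<^bsub>signed_perms n\<^esub> y) i then - 1 else 1 :: int) =
      (\<Prod>i=1..n. if fst y i then - 1 else 1) * (\<Prod>i=1..n. if fst x i then - 1 else 1)" .
  have "permutation (snd x)" "permutation (snd y)" using p permutation_permutes by blast+
  then have "sign (snd x \<circ> snd y) = sign (snd x) * sign (snd y)" by (rule sign_compose)
  then show ?thesis unfolding sign_character_def 1 snd_sp_mult by simp
qed

lemma subgroup_sign_character:
  "subgroup {x \<in> carrier (signed_perms n). sign_character n c x = 1} (signed_perms n)" (is "subgroup ?K ?S")
proof -
  interpret group ?S by (rule group_signed_perms)
  have one: "sign_character n c \<one>\<^bsub>?S\<^esub> = 1" by (simp add: sign_character_def)
  show ?thesis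
  proof
    show "\<one>\<^bsub>?S\<^esub> \<in> ?K" using one one_closed by blast
    show "x \<otimes>\<^bsub>?S\<^esub> y \<in> ?K" if "x \<in> ?K" "y \<in> ?K" for x y
      using that sign_character_mult[of x n y c] m_closed[of x y] by simp
    fix x assume x: "x \<in> ?K"
    have xc: "x \<in> carrier ?S" using x by blast
    have "sign_character n c x * sign_character n c (inv\<^bsub>?S\<^esub> x) = 1"
      using sign_character_mult[OF xc inv_closed[OF xc], of c] one r_inv[OF xc] by metis
    then show "inv\<^bsub>?S\<^esub> x \<in> ?K" using x inv_closed[OF xc] by simp
  qed blast
qed

lemma sign_character_w0: "odd n \<Longrightarrow> sign_character n c (\<lambda>i. 1 \<le> i \<and> i \<le> n, id) = - 1"
proof -
  assume n: "odd n"
  have "(\<Prod>i=1..n. if 1 \<le> i \<and> i \<le> n then - 1 else 1 :: int) = (\<Prod>i=1..n. - 1)" by (rule prod.cong) auto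
  also have "\<dots> = - 1" using n by simp
  finally show ?thesis by (simp add: sign_character_def)
qed

lemma sign_character_single:
  assumes "1 \<le> j" "j \<le> n"
  shows "(\<Prod>i=1..n. if i = (j::nat) then - 1 else 1 :: int) = - 1"
  using assms prod.delta[of "{1..n}" j "\<lambda>_. - 1 :: int"] by simp

text \<open>The square of a signed transposition changes the signs at \<open>i - 1\<close> and
  \<open>i\<close>. As \<open>n\<close> is odd, the pairs {2, 3}, {4, 5}, ... exhaust all positions
  but 1, so together with \<open>w\<^sub>0\<close> they give the sign change at 1. From the sign
  change at \<open>i - 1\<close>, the next signed transposition yields the plain one and the sign
  change at \<open>i\<close>.\<close>

lemma subgroup_eq_if_signed_transpositions:
  assumes K: "subgroup K (signed_perms n)" and n: "odd n"
    and b: "\<And>i. 2 \<le> i \<Longrightarrow> i \<le> n \<Longrightarrow> (\<lambda>k. k = i, transpose (i - 1) i) \<in> K"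
    and f: "(\<lambda>k. k = 1, id) \<in> K \<or> (\<lambda>k. 1 \<le> k \<and> k \<le> n, id) \<in> K"
  shows "K = carrier (signed_perms n)"
proof -
  have m: "(\<lambda>i. w i \<noteq> v (q i), p \<circ> q) \<in> K" if "(v, p) \<in> K" "(w, q) \<in> K" for v p w q
    using subgroup.m_closed[OF K that] by simp
  have flip1: "(\<lambda>k. k = 1, id) \<in> K"
  proof (cases "(\<lambda>k. k = 1, id) \<in> K")
    case False
    then have w: "(\<lambda>k. 1 \<le> k \<and> k \<le> n, id) \<in> K" using f by blast
    have pairs: "(\<lambda>k. k = i - 1 \<or> k = i, id) \<in> K" if i: "2 \<le> i" "i \<le> n" for i
    proof -
      have "(\<lambda>k. (k = i) \<noteq> (transpose (i - 1) i k = i)) = (\<lambda>k. k = i - 1 \<or> k = i)"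
        using i by (auto simp: transpose_def fun_eq_iff)
      then show ?thesis using m[OF b[OF i] b[OF i]] by simp
    qed
    have one: "(\<lambda>_. False, id) \<in> K" using subgroup.one_closed[OF K] by simp
    have tail: "2 * j + 1 \<le> n \<longrightarrow> (\<lambda>k. 2 \<le> k \<and> k \<le> 2 * j + 1, id) \<in> K" for j
    proof (induction j)
      case 0
      have "(\<lambda>k::nat. 2 \<le> k \<and> k \<le> 2 * 0 + 1) = (\<lambda>_. False)" by auto
      then show ?case using one by metis
    next
      case (Suc j)
      show ?case
      proof
        assume n: "2 * Suc j + 1 \<le> n"
        then have "2 * j + 1 \<le> n" by simp
        then have "(\<lambda>k. 2 \<le> k \<and> k \<le> 2 * j + 1, id) \<in> K" using Suc by blast
        moreover have "(\<lambda>k. k = 2 * j + 3 - 1 \<or> k = 2 * j + 3, id) \<in> K" using pairs[of "2 * j + 3"] n by simp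
        ultimately have "(\<lambda>k. (k = 2 * j + 3 - 1 \<or> k = 2 * j + 3) \<noteq> (2 \<le> id k \<and> id k \<le> 2 * j + 1), id \<circ> id) \<in> K"
          by (rule m)
        moreover have "(\<lambda>k. (k = 2 * j + 3 - 1 \<or> k = 2 * j + 3) \<noteq> (2 \<le> id k \<and> id k \<le> 2 * j + 1)) =
            (\<lambda>k. 2 \<le> k \<and> k \<le> 2 * Suc j + 1)"
          by (auto simp: fun_eq_iff)
        ultimately show "(\<lambda>k. 2 \<le> k \<and> k \<le> 2 * Suc j + 1, id) \<in> K" by (metis comp_id)
      qed
    qed
    obtain j where j: "n = 2 * j + 1" using n by (rule oddE)
    then have "(\<lambda>k. 2 \<le> k \<and> k \<le> n, id) \<in> K" using tail[of j] by simp
    from m[OF this w] have "(\<lambda>k. (1 \<le> k \<and> k \<le> n) \<noteq> (2 \<le> id k \<and> id k \<le> n), id \<circ> id) \<in> K" .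
    moreover have "(\<lambda>k. (1 \<le> k \<and> k \<le> n) \<noteq> (2 \<le> id k \<and> id k \<le> n)) = (\<lambda>k. k = 1)"
      using j by (auto simp: fun_eq_iff)
    ultimately show ?thesis by (metis comp_id)
  qed
  have next_flip: "(\<lambda>_. False, transpose (i - 1) i) \<in> K" "(\<lambda>k. k = i, id) \<in> K"
    if i: "2 \<le> i" "i \<le> n" and fi: "(\<lambda>k. k = i - 1, id) \<in> K" for i
  proof -
    have e: "(\<lambda>k. (k = i) \<noteq> (transpose (i - 1) i k = i - 1)) = (\<lambda>_. False)"
      using i by (auto simp: transpose_def fun_eq_iff)
    from m[OF fi b[OF i]] show t: "(\<lambda>_. False, transpose (i - 1) i) \<in> K" unfolding e by simp
    have e2: "(\<lambda>k. (False \<noteq> (transpose (i - 1) i k = i - 1))) = (\<lambda>k. k = i)"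
      using i by (auto simp: transpose_def fun_eq_iff)
    from m[OF fi t] have "(\<lambda>k. k = i, transpose (i - 1) i) \<in> K" unfolding e2 by simp
    from m[OF t this] show "(\<lambda>k. k = i, id) \<in> K" by simp
  qed
  have flip: "i \<le> n \<longrightarrow> (\<lambda>k. k = i, id) \<in> K" if "1 \<le> i" for i
    using that
  proof (induction i rule: dec_induct)
    case base
    show ?case using flip1 by blast
  next
    case (step i)
    show ?case
    proof
      assume n: "Suc i \<le> n"
      have "(\<lambda>k. k = Suc i - 1, id) \<in> K" using step.IH n unfolding diff_Suc_1 by (meson Suc_leD)
      then show "(\<lambda>k. k = Suc i, id) \<in> K" by (rule next_flip(2)[rotated 2]) (use step.hyps n in auto)
    qed
  qed
  show ?thesis
  proof (rule signed_perms_subgroup_eqI[OF K])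
    show "(\<lambda>_. False, transpose (i - 1) i) \<in> K" if "2 \<le> i" "i \<le> n" for i
    proof (rule next_flip(1)[OF that])
      have "1 \<le> i - 1" "i - 1 \<le> n" using that by auto
      then show "(\<lambda>k. k = i - 1, id) \<in> K" using flip by blast
    qed
  qed (rule flip1)
qed

lemma (in group) subgroup_mult_center:
  assumes K: "subgroup K G"
  shows "subgroup (K <#> center G) G"
proof -
  have c: "z \<in> carrier G" "\<And>g. g \<in> carrier G \<Longrightarrow> z \<otimes> g = g \<otimes> z" if "z \<in> center G" for z
    using that by (auto simp: center_def)
  note Kc = subgroup.mem_carrier[OF K]
  have mem: "x \<in> K <#> center G \<longleftrightarrow> (\<exists>k\<in>K. \<exists>z\<in>center G. x = k \<otimes> z)" for x
    by (auto simp: set_mult_def)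
  show ?thesis
  proof
    show "K <#> center G \<subseteq> carrier G" by (rule set_mult_closed[OF subgroup.subset[OF K] center_closed])
    have "\<one> \<in> center G" by (simp add: center_def)
    then show "\<one> \<in> K <#> center G" unfolding mem using subgroup.one_closed[OF K] by (intro bexI[of _ \<one>]) auto
    fix x y assume "x \<in> K <#> center G" "y \<in> K <#> center G"
    then obtain k z l w where *: "k \<in> K" "z \<in> center G" "x = k \<otimes> z" "l \<in> K" "w \<in> center G" "y = l \<otimes> w"
      unfolding mem by blast
    note cl = Kc[OF *(1)] Kc[OF *(4)] c(1)[OF *(2)] c(1)[OF *(5)]
    have "x \<otimes> y = k \<otimes> ((z \<otimes> l) \<otimes> w)" using cl by (simp add: *(3,6) m_assoc)
    also have "\<dots> = (k \<otimes> l) \<otimes> (z \<otimes> w)" using cl by (simp add: c(2)[OF *(2) cl(2)] m_assoc)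
    finally have "x \<otimes> y = (k \<otimes> l) \<otimes> (z \<otimes> w)" .
    moreover have "z \<otimes> w \<in> center G"
      unfolding center_def
    proof (intro CollectI conjI ballI)
      fix g assume g: "g \<in> carrier G"
      have "z \<otimes> w \<otimes> g = z \<otimes> g \<otimes> w" using cl g by (simp add: m_assoc c(2)[OF *(5) g])
      also have "\<dots> = g \<otimes> (z \<otimes> w)" using cl g by (simp add: m_assoc c(2)[OF *(2) g])
      finally show "z \<otimes> w \<otimes> g = g \<otimes> (z \<otimes> w)" .
    qed (use cl in simp)
    ultimately show "x \<otimes> y \<in> K <#> center G" unfolding mem using subgroup.m_closed[OF K *(1,4)] by blast
  next
    fix x assume "x \<in> K <#> center G"
    then obtain k z where *: "k \<in> K" "z \<in> center G" "x = k \<otimes> z" unfolding mem by blast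
    note cl = Kc[OF *(1)] c(1)[OF *(2)]
    have iz: "inv z \<in> center G"
      unfolding center_def
    proof (intro CollectI conjI ballI)
      fix g assume g: "g \<in> carrier G"
      have "inv z \<otimes> g = inv (inv g \<otimes> z)" using cl g by (simp add: inv_mult_group)
      also have "\<dots> = g \<otimes> inv z" using cl g c(2)[OF *(2), of "inv g"] by (simp add: inv_mult_group flip: c(2)[OF *(2)])
      finally show "inv z \<otimes> g = g \<otimes> inv z" .
    qed (use cl in simp)
    have "inv x = inv k \<otimes> inv z"
      using cl c(2)[OF iz, of "inv k"] by (simp add: *(3) inv_mult_group)
    then show "inv x \<in> K <#> center G" unfolding mem using iz subgroup.m_inv_closed[OF K *(1)] by blast
  qed
qed

section \<open>The theorem\<close>

lemma set_mult_center_subset: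
  assumes "subgroup K' G" "K \<subseteq> K'" "center G \<subseteq> K'"
  shows "K <#>\<^bsub>G\<^esub> center G \<subseteq> K'"
  using assms subgroup.m_closed[OF assms(1)] by (auto simp: set_mult_def)

lemma (in group) subset_mult_center:
  assumes K: "subgroup K G"
  shows "K \<subseteq> K <#> center G" "center G \<subseteq> K <#> center G"
proof -
  have one: "\<one> \<in> center G" "\<one> \<in> K" using subgroup.one_closed[OF K] by (auto simp: center_def)
  have mem: "k \<otimes> z \<in> K <#> center G" if "k \<in> K" "z \<in> center G" for k z
    using that by (auto simp: set_mult_def)
  show "K \<subseteq> K <#> center G"
    using mem[OF _ one(1)] subgroup.mem_carrier[OF K] by force
  show "center G \<subseteq> K <#> center G"
    using mem[OF one(2)] center_closed[of G] by force
qed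

text \<open>All \<open>snd (x i)\<close> with \<open>i \<ge> 2\<close> would equal
  \<open>snd (x 3)\<close>, which commutes with \<open>snd (x 1)\<close>. Two passes through
  centralizers follow: first every permutation commutes with all \<open>snd (x i)\<close>, hence
  every permutation commutes with every other. The center does no harm, because its elements have
  permutations commuting with everything.\<close>

lemma not_all_equal:
  assumes n: "3 \<le> n" and B: "B_tuple (signed_perms n) n x"
    and least: "\<And>K'. subgroup K' (signed_perms n) \<Longrightarrow> (\<And>i. i \<in> {1..n} \<Longrightarrow> x i \<in> K') \<Longrightarrow> K \<subseteq> K'"
    and K: "carrier (signed_perms n) = K <#>\<^bsub>signed_perms n\<^esub> center (signed_perms n)"
  shows "\<not> all_equal_on n {1..n} (\<lambda>i. snd (x (Suc i)))"
proof
  let ?S = "signed_perms n"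
  assume eq: "all_equal_on n {1..n} (\<lambda>i. snd (x (Suc i)))"
  have xc: "x i \<in> carrier ?S" if "i \<in> {1..n}" for i using B_tupleD(1)[OF B] that by simp
  note xp = sp_permutes[OF xc]
  have same: "snd (x i) = snd (x 3)" if i: "i \<in> {2..n}" for i
  proof
    fix k
    show "snd (x i) k = snd (x 3) k"
    proof (cases "k \<in> {1..n}")
      case True
      have "1 \<le> i - 1" "i - 1 < n" "Suc (i - 1) = i" "2 < n" using i n by auto
      then show ?thesis using all_equal_onD[OF eq, of "i - 1" 2 k] True by simp
    next
      case False
      have "i \<in> {1..n}" "3 \<in> {1..n}" using i n by auto
      then show ?thesis using permutes_not_in[OF xp False] by metis
    qed
  qed
  have comm3: "snd (x 1) \<circ> snd (x 3) = snd (x 3) \<circ> snd (x 1)"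
    using arg_cong[where f = snd, OF B_tupleD(4)[OF B, of 1 3]] n by (simp add: snd_sp_mult)
  have two: "snd (x i) = snd (x 1) \<or> snd (x i) = snd (x 3)" if "i \<in> {1..n}" for i
    using same[of i] that by (cases "i = 1") auto
  have comm: "snd (x i) \<circ> snd (x j) = snd (x j) \<circ> snd (x i)" if "i \<in> {1..n}" "j \<in> {1..n}" for i j
    using two[OF that(1)] two[OF that(2)] comm3 by metis
  define C where "C T = {y \<in> carrier ?S. \<forall>q\<in>T. snd y \<circ> q = q \<circ> snd y}" for T
  have C: "subgroup (C T) ?S" for T unfolding C_def by (rule subgroup_perm_centralizer)
  have cC: "center ?S \<subseteq> C T" if "\<And>q. q \<in> T \<Longrightarrow> q permutes {1..n}" for T
    using center_signed_perms(1) center_closed[of ?S] that unfolding C_def by blast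
  have all: "carrier ?S \<subseteq> C T" if "\<And>q. q \<in> T \<Longrightarrow> q permutes {1..n}" "\<And>i. i \<in> {1..n} \<Longrightarrow> x i \<in> C T" for T
    unfolding K by (rule set_mult_center_subset[OF C least[OF C that(2)] cC[OF that(1)]])
  have 1: "carrier ?S \<subseteq> C ((\<lambda>i. snd (x i)) ` {1..n})"
  proof (rule all)
    show "q permutes {1..n}" if "q \<in> (\<lambda>i. snd (x i)) ` {1..n}" for q using that xp by auto
    show "x i \<in> C ((\<lambda>i. snd (x i)) ` {1..n})" if "i \<in> {1..n}" for i
      using xc[OF that] comm[OF that] by (auto simp: C_def)
  qed
  have p: "(\<lambda>_. False, q) \<in> carrier ?S" if "q permutes {1..n}" for q using that by simp
  have 2: "carrier ?S \<subseteq> C {q. q permutes {1..n}}"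
  proof (rule all)
    show "x i \<in> C {q. q permutes {1..n}}" if i: "i \<in> {1..n}" for i
    proof -
      have "snd (x i) \<circ> q = q \<circ> snd (x i)" if "q permutes {1..n}" for q
        using subsetD[OF 1 p[OF that]] i by (auto simp: C_def)
      then show ?thesis using xc[OF i] by (simp add: C_def)
    qed
  qed simp
  have t: "transpose 1 2 permutes {1..n}" "transpose 2 3 permutes {1..n}"
    by (rule transpose_permutes; use n in simp)+
  have "transpose 1 2 \<circ> transpose 2 3 = transpose 2 3 \<circ> transpose 1 (2::nat)"
    using subsetD[OF 2 p[OF t(1)]] t(2) by (simp add: C_def)
  then have "(transpose 1 2 \<circ> transpose 2 3) (1::nat) = (transpose 2 3 \<circ> transpose 1 2) 1" by simp
  then show False by (simp add: transpose_def)
qed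

text \<open>\<open>gens\<close> and \<open>least\<close> identify \<open>K\<close> as the subgroup
  generated by the tuple. If \<open>a\<close> holds without \<open>b\<close>, the sign change at 1
  is in \<open>K\<close>; if \<open>c\<close> and \<open>b\<close> hold without \<open>a\<close>,
  then \<open>w\<^sub>0\<close> is, and oddness recovers the sign change. In the three cases on the
  right, \<open>K\<close> lies in the kernel of \<open>sign_character n c\<close>, and
  \<open>w\<^sub>0\<close> supplies what is missing.\<close>

lemma normal_tuple_image_iff:
  assumes n: "3 \<le> n" "odd n" and K: "subgroup K (signed_perms n)"
    and gens: "\<And>i. i \<in> {1..n} \<Longrightarrow> normal_tuple n c a b i \<in> K"
    and least: "\<And>K'. subgroup K' (signed_perms n) \<Longrightarrow>
      (\<And>i. i \<in> {1..n} \<Longrightarrow> normal_tuple n c a b i \<in> K') \<Longrightarrow> K \<subseteq> K'"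
  shows "carrier (signed_perms n) = K <#>\<^bsub>signed_perms n\<^esub> center (signed_perms n) \<and> K \<noteq> carrier (signed_perms n)
    \<longleftrightarrow> (c, a, b) \<in> {(False, True, True), (True, True, True), (True, False, False)}" (is "?L \<longleftrightarrow> ?R")
proof -
  let ?S = "signed_perms n" and ?w0 = "(\<lambda>i. 1 \<le> i \<and> i \<le> n, id :: nat \<Rightarrow> nat)" and ?f = "(\<lambda>k::nat. k = 1, id :: nat \<Rightarrow> nat)"
  interpret group ?S by (rule group_signed_perms)
  have x1: "(\<lambda>k. 1 \<le> k \<and> k \<le> n \<and> b \<noteq> (a \<and> k = 1), id) \<in> K"
    using gens[of 1] n by (simp add: normal_tuple_def)
  have x2: "(\<lambda>k. c \<and> k = i, transpose (i - 1) i) \<in> K" if "2 \<le> i" "i \<le> n" for i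
    using gens[of i] that by (simp add: normal_tuple_def)
  have f1: "(\<lambda>k. 1 \<le> k \<and> k \<le> n \<and> k = 1) = (\<lambda>k. k = 1)" using n by auto
  have not_const: False if c: "\<not> c" and a: "\<not> a" and L: ?L
  proof -
    let ?C = "{x \<in> carrier ?S. \<forall>j\<in>{1..n}. fst x j = fst x 1}"
    have C: "subgroup ?C ?S" by (rule subgroup_constant_signs)
    have "normal_tuple n c a b i \<in> ?C" if "i \<in> {1..n}" for i
      using normal_tuple_closed[of i n c a b] that c a by (auto simp: normal_tuple_def)
    then have KC: "K \<subseteq> ?C" by (rule least[OF C])
    have ZC: "center ?S \<subseteq> ?C"
    proof
      fix z assume z: "z \<in> center ?S"
      have "fst z j = fst z 1" if "j \<in> {1..n}" for j
        using center_signed_perms(2)[OF z transpose_permutes[of 1 n j], of 1] that by simp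
      moreover have "z \<in> carrier ?S" using z by (rule subsetD[OF center_closed])
      ultimately show "z \<in> ?C" by blast
    qed
    have "carrier ?S \<subseteq> ?C" using L set_mult_center_subset[OF C KC ZC] by (simp only:)
    moreover have "?f \<in> carrier ?S" using n by (simp add: permutes_id)
    ultimately have "?f \<in> ?C" by (rule subsetD)
    then have const: "\<forall>j\<in>{1..n}. fst ?f j = fst ?f 1" unfolding mem_Collect_eq by (rule conjunct2)
    have "2 \<in> {1..n}" using n by simp
    from bspec[OF const this] show False by simp
  qed
  have full: "K = carrier ?S" if "a" "\<not> b"
  proof (cases c)
    case True
    show ?thesis
      by (rule subgroup_eq_if_signed_transpositions[OF K n(2)]) (use x1 x2 that True f1 in auto)
  next
    case False
    show ?thesis
      by (rule signed_perms_subgroup_eqI[OF K]) (use x1 x2 that False f1 in auto)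
  qed
  have full': "K = carrier ?S" if "c" "\<not> a" "b"
    by (rule subgroup_eq_if_signed_transpositions[OF K n(2)]) (use x1 x2 that in auto)
  have proper: "K \<noteq> carrier ?S" if ?R
  proof -
    have "sign_character n c (normal_tuple n c a b i) = 1" if i: "i \<in> {1..n}" for i
    proof (cases "i = 1")
      case True
      have "(\<Prod>k=1..n. if 1 \<le> k \<and> k \<le> n \<and> b \<noteq> (a \<and> k = 1) then - 1 else 1 :: int) = 1"
      proof (cases a)
        case True
        then have b using \<open>?R\<close> by auto
        have "(\<Prod>k=1..n. if 1 \<le> k \<and> k \<le> n \<and> b \<noteq> (a \<and> k = 1) then - 1 else 1 :: int) =
            (\<Prod>k=1..n. - 1 * (if k = 1 then - 1 else 1))"
          by (rule prod.cong) (use True \<open>b\<close> in auto)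
        also have "\<dots> = (\<Prod>k=1..n. - 1) * (\<Prod>k=1..n. if k = 1 then - 1 else 1)" by (rule prod.distrib)
        also have "\<dots> = 1" using n sign_character_single[of 1 n] by simp
        finally show ?thesis .
      next
        case False
        then have "\<not> b" using \<open>?R\<close> by auto
        then show ?thesis using False by (intro prod.neutral) auto
      qed
      then show ?thesis using True by (simp add: sign_character_def normal_tuple_def)
    next
      case False
      have "1 \<le> i" "i \<le> n" "i - 1 \<noteq> i" using i by auto
      then have "(\<Prod>k=1..n. if k = i then - 1 else 1 :: int) = - 1" "sign (transpose (i - 1) i) = - 1"
        using sign_character_single[of i n] sign_swap_id[of "i - 1" i] by auto
      then show ?thesis using False by (auto simp: sign_character_def normal_tuple_def)
    qed
    then have sub: "K \<subseteq> {x \<in> carrier ?S. sign_character n c x = 1}"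
      using least[OF subgroup_sign_character] normal_tuple_closed by simp
    show ?thesis
    proof
      assume "K = carrier ?S"
      then have "?w0 \<in> K" using subsetD[OF center_closed w0_in_center] by blast
      then have "sign_character n c ?w0 = 1" using sub by blast
      then show False using sign_character_w0[OF n(2)] by simp
    qed
  qed
  have up: "carrier ?S = K <#>\<^bsub>?S\<^esub> center ?S" if ?R
  proof -
    let ?M = "K <#>\<^bsub>?S\<^esub> center ?S"
    have M: "subgroup ?M ?S" by (rule subgroup_mult_center[OF K])
    have w: "?w0 \<in> ?M" using subset_mult_center(2)[OF K] w0_in_center by blast
    have k: "x \<in> ?M" if "x \<in> K" for x using subset_mult_center(1)[OF K] that by blast
    \<comment> \<open>The first entry is \<open>w\<^sub>0\<close> times the sign change at 1, so
      multiplying by the central \<open>w\<^sub>0\<close> isolates the latter.\<close>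
    have f: "?f \<in> ?M" if ab: a b
    proof -
      have "?w0 \<otimes>\<^bsub>?S\<^esub> (\<lambda>k. 1 \<le> k \<and> k \<le> n \<and> b \<noteq> (a \<and> k = 1), id) \<in> ?M"
        by (rule subgroup.m_closed[OF M w k[OF x1]])
      moreover have "?w0 \<otimes>\<^bsub>?S\<^esub> (\<lambda>k. 1 \<le> k \<and> k \<le> n \<and> b \<noteq> (a \<and> k = 1), id) = ?f"
        using ab n unfolding sp_mult by (auto simp: fun_eq_iff)
      ultimately show ?thesis by simp
    qed
    show ?thesis
    proof (cases c)
      case True
      have "?M = carrier ?S"
        by (rule subgroup_eq_if_signed_transpositions[OF M n(2)]) (use k[OF x2] True w in auto)
      then show ?thesis by simp
    next
      case False
      then have ab: a b using \<open>?R\<close> by auto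
      have "?M = carrier ?S"
        by (rule signed_perms_subgroup_eqI[OF M]) (use k[OF x2] False f[OF ab] in auto)
      then show ?thesis by simp
    qed
  qed
  show ?thesis
  proof
    assume L: ?L
    have "c \<or> a" using not_const[OF _ _ L] by blast
    moreover have "\<not> (a \<and> \<not> b)" using full L by blast
    moreover have "\<not> (c \<and> \<not> a \<and> b)" using full' L by blast
    ultimately show ?R by auto
  next
    assume ?R
    then show ?L using proper up by blast
  qed
qed

theorem proposition2p4:
  fixes n :: nat
  assumes "n \<ge> 3" and "odd n"
  defines "W \<equiv> W_B n"
    and "\<sigma> \<equiv> sigma_B n" and "s \<equiv> s_B n" and "e \<equiv> e_B n" and "w\<^sub>0 \<equiv> w0_B n"
    and "P \<equiv> proper_up_to_center_epi (artin_B n) (W_B n)"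
    and "E \<equiv> hom_equivalence (artin_B n) (W_B n)"
  shows "\<exists>\<mu>' \<nu>3 \<nu>4.
    \<mu>' \<in> P \<and> \<nu>3 \<in> P \<and> \<nu>4 \<in> P \<and>
    \<mu>' (\<sigma> 1) = w\<^sub>0 \<otimes>\<^bsub>W\<^esub> s 1 \<and> (\<forall>i\<in>{2..n}. \<mu>' (\<sigma> i) = s i) \<and>
    \<nu>3 (\<sigma> 1) = w\<^sub>0 \<otimes>\<^bsub>W\<^esub> s 1 \<and> (\<forall>i\<in>{2..n}. \<nu>3 (\<sigma> i) = e (i - 1) \<otimes>\<^bsub>W\<^esub> s i) \<and>
    \<nu>4 (\<sigma> 1) = \<one>\<^bsub>W\<^esub> \<and> (\<forall>i\<in>{2..n}. \<nu>4 (\<sigma> i) = e (i - 1) \<otimes>\<^bsub>W\<^esub> s i) \<and>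
    card (P // E) = 3 \<and> P // E = {E `` {\<mu>'}, E `` {\<nu>3}, E `` {\<nu>4}}"
proof -
  let ?A = "artin_B n" and ?S = "signed_perms n"
  let ?H = "hom ?A W \<inter> extensional (carrier ?A)"
  have A: "group ?A" by (rule group_artin_group)
  have W: "group W" unfolding W_def by (rule group_coxeter_group)
  have S: "group ?S" by (rule group_signed_perms)
  have n1: "1 \<le> n" using assms(1) by simp
  interpret W: group W by (fact W)
  have P_W: "P = proper_up_to_center_epi ?A W" by (simp add: P_def W_def)
  have E_W: "E = hom_equivalence ?A W" by (simp add: E_def W_def)
  obtain \<pi> where \<pi>: "\<pi> \<in> iso W ?S" "\<And>i. i \<in> {1..n} \<Longrightarrow> \<pi> (s i) = signed_gen i"
    using W_B_iso_signed_perms[OF n1] unfolding W_def s_def by blast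
  note \<pi>_hom = isoD(1)[OF \<pi>(1)] and \<pi>_inj = isoD(2)[OF \<pi>(1)]
  have \<pi>_eq: "u = v" if "\<pi> u = \<pi> v" "u \<in> carrier W" "v \<in> carrier W" for u v
    using \<pi>_inj that by (rule inj_onD)
  have \<pi>_mult: "\<pi> (u \<otimes>\<^bsub>W\<^esub> v) = \<pi> u \<otimes>\<^bsub>?S\<^esub> \<pi> v" if "u \<in> carrier W" "v \<in> carrier W" for u v
    using hom_mult[OF \<pi>_hom that] .
  have \<sigma>: "\<sigma> i \<in> carrier ?A" if "i \<in> {1..n}" for i unfolding \<sigma>_def using that by (rule artin_gen_closed)
  have s: "s i \<in> carrier W" if "i \<in> {1..n}" for i unfolding s_def W_def using that by (rule coxeter_gen_closed)
  have w0: "w\<^sub>0 \<in> carrier W" "\<pi> w\<^sub>0 = (\<lambda>i. 1 \<le> i \<and> i \<le> n, id)"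
    using signed_perm_of_w0[OF n1, of \<pi>] \<pi> unfolding W_def s_def w\<^sub>0_def by blast+
  have e: "e i \<in> carrier W" "\<pi> (e i) = (\<lambda>j. j = i, id)" if "1 \<le> i" "i \<le> n" for i
    using signed_perm_of_e[OF _ _ that, of \<pi>] \<pi>(2) \<pi>_hom unfolding W_def s_def e_def by blast+
  have Hc: "f a \<in> carrier W" if "f \<in> ?H" "a \<in> carrier ?A" for f a
    using that by (auto simp: hom_def)
  have tuple: "B_tuple ?S n (\<lambda>i. \<pi> (f (\<sigma> i)))" if "f \<in> ?H" for f
    using B_tuple_hom[OF B_tuple_hom[OF B_tuple_artin _ A W] \<pi>_hom W S, of f] that
    unfolding \<sigma>_def by simp
  have unique: "f = g" if "f \<in> ?H" "g \<in> ?H" "\<And>i. i \<in> {1..n} \<Longrightarrow> \<pi> (f (\<sigma> i)) = \<pi> (g (\<sigma> i))" for f g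
  proof -
    have gen: "f (\<sigma> i) = g (\<sigma> i)" if "i \<in> {1..n}" for i
      using \<pi>_eq[OF _ Hc Hc] \<open>f \<in> ?H\<close> \<open>g \<in> ?H\<close> \<sigma>[OF that] \<open>\<And>i. i \<in> {1..n} \<Longrightarrow> \<pi> (f (\<sigma> i)) = \<pi> (g (\<sigma> i))\<close>[OF that] by blast
    have "f a = g a" if "a \<in> carrier ?A" for a
      using artin_group_hom_eqI[OF W, of f "{1..n}" coxeter_B g a] that gen \<open>f \<in> ?H\<close> \<open>g \<in> ?H\<close>
      unfolding \<sigma>_def by blast
    then show ?thesis using that(1,2) by (intro extensionalityI[of f "carrier ?A" g]) auto
  qed
  have ex: "\<exists>f. f \<in> ?H \<and> (\<forall>i\<in>{1..n}. \<pi> (f (\<sigma> i)) = normal_tuple n c a b i)" for c a b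
  proof -
    let ?k = "inv_into (carrier W) \<pi>"
    have "?k \<in> hom ?S W" using isoD(1)[OF W.iso_set_sym[OF \<pi>(1)]] .
    from B_tuple_hom[OF B_tuple_normal_tuple this S W]
    obtain f where f: "f \<in> ?H" "\<And>i. i \<in> {1..n} \<Longrightarrow> f (\<sigma> i) = ?k (normal_tuple n c a b i)"
      using artin_B_hom_exists[OF W, of n "\<lambda>i. ?k (normal_tuple n c a b i)"] unfolding \<sigma>_def by blast
    have "\<pi> (f (\<sigma> i)) = normal_tuple n c a b i" if i: "i \<in> {1..n}" for i
    proof -
      have "normal_tuple n c a b i \<in> \<pi> ` carrier W"
        using normal_tuple_closed[of i n c a b] i isoD(3)[OF \<pi>(1)] by simp
      then show ?thesis using f(2)[OF i] f_inv_into_f by metis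
    qed
    then show ?thesis using f(1) by blast
  qed
  \<comment> \<open>The image of the homomorphism is the least subgroup containing the images of the
    generators, which is the form that \<open>not_all_equal\<close> and
    \<open>normal_tuple_image_iff\<close> take.\<close>
  have image: "subgroup (\<pi> ` f ` carrier ?A) ?S" "\<And>i. i \<in> {1..n} \<Longrightarrow> \<pi> (f (\<sigma> i)) \<in> \<pi> ` f ` carrier ?A"
    "\<And>K'. subgroup K' ?S \<Longrightarrow> (\<And>i. i \<in> {1..n} \<Longrightarrow> \<pi> (f (\<sigma> i)) \<in> K') \<Longrightarrow> \<pi> ` f ` carrier ?A \<subseteq> K'"
    if f: "f \<in> ?H" for f
  proof -
    have h: "\<pi> \<circ> f \<in> hom ?A ?S" using hom_compose[of f ?A W \<pi> ?S] f \<pi>_hom by blast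
    show "subgroup (\<pi> ` f ` carrier ?A) ?S"
      using subgroup_hom_image[OF A S h] by (simp add: image_comp)
    show "\<pi> (f (\<sigma> i)) \<in> \<pi> ` f ` carrier ?A" if "i \<in> {1..n}" for i using \<sigma>[OF that] by blast
    fix K' assume K': "subgroup K' ?S" and gen: "\<And>i. i \<in> {1..n} \<Longrightarrow> \<pi> (f (\<sigma> i)) \<in> K'"
    have "{a \<in> carrier ?A. (\<pi> \<circ> f) a \<in> K'} = carrier ?A"
      by (rule artin_group_generated[OF subgroup_vimage[OF A S h K']])
        (use gen \<sigma> in \<open>auto simp: \<sigma>_def\<close>)
    then show "\<pi> ` f ` carrier ?A \<subseteq> K'" by auto
  qed
  have P_iff: "f \<in> P \<longleftrightarrow> f \<in> ?H \<and> carrier ?S = \<pi> ` f ` carrier ?A <#>\<^bsub>?S\<^esub> center ?S \<and> \<pi> ` f ` carrier ?A \<noteq> carrier ?S" for f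
  proof (cases "f \<in> ?H")
    case True
    then have "f ` carrier ?A \<subseteq> carrier W" using Hc by blast
    from up_to_center_iso_iff[OF W \<pi>(1) this] show ?thesis
      using True unfolding P_W proper_up_to_center_epi_iff by blast
  next
    case False
    then show ?thesis unfolding P_W proper_up_to_center_epi_iff by blast
  qed
  have P_normal: "f \<in> P \<longleftrightarrow> (c, a, b) \<in> {(False, True, True), (True, True, True), (True, False, False)}"
    if f: "f \<in> ?H" and gen: "\<And>i. i \<in> {1..n} \<Longrightarrow> \<pi> (f (\<sigma> i)) = normal_tuple n c a b i" for f c a b
    using normal_tuple_image_iff[OF assms(1,2) image(1)[OF f], of c a b] image(2,3)[OF f] f gen
    unfolding P_iff by simp
  obtain \<mu> where \<mu>: "\<mu> \<in> ?H" "\<And>i. i \<in> {1..n} \<Longrightarrow> \<pi> (\<mu> (\<sigma> i)) = normal_tuple n False True True i"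
    using ex by meson
  obtain \<nu>3 where \<nu>3: "\<nu>3 \<in> ?H" "\<And>i. i \<in> {1..n} \<Longrightarrow> \<pi> (\<nu>3 (\<sigma> i)) = normal_tuple n True True True i"
    using ex by meson
  obtain \<nu>4 where \<nu>4: "\<nu>4 \<in> ?H" "\<And>i. i \<in> {1..n} \<Longrightarrow> \<pi> (\<nu>4 (\<sigma> i)) = normal_tuple n True False False i"
    using ex by meson
  have inP: "\<mu> \<in> P" "\<nu>3 \<in> P" "\<nu>4 \<in> P"
    using P_normal[OF \<mu>] P_normal[OF \<nu>3] P_normal[OF \<nu>4] by simp_all
  have equivE: "equiv ?H E" unfolding E_W by (rule equiv_hom_equivalence[OF A W])
  \<comment> \<open>The automorphism that normalizes the tuple lives on the model and is pulled back
    along \<open>\<pi>\<close>. The property of being proper survives composition with it, and so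
    selects the three admissible triples.\<close>
  have classify: "\<exists>g\<in>{\<mu>, \<nu>3, \<nu>4}. (f, g) \<in> E" if f: "f \<in> P" for f
  proof -
    have fH: "f \<in> ?H" and up: "carrier ?S = \<pi> ` f ` carrier ?A <#>\<^bsub>?S\<^esub> center ?S"
      using f unfolding P_iff by blast+
    have ne: "\<not> all_equal_on n {1..n} (\<lambda>i. snd (\<pi> (f (\<sigma> (Suc i)))))"
      by (rule not_all_equal[OF assms(1) tuple[OF fH] image(3)[OF fH] up])
    obtain \<alpha> c a b where \<alpha>: "\<alpha> \<in> auto ?S"
      "\<And>i. 1 \<le> i \<Longrightarrow> i \<le> n \<Longrightarrow> \<alpha> (\<pi> (f (\<sigma> i))) = normal_tuple n c a b i"
      by (rule normal_tuple_exists[OF tuple[OF fH] assms(1,2) ne]) (erule that, blast)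
    obtain \<beta> where \<beta>: "\<beta> \<in> auto W" "\<And>x. x \<in> carrier W \<Longrightarrow> \<pi> (\<beta> x) = \<alpha> (\<pi> x)"
      using auto_pullback[OF W \<pi>(1) \<alpha>(1)] by blast
    let ?g = "compose (carrier ?A) \<beta> f"
    have g: "?g \<in> P" unfolding P_W by (rule proper_up_to_center_epi_compose[OF A W f[unfolded P_W] \<beta>(1)])
    then have gH: "?g \<in> ?H" unfolding P_iff by blast
    have gen: "\<pi> (?g (\<sigma> i)) = normal_tuple n c a b i" if "i \<in> {1..n}" for i
      using \<alpha>(2)[of i] \<beta>(2)[OF Hc[OF fH \<sigma>[OF that]]] \<sigma>[OF that] that by (simp add: compose_eq)
    have "(c, a, b) \<in> {(False, True, True), (True, True, True), (True, False, False)}"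
      using P_normal[OF gH gen] g by blast
    then have "?g = \<mu> \<or> ?g = \<nu>3 \<or> ?g = \<nu>4"
      using unique[OF gH \<mu>(1)] unique[OF gH \<nu>3(1)] unique[OF gH \<nu>4(1)] gen \<mu>(2) \<nu>3(2) \<nu>4(2) by auto
    moreover have "(f, ?g) \<in> E" using fH gH \<beta>(1) unfolding E_W hom_equivalence_def by blast
    ultimately show ?thesis by auto
  qed
  have one_in: "1 \<in> {1..n}" "2 \<in> {1..n}" using assms(1) by auto
  have \<pi>_one: "\<pi> \<one>\<^bsub>W\<^esub> = \<one>\<^bsub>?S\<^esub>" using hom_one[OF \<pi>_hom W S] .
  have not_one: "g (\<sigma> 1) \<noteq> \<one>\<^bsub>W\<^esub>" if "\<pi> (g (\<sigma> 1)) = normal_tuple n c True True 1" for g c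
  proof
    assume "g (\<sigma> 1) = \<one>\<^bsub>W\<^esub>"
    then have "normal_tuple n c True True 1 = \<one>\<^bsub>?S\<^esub>" using that \<pi>_one by simp
    \<comment> \<open>Position 2 shows the sign of \<open>w\<^sub>0\<close>, which multiplication by
      \<open>s 1\<close> leaves unchanged.\<close>
    then have "fst (normal_tuple n c True True 1) 2 = False" by simp
    then show False using assms(1) by (simp add: normal_tuple_def)
  qed
  have \<nu>4_one: "\<nu>4 (\<sigma> 1) = \<one>\<^bsub>W\<^esub>"
  proof (rule \<pi>_eq[OF _ Hc[OF \<nu>4(1) \<sigma>[OF one_in(1)]] W.one_closed])
    show "\<pi> (\<nu>4 (\<sigma> 1)) = \<pi> \<one>\<^bsub>W\<^esub>" using \<nu>4(2)[OF one_in(1)] \<pi>_one by (simp add: normal_tuple_def)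
  qed
  \<comment> \<open>Automorphisms fix the identity, and \<nu>4 alone among the three sends
    \<open>\<sigma> 1\<close> to it.\<close>
  have not_\<nu>4: "(\<nu>4, g) \<notin> E" if g: "\<pi> (g (\<sigma> 1)) = normal_tuple n c True True 1" for g c
  proof
    assume "(\<nu>4, g) \<in> E"
    then obtain \<alpha> where \<alpha>: "\<alpha> \<in> auto W" "g = compose (carrier ?A) \<alpha> \<nu>4"
      unfolding E_W hom_equivalence_def by blast
    have "g (\<sigma> 1) = \<alpha> \<one>\<^bsub>W\<^esub>" using \<alpha>(2) \<sigma>[OF one_in(1)] \<nu>4_one by (simp add: compose_eq)
    also have "\<alpha> \<one>\<^bsub>W\<^esub> = \<one>\<^bsub>W\<^esub>" using hom_one[OF autoD(1)[OF \<alpha>(1)] W W] .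
    finally show False using not_one[where g = g and c = c, OF g] by blast
  qed
  \<comment> \<open>The two agree on \<open>\<sigma> 1\<close> and are separated at
    \<open>\<sigma> 2\<close>: its image under \<mu> is an involution, whereas under \<nu>3 its
    square changes the signs at 1 and 2.\<close>
  have \<mu>_\<nu>3: "(\<mu>, \<nu>3) \<notin> E"
  proof
    assume "(\<mu>, \<nu>3) \<in> E"
    then obtain \<alpha> where \<alpha>: "\<alpha> \<in> auto W" "\<nu>3 = compose (carrier ?A) \<alpha> \<mu>"
      unfolding E_W hom_equivalence_def by blast
    let ?m = "\<mu> (\<sigma> 2)"
    have m: "?m \<in> carrier W" using Hc[OF \<mu>(1) \<sigma>[OF one_in(2)]] .
    have "\<pi> (?m \<otimes>\<^bsub>W\<^esub> ?m) = \<pi> \<one>\<^bsub>W\<^esub>"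
      using \<mu>(2)[OF one_in(2)] by (simp add: \<pi>_mult[OF m m] \<pi>_one normal_tuple_def)
    then have sq: "?m \<otimes>\<^bsub>W\<^esub> ?m = \<one>\<^bsub>W\<^esub>" using \<pi>_eq m by simp
    have "\<nu>3 (\<sigma> 2) = \<alpha> ?m" using \<alpha>(2) \<sigma>[OF one_in(2)] by (simp add: compose_eq)
    then have "\<nu>3 (\<sigma> 2) \<otimes>\<^bsub>W\<^esub> \<nu>3 (\<sigma> 2) = \<alpha> (?m \<otimes>\<^bsub>W\<^esub> ?m)"
      using hom_mult[OF autoD(1)[OF \<alpha>(1)] m m] by simp
    also have "\<dots> = \<one>\<^bsub>W\<^esub>" unfolding sq using hom_one[OF autoD(1)[OF \<alpha>(1)] W W] .
    finally have "\<pi> (\<nu>3 (\<sigma> 2)) \<otimes>\<^bsub>?S\<^esub> \<pi> (\<nu>3 (\<sigma> 2)) = \<one>\<^bsub>?S\<^esub>"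
      using \<pi>_mult[OF Hc[OF \<nu>3(1) \<sigma>[OF one_in(2)]] Hc[OF \<nu>3(1) \<sigma>[OF one_in(2)]]] \<pi>_one by simp
    then have "fst (normal_tuple n True True True 2 \<otimes>\<^bsub>?S\<^esub> normal_tuple n True True True 2) 2 = False"
      using \<nu>3(2)[OF one_in(2)] by simp
    then show False by (simp add: fst_sp_mult normal_tuple_def)
  qed
  have quotient: "P // E = {E `` {\<mu>}, E `` {\<nu>3}, E `` {\<nu>4}}"
  proof
    show "P // E \<subseteq> {E `` {\<mu>}, E `` {\<nu>3}, E `` {\<nu>4}}"
    proof
      fix X assume "X \<in> P // E"
      then obtain f where f: "f \<in> P" "X = E `` {f}" by (rule quotientE)
      obtain g where "g \<in> {\<mu>, \<nu>3, \<nu>4}" "(f, g) \<in> E" using classify[OF f(1)] by blast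
      then show "X \<in> {E `` {\<mu>}, E `` {\<nu>3}, E `` {\<nu>4}}"
        using equiv_class_eq[OF equivE] f(2) by blast
    qed
    show "{E `` {\<mu>}, E `` {\<nu>3}, E `` {\<nu>4}} \<subseteq> P // E" using inP by (auto intro: quotientI)
  qed
  have "E `` {\<mu>} \<noteq> E `` {\<nu>3}" using \<mu>_\<nu>3 eq_equiv_class[OF _ equivE \<nu>3(1)] by blast
  moreover have "E `` {\<nu>4} \<noteq> E `` {\<mu>}"
    using not_\<nu>4[where g = \<mu> and c = False, OF \<mu>(2)[OF one_in(1)]] eq_equiv_class[OF _ equivE \<mu>(1)] by blast
  moreover have "E `` {\<nu>4} \<noteq> E `` {\<nu>3}"
    using not_\<nu>4[where g = \<nu>3 and c = True, OF \<nu>3(2)[OF one_in(1)]] eq_equiv_class[OF _ equivE \<nu>3(1)] by blast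
  ultimately have card: "card (P // E) = 3" unfolding quotient by (auto simp: card_insert_if)
  have w0s1: "g (\<sigma> 1) = w\<^sub>0 \<otimes>\<^bsub>W\<^esub> s 1" if "g \<in> ?H" "\<pi> (g (\<sigma> 1)) = normal_tuple n c True True 1" for g c
  proof (rule \<pi>_eq[OF _ Hc[OF that(1) \<sigma>[OF one_in(1)]] W.m_closed[OF w0(1) s[OF one_in(1)]]])
    show "\<pi> (g (\<sigma> 1)) = \<pi> (w\<^sub>0 \<otimes>\<^bsub>W\<^esub> s 1)"
      unfolding that(2) \<pi>_mult[OF w0(1) s[OF one_in(1)]] w0(2) \<pi>(2)[OF one_in(1)]
      using n1 by (auto simp: normal_tuple_def signed_gen_def fun_eq_iff)
  qed
  have si: "g (\<sigma> i) = s i" if "g \<in> ?H" "\<pi> (g (\<sigma> i)) = normal_tuple n False a b i" "i \<in> {2..n}" for g a b i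
  proof -
    have i: "i \<in> {1..n}" using that(3) by auto
    show ?thesis
      by (rule \<pi>_eq[OF _ Hc[OF that(1) \<sigma>[OF i]] s[OF i]])
        (use that(2,3) \<pi>(2)[OF i] in \<open>simp add: normal_tuple_def signed_gen_def\<close>)
  qed
  have ei: "g (\<sigma> i) = e (i - 1) \<otimes>\<^bsub>W\<^esub> s i" if "g \<in> ?H" "\<pi> (g (\<sigma> i)) = normal_tuple n True a b i" "i \<in> {2..n}" for g a b i
  proof -
    have i: "i \<in> {1..n}" "1 \<le> i - 1" "i - 1 \<le> n" "i \<noteq> 1" "i \<noteq> i - 1" using that(3) by auto
    have t: "transpose (i - 1) i k = i - 1 \<longleftrightarrow> k = i" for k using i(5) by (auto simp: transpose_def)
    show ?thesis
    proof (rule \<pi>_eq[OF _ Hc[OF that(1) \<sigma>[OF i(1)]] W.m_closed[OF e(1)[OF i(2,3)] s[OF i(1)]]])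
      show "\<pi> (g (\<sigma> i)) = \<pi> (e (i - 1) \<otimes>\<^bsub>W\<^esub> s i)"
        unfolding that(2) \<pi>_mult[OF e(1)[OF i(2,3)] s[OF i(1)]] e(2)[OF i(2,3)] \<pi>(2)[OF i(1)]
        using i(4) t by (simp add: normal_tuple_def signed_gen_def)
    qed
  qed
  have sub: "i \<in> {1..n}" if "i \<in> {2..n}" for i using that by auto
  show ?thesis
  proof (intro exI conjI ballI)
    show "\<mu> (\<sigma> 1) = w\<^sub>0 \<otimes>\<^bsub>W\<^esub> s 1" "\<nu>3 (\<sigma> 1) = w\<^sub>0 \<otimes>\<^bsub>W\<^esub> s 1"
      using w0s1[where g = \<mu> and c = False, OF \<mu>(1) \<mu>(2)[OF one_in(1)]] w0s1[where g = \<nu>3 and c = True, OF \<nu>3(1) \<nu>3(2)[OF one_in(1)]] .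
    show "\<mu> (\<sigma> i) = s i" if "i \<in> {2..n}" for i using si[where g = \<mu> and a = True and b = True, OF \<mu>(1) \<mu>(2)[OF sub[OF that]] that] .
    show "\<nu>3 (\<sigma> i) = e (i - 1) \<otimes>\<^bsub>W\<^esub> s i" if "i \<in> {2..n}" for i
      using ei[where g = \<nu>3 and a = True and b = True, OF \<nu>3(1) \<nu>3(2)[OF sub[OF that]] that] .
    show "\<nu>4 (\<sigma> i) = e (i - 1) \<otimes>\<^bsub>W\<^esub> s i" if "i \<in> {2..n}" for i
      using ei[where g = \<nu>4 and a = False and b = False, OF \<nu>4(1) \<nu>4(2)[OF sub[OF that]] that] .
  qed (fact inP \<nu>4_one card quotient)+
qed

end
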